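(* Let $n\ge 1$, let $V:\mathbb{R}^n\to\mathbb{R}$ be a potential and let $H=-\Delta+V$ be a self-adjoint Schrödinger operator on $L^2(\mathbb{R}^n)$ satisfying the Kernel Decay Assumption (see context). Let $\{\varphi_j\}_{j\in\mathbb{Z}}\subset C_0^\infty(\mathbb{R})$ be a system satisfying conditions (i), (ii), (iii) of the context. Then the following equivalences of quasi-norms hold, with constants independent of $f\in\mathcal{S}(\mathbb{R}^n)$. (a) If $0<p\le\infty$, $0<q\le\infty$, $\alpha\in\mathbb{R}$ and $s>n/p$, then $$\|f\|_{\dot B_p^{\alpha,q}(H)}\approx \Big(\sum_{j\in\mathbb{Z}}2^{j\alpha q}\,\|\varphi_{j,s}^*f\|_{L^p(\mathbb{R}^n)}^q\Big)^{1/q}.$$ (b) If $0<p<\infty$, $0<q\le\infty$, $\alpha\in\mathbb{R}$ and $s>n/\min(p,q)$, then $$\|f\|_{\dot F_p^{\alpha,q}(H)}\approx \Big\|\Big(\sum_{j\in\mathbb{Z}}2^{j\alpha q}\,|\varphi_{j,s}^*f|^q\Big)^{1/q}\Big\|_{L^p(\mathbb{R}^n)}.$$ (For $q=\infty$ the $\ell^q$ sums are replaced by suprema over $j$.)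
   Context: Functional calculus: for Borel $\phi:\mathbb{R}\to\mathbb{C}$, $\phi(H)=\int\phi(\lambda)\,dE_\lambda$, where $H=\int\lambda\,dE_\lambda$ is the spectral resolution; $\phi(H)(x,y)$ denotes the integral kernel of $\phi(H)$. Conditions on a family $\{\varphi_j\}_{j\in\mathbb{Z}}\subset C_0^\infty(\mathbb{R})$: (i) $\operatorname{supp}\varphi_j\subset\{x:2^{j-2}\le|x|\le 2^j\}$; (ii) $|\varphi_j^{(k)}(x)|\le c_k2^{-kj}$ for all $j\in\mathbb{Z}$, $k\in\mathbb{N}_0=\{0,1,2,\dots\}$; (iii) $\sum_{j\in\mathbb{Z}}|\varphi_j(x)|\approx 1$ for all $x\ne 0$. Kernel Decay Assumption on $H$: for every family $\{\phi_j\}_{j\in\mathbb{Z}}\subset C_0^\infty(\mathbb{R})$ satisfying (i) and (ii), for $\ell=0,1$ and every $N\in\mathbb{N}_0$ there is a constant $c_N>0$ such that for all $j\in\mathbb{Z}$ and $x,y\in\mathbb{R}^n$ $$|\nabla_x^\ell\phi_j(H)(x,y)|\le c_N\frac{2^{(n+\ell)j/2}}{(1+2^{j/2}|x-y|)^N}.$$ Quasi-norms: $\|f\|_{\dot B_p^{\alpha,q}(H)}=\big(\sum_{j\in\mathbb{Z}}2^{j\alpha q}\|\varphi_j(H)f\|_{L^p}^q\big)^{1/q}$ and $\|f\|_{\dot F_p^{\alpha,q}(H)}=\big\|\big(\sum_{j\in\mathbb{Z}}2^{j\alpha q}|\varphi_j(H)f|^q\big)^{1/q}\big\|_{L^p}$;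 the spaces $\dot B_p^{\alpha,q}(H)$, $\dot F_p^{\alpha,q}(H)$ are the completions of $\mathcal{S}(\mathbb{R}^n)$ in these quasi-norms. Peetre-type maximal function: for $j\in\mathbb{Z}$, $s>0$, $\varphi_{j,s}^*f(x)=\sup_{t\in\mathbb{R}^n}\dfrac{|\varphi_j(H)f(t)|}{(1+2^{j/2}|x-t|)^s}$. $A\approx B$ means $c^{-1}A\le B\le cA$ for a constant $c>0$ (both sides may be infinite). *)

theory Defs
  imports "HOL-Probability.Essential_Supremum" "HOL-Analysis.Analysis"
begin

section \<open>Smooth functions\<close>

definition pdiff :: "'a::euclidean_space \<Rightarrow> ('a \<Rightarrow> complex) \<Rightarrow> 'a \<Rightarrow> complex" where
  "pdiff b f x = frechet_derivative f (at x) b"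

definition smooth :: "('a::euclidean_space \<Rightarrow> complex) \<Rightarrow> bool" where
  "smooth f \<longleftrightarrow> (\<forall>bs\<in>lists Basis. \<forall>x. foldr pdiff bs f differentiable (at x))"

definition test_functions :: "('a::euclidean_space \<Rightarrow> complex) set" where
  "test_functions = {f. smooth f \<and> compact (closure {x. f x \<noteq> 0})}"

definition schwartz_space :: "('a::euclidean_space \<Rightarrow> complex) set" where
  "schwartz_space = {f. smooth f \<and>
     (\<forall>bs\<in>lists Basis. \<forall>k::nat. \<exists>C. \<forall>x. (1 + norm x) ^ k * norm (foldr pdiff bs f x) \<le> C)}"

definition gradient :: "(real^'n \<Rightarrow> complex) \<Rightarrow> real^'n \<Rightarrow> complex^'n" where
  "gradient f x = (\<chi> i. pdiff (axis i 1) f x)"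

definition laplacian :: "('a::euclidean_space \<Rightarrow> complex) \<Rightarrow> 'a \<Rightarrow> complex" where
  "laplacian f x = (\<Sum>b\<in>Basis. pdiff b (pdiff b f) x)"


section \<open>Self-adjoint operators on \<open>L\<^sup>2\<close>\<close>

text \<open>
  Elements of \<open>L\<^sup>2\<close> are represented by functions, with almost everywhere equality made explicit
  where it matters. An unbounded operator is represented by its graph, the set of all pairs
  \<open>(f, h)\<close> such that \<open>f\<close> lies in the domain and \<open>h\<close> is a representative of the image of \<open>f\<close>.
\<close>

definition L2 :: "('a::euclidean_space \<Rightarrow> complex) set" where
  "L2 = {f \<in> borel_measurable lborel. integrable lborel (\<lambda>x. (norm (f x))\<^sup>2)}"

definition l2_inner :: "('a::euclidean_space \<Rightarrow> complex) \<Rightarrow> ('a \<Rightarrow> complex) \<Rightarrow> complex" where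
  "l2_inner f g = (\<integral>x. f x * cnj (g x) \<partial>lborel)"

definition l2_norm :: "('a::euclidean_space \<Rightarrow> complex) \<Rightarrow> real" where
  "l2_norm f = sqrt (\<integral>x. (norm (f x))\<^sup>2 \<partial>lborel)"

type_synonym 'a l2_operator = "(('a \<Rightarrow> complex) \<times> ('a \<Rightarrow> complex)) set"

definition adjoint_operator :: "'a::euclidean_space l2_operator \<Rightarrow> 'a l2_operator" where
  "adjoint_operator T =
     {(g, h). g \<in> L2 \<and> h \<in> L2 \<and> (\<forall>(f, u)\<in>T. l2_inner u g = l2_inner f h)}"

definition densely_defined :: "'a::euclidean_space l2_operator \<Rightarrow> bool" where
  "densely_defined T \<longleftrightarrow> (\<forall>f\<in>L2. \<forall>e>0. \<exists>g\<in>Domain T. l2_norm (\<lambda>x. f x - g x) < e)"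

text \<open>
  An adjoint is always a linear subspace closed under almost everywhere equality, and the adjoint
  of a densely defined operator is single-valued up to null sets; so these properties of an
  operator need not be listed separately.
\<close>

definition self_adjoint :: "'a::euclidean_space l2_operator \<Rightarrow> bool" where
  "self_adjoint T \<longleftrightarrow> T \<subseteq> L2 \<times> L2 \<and> densely_defined T \<and> adjoint_operator T = T"

text \<open>
  \<open>H f = -\<Delta> f + V f\<close> is understood in the sense of distributions. This covers
  operator sums, form sums and all self-adjoint extensions of \<open>-\<Delta> + V\<close> on test functions
  with \<open>V\<close> locally square integrable.
\<close>

definition schrodinger_operator :: "(real^'n \<Rightarrow> real) \<Rightarrow> (real^'n) l2_operator \<Rightarrow> bool" where
  "schrodinger_operator V H \<longleftrightarrow> self_adjoint H \<and>
     (\<forall>(f, h)\<in>H.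
        (\<forall>K. compact K \<longrightarrow> set_integrable lborel K (\<lambda>x. of_real (V x) * f x)) \<and>
        (\<forall>\<psi>\<in>test_functions.
           (\<integral>x. h x * \<psi> x \<partial>lborel) =
           (\<integral>x. f x * (- laplacian \<psi> x) \<partial>lborel) + (\<integral>x. of_real (V x) * f x * \<psi> x \<partial>lborel)))"


section \<open>Spectral resolution and functional calculus\<close>

text \<open>
  A spectral resolution is given as a projection-valued measure \<open>E\<close> on the Borel sets of the real
  line; the spectral family is \<open>E\<^sub>\<lambda> = E {..\<lambda>}\<close>. Each \<open>E A\<close> acts on representatives of \<open>L\<^sup>2\<close> classes;
  linearity and compatibility with almost everywhere equality follow from symmetry.
\<close>

definition orthogonal_projection ::
    "(('a::euclidean_space \<Rightarrow> complex) \<Rightarrow> ('a \<Rightarrow> complex)) \<Rightarrow> bool" where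
  "orthogonal_projection P \<longleftrightarrow>
     (\<forall>f\<in>L2. P f \<in> L2 \<and> (AE x in lborel. P (P f) x = P f x)) \<and>
     (\<forall>f\<in>L2. \<forall>g\<in>L2. l2_inner (P f) g = l2_inner f (P g))"

definition projection_valued_measure ::
    "(real set \<Rightarrow> ('a::euclidean_space \<Rightarrow> complex) \<Rightarrow> ('a \<Rightarrow> complex)) \<Rightarrow> bool" where
  "projection_valued_measure E \<longleftrightarrow>
     (\<forall>A\<in>sets borel. orthogonal_projection (E A)) \<and>
     (\<forall>f\<in>L2. AE x in lborel. E UNIV f x = f x) \<and>
     (\<forall>A\<in>sets borel. \<forall>B\<in>sets borel. \<forall>f\<in>L2. AE x in lborel. E (A \<inter> B) f x = E A (E B f) x) \<and>
     (\<forall>A. range A \<subseteq> sets borel \<longrightarrow> disjoint_family A \<longrightarrow>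
        (\<forall>f\<in>L2. (\<lambda>m::nat. l2_norm (\<lambda>x. E (\<Union>i. A i) f x - (\<Sum>i<m. E (A i) f x))) \<longlonglongrightarrow> 0))"

definition spectral_measure ::
    "(real set \<Rightarrow> ('a::euclidean_space \<Rightarrow> complex) \<Rightarrow> ('a \<Rightarrow> complex)) \<Rightarrow> ('a \<Rightarrow> complex) \<Rightarrow> real measure" where
  "spectral_measure E f = measure_of UNIV (sets borel) (\<lambda>A. ennreal (Re (l2_inner (E A f) f)))"

definition spectral_domain ::
    "(real set \<Rightarrow> ('a::euclidean_space \<Rightarrow> complex) \<Rightarrow> ('a \<Rightarrow> complex)) \<Rightarrow> (real \<Rightarrow> complex) \<Rightarrow> ('a \<Rightarrow> complex) set" where
  "spectral_domain E \<phi> = {f \<in> L2. (\<integral>\<^sup>+t. ennreal ((norm (\<phi> t))\<^sup>2) \<partial>spectral_measure E f) < \<infinity>}"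

text \<open>
  The integral of \<open>\<phi>\<close> against the complex measure \<open>A \<mapsto> \<langle>E(A) f, g\<rangle>\<close>, which by polarization is a
  combination of four finite positive measures.
\<close>

definition spectral_form ::
    "(real set \<Rightarrow> ('a::euclidean_space \<Rightarrow> complex) \<Rightarrow> ('a \<Rightarrow> complex)) \<Rightarrow> (real \<Rightarrow> complex) \<Rightarrow>
     ('a \<Rightarrow> complex) \<Rightarrow> ('a \<Rightarrow> complex) \<Rightarrow> complex" where
  "spectral_form E \<phi> f g =
     (\<Sum>k<4::nat. \<i> ^ k * (\<integral>t. \<phi> t \<partial>spectral_measure E (\<lambda>x. f x + \<i> ^ k * g x))) / 4"

text \<open>The operator \<open>\<integral> \<phi> dE\<close>, for Borel functions \<open>\<phi>\<close>.\<close>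

definition spectral_integral ::
    "(real set \<Rightarrow> ('a::euclidean_space \<Rightarrow> complex) \<Rightarrow> ('a \<Rightarrow> complex)) \<Rightarrow> (real \<Rightarrow> complex) \<Rightarrow> 'a l2_operator" where
  "spectral_integral E \<phi> =
     {(f, h). f \<in> spectral_domain E \<phi> \<and> h \<in> L2 \<and>
        (\<forall>g\<in>spectral_domain E \<phi>. l2_inner h g = spectral_form E \<phi> f g)}"

definition spectral_resolution ::
    "'a::euclidean_space l2_operator \<Rightarrow> (real set \<Rightarrow> ('a \<Rightarrow> complex) \<Rightarrow> ('a \<Rightarrow> complex)) \<Rightarrow> bool" where
  "spectral_resolution H E \<longleftrightarrow>
     projection_valued_measure E \<and> H = spectral_integral E (\<lambda>t. of_real t)"

text \<open>\<open>T\<close> is defined on all of \<open>L\<^sup>2\<close> and is integration against \<open>K\<close>.\<close>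

definition integral_kernel ::
    "'a::euclidean_space l2_operator \<Rightarrow> ('a \<Rightarrow> 'a \<Rightarrow> complex) \<Rightarrow> bool" where
  "integral_kernel T K \<longleftrightarrow>
     (\<lambda>(x, y). K x y) \<in> borel_measurable borel \<and>
     (\<forall>f\<in>L2. (AE x in lborel. integrable lborel (\<lambda>y. K x y * f y)) \<and>
              (f, \<lambda>x. \<integral>y. K x y * f y \<partial>lborel) \<in> T)"

text \<open>
  The function \<open>\<phi>(H) f\<close> evaluated at points. It is an \<open>L\<^sup>2\<close> class, and values at points
  are those of its continuous representative, which is unique; if \<open>\<phi>(H)\<close> has a kernel satisfying the
  decay bounds below, this representative exists and is \<open>\<lambda>x. \<integral>y. \<phi>(H)(x,y) f(y)\<close>.
\<close>

definition spectral_apply ::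
    "(real set \<Rightarrow> ('a::euclidean_space \<Rightarrow> complex) \<Rightarrow> ('a \<Rightarrow> complex)) \<Rightarrow> (real \<Rightarrow> complex) \<Rightarrow>
     ('a \<Rightarrow> complex) \<Rightarrow> 'a \<Rightarrow> complex" where
  "spectral_apply E \<phi> f = (THE g. continuous_on UNIV g \<and> (f, g) \<in> spectral_integral E \<phi>)"


section \<open>Dyadic systems and kernel decay\<close>

definition dyadic_family :: "(int \<Rightarrow> real \<Rightarrow> complex) \<Rightarrow> bool" where
  "dyadic_family \<phi> \<longleftrightarrow>
     (\<forall>j. \<phi> j \<in> test_functions) \<and>
     (\<forall>j. closure {x. \<phi> j x \<noteq> 0} \<subseteq> {x. 2 powr (of_int j - 2) \<le> \<bar>x\<bar> \<and> \<bar>x\<bar> \<le> 2 powr of_int j}) \<and>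
     (\<exists>c::nat \<Rightarrow> real. \<forall>k j x. norm ((pdiff 1 ^^ k) (\<phi> j) x) \<le> c k * 2 powr (- (of_nat k * of_int j)))"

definition dyadic_system :: "(int \<Rightarrow> real \<Rightarrow> complex) \<Rightarrow> bool" where
  "dyadic_system \<phi> \<longleftrightarrow> dyadic_family \<phi> \<and>
     (\<exists>c>0. \<forall>x. x \<noteq> 0 \<longrightarrow>
        1 / c \<le> (\<Sum>\<^sub>\<infinity>j\<in>UNIV. norm (\<phi> j x)) \<and> (\<Sum>\<^sub>\<infinity>j\<in>UNIV. norm (\<phi> j x)) \<le> c)"

text \<open>
  A kernel is determined by \<open>\<phi>\<^sub>j(H)\<close> only up to null sets; as the gradient in \<open>x\<close> is to be bounded
  at every point, some version differentiable in \<open>x\<close> is meant.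
\<close>

definition kernel_decay ::
    "(real set \<Rightarrow> (real^'n \<Rightarrow> complex) \<Rightarrow> (real^'n \<Rightarrow> complex)) \<Rightarrow> bool" where
  "kernel_decay E \<longleftrightarrow>
     (\<forall>\<phi>. dyadic_family \<phi> \<longrightarrow>
        (\<exists>K. (\<forall>j. integral_kernel (spectral_integral E (\<phi> j)) (K j)) \<and>
             (\<forall>j x y. (\<lambda>x. K j x y) differentiable (at x)) \<and>
             (\<forall>N::nat. \<exists>c>0. \<forall>j x y.
                norm (K j x y) \<le>
                  c * 2 powr (of_nat CARD('n) * of_int j / 2)
                    / (1 + 2 powr (of_int j / 2) * norm (x - y)) ^ N \<and>
                norm (gradient (\<lambda>x. K j x y) x) \<le>
                  c * 2 powr ((of_nat CARD('n) + 1) * of_int j / 2)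
                    / (1 + 2 powr (of_int j / 2) * norm (x - y)) ^ N)))"


section \<open>Quasi-norms\<close>

text \<open>Powers with exponent \<open>a > 0\<close> of values that may be infinite.\<close>

definition epowr :: "ennreal \<Rightarrow> real \<Rightarrow> ennreal" where
  "epowr x a = (if x = \<infinity> then \<infinity> else ennreal (enn2real x powr a))"

text \<open>For \<open>p = \<infinity>\<close> and \<open>q = \<infinity>\<close> the quasi-norms below are the usual (essential) suprema.\<close>

definition Lp_norm :: "ennreal \<Rightarrow> ('a::euclidean_space \<Rightarrow> ennreal) \<Rightarrow> ennreal" where
  "Lp_norm p F = (if p = \<infinity> then esssup lborel F
     else epowr (\<integral>\<^sup>+x. epowr (F x) (enn2real p) \<partial>lborel) (1 / enn2real p))"

definition lq_norm :: "real \<Rightarrow> ennreal \<Rightarrow> (int \<Rightarrow> ennreal) \<Rightarrow> ennreal" where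
  "lq_norm \<alpha> q a = (if q = \<infinity> then (SUP j. ennreal (2 powr (of_int j * \<alpha>)) * a j)
     else epowr (\<integral>\<^sup>+j. ennreal (2 powr (of_int j * \<alpha> * enn2real q)) * epowr (a j) (enn2real q)
                   \<partial>count_space UNIV) (1 / enn2real q))"

definition besov_norm ::
    "(real set \<Rightarrow> ('a::euclidean_space \<Rightarrow> complex) \<Rightarrow> ('a \<Rightarrow> complex)) \<Rightarrow> (int \<Rightarrow> real \<Rightarrow> complex) \<Rightarrow> real \<Rightarrow> ennreal \<Rightarrow> ennreal \<Rightarrow> ('a \<Rightarrow> complex) \<Rightarrow> ennreal" where
  "besov_norm E \<phi> \<alpha> p q f =
     lq_norm \<alpha> q (\<lambda>j. Lp_norm p (\<lambda>x. ennreal (norm (spectral_apply E (\<phi> j) f x))))"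

definition triebel_lizorkin_norm ::
    "(real set \<Rightarrow> ('a::euclidean_space \<Rightarrow> complex) \<Rightarrow> ('a \<Rightarrow> complex)) \<Rightarrow> (int \<Rightarrow> real \<Rightarrow> complex) \<Rightarrow> real \<Rightarrow> ennreal \<Rightarrow> ennreal \<Rightarrow> ('a \<Rightarrow> complex) \<Rightarrow> ennreal" where
  "triebel_lizorkin_norm E \<phi> \<alpha> p q f =
     Lp_norm p (\<lambda>x. lq_norm \<alpha> q (\<lambda>j. ennreal (norm (spectral_apply E (\<phi> j) f x))))"

definition peetre_maximal ::
    "(real set \<Rightarrow> ('a::euclidean_space \<Rightarrow> complex) \<Rightarrow> ('a \<Rightarrow> complex)) \<Rightarrow> (int \<Rightarrow> real \<Rightarrow> complex) \<Rightarrow> int \<Rightarrow> real \<Rightarrow> ('a \<Rightarrow> complex) \<Rightarrow> 'a \<Rightarrow> ennreal" where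
  "peetre_maximal E \<phi> j s f x =
     (SUP t. ennreal (norm (spectral_apply E (\<phi> j) f t) / (1 + 2 powr (of_int j / 2) * norm (x - t)) powr s))"

definition equivalent_on :: "'f set \<Rightarrow> ('f \<Rightarrow> ennreal) \<Rightarrow> ('f \<Rightarrow> ennreal) \<Rightarrow> bool" where
  "equivalent_on S A B \<longleftrightarrow>
     (\<exists>c>0. \<forall>f\<in>S. ennreal (1 / c) * A f \<le> B f \<and> B f \<le> ennreal c * A f)"

end

theory Submission
  imports Defs
begin

text \<open>
  For a smooth dyadic partition of unity \<open>\<psi>\<close>, the function \<open>f\<^sub>j = \<phi>\<^sub>j(H) f\<close> reproduces itself as
  \<open>f\<^sub>j = \<Sum>\<^sub>i \<psi>\<^sub>i(H) f\<^sub>j\<close> over \<open>\<bar>i - j\<bar> \<le> 1\<close>. The gradient bounds for the kernels of \<open>\<psi>\<^sub>i(H)\<close> then show that,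
  relative to its Peetre maximal function, \<open>f\<^sub>j\<close> hardly varies on balls of radius \<open>d 2\<^bsup>-j/2\<^esup>\<close> with
  \<open>d\<close> small. So the maximal function at \<open>x\<close> is at most twice the supremum over \<open>t\<close> of the infimum of
  \<open>\<bar>f\<^sub>j\<bar>\<close> on the ball around \<open>t\<close>, weighted by \<open>(1 + 2\<^bsup>j/2\<^esup> \<bar>x - t\<bar>)\<^bsup>-s\<^esup>\<close>: the
  error is at most half of the maximal function, which is finite since \<open>f\<^sub>j\<close> is bounded. Decomposing into shells \<open>\<bar>x - t\<bar> \<le> 2\<^bsup>k-j/2\<^esup>\<close> and replacing infima by averages of \<open>\<bar>f\<^sub>j\<bar>\<^bsup>a\<^esup>\<close>
  costs a factor \<open>2\<^bsup>kn\<^esup>\<close>, which the weight \<open>2\<^bsup>-ksa\<^esup>\<close> compensates when \<open>sa > n\<close>.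

  With \<open>a = p\<close>, integration in \<open>x\<close> gives the Besov case and the case \<open>q = p\<close>. For \<open>q < p\<close> take \<open>a = q\<close> and use
  that ball averages are symmetric and dominated by the Hardy-Littlewood maximal function, which is bounded on
  the dual Lebesgue space. For \<open>q = \<infinity>\<close> the maximal function applies directly, with \<open>a\<close> slightly below \<open>p\<close>.
  For \<open>p < q < \<infinity>\<close> a good-\<open>\<lambda>\<close> argument needs only the weak type inequality: off a small set, the infima
  are controlled by averages over the part of the ball where the square function is below the level.
\<close>

section \<open>Smooth dyadic partitions of unity\<close>

text \<open>Condition (iii) yields no identity for the given system, so the reproducing formula is
  borrowed from an auxiliary partition; the Kernel Decay Assumption quantifies over all families
  with (i) and (ii) and therefore supplies kernels for it, with constants uniform in
  \<open>j\<close>. Exponents below 1 are allowed and no analyticity of \<open>f\<^sub>j\<close> is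
  at hand, so a mean value inequality for powers has to be manufactured: an infimum over a small
  ball, raised to any power \<open>a > 0\<close>, is at most the average of the \<open>a\<close>-th
  power, and slow variation compares the function with this infimum up to an absorbed error. After
  raising to powers, the relation between \<open>p\<close> and \<open>q\<close> shows up as the
  outer exponent \<open>p / q\<close>. At 1, sum and integral are exchanged; above 1, one can test
  against a dual function; below 1 there is no duality, hence the argument by level sets. The lower
  bound in both equivalences is the choice \<open>t = x\<close> in the supremum.\<close>

definition derivative_sequence :: "(nat \<Rightarrow> real \<Rightarrow> 'b::real_normed_vector) \<Rightarrow> bool" where
  "derivative_sequence F \<longleftrightarrow> (\<forall>k x. (F k has_vector_derivative F (Suc k) x) (at x))"

lemma pdiff_1_eqI:
  assumes "\<And>x. (f has_vector_derivative f' x) (at x)"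
  shows "pdiff 1 f = f'"
proof
  fix x
  have "frechet_derivative f (at x) = (\<lambda>h. h *\<^sub>R f' x)"
    using assms[of x] unfolding has_vector_derivative_def by (rule frechet_derivative_at[symmetric])
  then show "pdiff 1 f x = f' x" by (simp add: pdiff_def)
qed

lemma pdiff_power_derivative_sequence:
  assumes "derivative_sequence F"
  shows "(pdiff 1 ^^ k) (F 0) = F k"
proof (induction k)
  case (Suc k)
  then show ?case using assms by (auto simp: derivative_sequence_def intro!: pdiff_1_eqI)
qed simp

text \<open>On the real line the only basis vector is 1, so every word of directions in
  \<open>smooth\<close> is a power of \<open>pdiff 1\<close>, and the chain \<open>F\<close> lists
  all of these.\<close>

lemma smooth_derivative_sequence:
  assumes "derivative_sequence F"
  shows "smooth (F 0)"
  unfolding smooth_def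
proof (intro ballI allI)
  fix bs :: "real list" and x :: real
  assume "bs \<in> lists Basis"
  then have "foldr pdiff bs (F 0) = (pdiff 1 ^^ length bs) (F 0)"
    by (induction bs) auto
  also have "\<dots> = F (length bs)" by (rule pdiff_power_derivative_sequence[OF assms])
  finally show "foldr pdiff bs (F 0) differentiable at x"
    using assms unfolding derivative_sequence_def has_vector_derivative_def differentiable_def by auto
qed

text \<open>Smoothness from a closure property: dependent choice strings successive derivatives
  together inside a class that is stable under differentiation.\<close>

lemma derivative_sequence_closure:
  assumes "f \<in> S" "\<And>f. f \<in> S \<Longrightarrow> \<exists>g\<in>S. \<forall>x. (f has_vector_derivative g x) (at x)"
  shows "\<exists>F. derivative_sequence F \<and> F 0 = f"
proof -
  have "\<exists>F. \<forall>k. (F k \<in> S \<and> (k = 0 \<longrightarrow> F k = f)) \<and> (\<forall>x. (F k has_vector_derivative F (Suc k) x) (at x))"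
    by (rule dependent_nat_choice) (use assms in auto)
  then show ?thesis unfolding derivative_sequence_def by metis
qed

text \<open>Carries the vanishing outside a compact interval over to all derivatives, so that their
  maxima on the interval bound them on the whole line.\<close>

lemma derivative_sequence_zero_on_open:
  assumes F: "derivative_sequence F" and U: "open U" "\<And>x. x \<in> U \<Longrightarrow> F 0 x = 0" and x: "x \<in> U"
  shows "F k x = 0"
  using x
proof (induction k arbitrary: x)
  case (Suc k)
  have "((\<lambda>_. 0) has_vector_derivative F (Suc k) x) (at x)"
  proof (rule has_vector_derivative_transform_within_open[OF _ U(1) Suc.prems])
    show "(F k has_vector_derivative F (Suc k) x) (at x)" using F by (simp add: derivative_sequence_def)
  qed (rule Suc.IH)
  then show ?case by (rule vector_derivative_unique_at[OF _ has_vector_derivative_const])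
qed (use U in auto)

text \<open>The function exp(-1/x) with polynomial prefactors in 1/x. These prefactors make the
  class closed under differentiation: the derivative of P(1/x) exp(-1/x) is (P - P')(1/x) exp(-1/x)
  / x^2.\<close>

definition flat :: "real poly \<Rightarrow> real \<Rightarrow> real" where
  "flat P x = (if x > 0 then poly P (1 / x) * exp (- (1 / x)) else 0)"

lemma poly_div_exp_tendsto_0: "((\<lambda>x. poly P x * exp (- x)) \<longlongrightarrow> (0::real)) at_top"
proof -
  have "((\<lambda>x. \<Sum>i\<le>degree P. coeff P i * (x ^ i / exp x)) \<longlongrightarrow> (\<Sum>i\<le>degree P. coeff P i * 0)) at_top"
    by (intro tendsto_intros tendsto_power_div_exp_0)
  then show ?thesis
    by (simp add: poly_altdef sum_divide_distrib exp_minus divide_inverse[symmetric])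
qed

lemma flat_tendsto_0: "(flat P \<longlongrightarrow> 0) (at 0)"
proof -
  have "((\<lambda>x. poly P (inverse x) * exp (- inverse x)) \<longlongrightarrow> 0) (at_right 0)"
    by (rule filterlim_compose[OF poly_div_exp_tendsto_0 filterlim_inverse_at_top_right])
  then have "(flat P \<longlongrightarrow> 0) (at_right 0)"
    by (rule Lim_transform_eventually) (auto simp: eventually_at_filter flat_def inverse_eq_divide)
  moreover have "(flat P \<longlongrightarrow> 0) (at_left 0)"
    by (rule Lim_transform_eventually[OF tendsto_const]) (auto simp: eventually_at_filter flat_def)
  ultimately show ?thesis by (simp add: filterlim_at_split)
qed

lemma flat_has_derivative:
  "(flat P has_vector_derivative flat ([:0,0,1:] * (P - pderiv P)) x) (at x)"
proof -
  let ?Q = "[:0,0,1:] * (P - pderiv P)"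
  consider "x > 0" | "x < 0" | "x = 0" by linarith
  then have "(flat P has_real_derivative flat ?Q x) (at x)"
  proof cases
    case 1
    have "((\<lambda>x. poly P (1 / x) * exp (- (1 / x))) has_real_derivative flat ?Q x) (at x)"
      using 1 by (auto intro!: derivative_eq_intros simp: flat_def field_simps power2_eq_square)
    then show ?thesis
      by (rule has_field_derivative_transform_within_open[where S="{0<..}"]) (use 1 in \<open>auto simp: flat_def\<close>)
  next
    case 2
    have "((\<lambda>x. 0) has_real_derivative flat ?Q x) (at x)"
      using 2 by (simp add: flat_def)
    then show ?thesis
      by (rule has_field_derivative_transform_within_open[where S="{..<0}"]) (use 2 in \<open>auto simp: flat_def\<close>)
  next
    case 3
    \<comment> \<open>The difference quotient of \<open>flat P\<close> at 0 is itself flat: dividing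
      by \<open>h\<close> multiplies the polynomial by its variable.\<close>
    have "((\<lambda>h. flat ([:0,1:] * P) h) \<longlongrightarrow> 0) (at 0)" by (rule flat_tendsto_0)
    then have "((\<lambda>h. (flat P (0 + h) - flat P 0) / h) \<longlongrightarrow> 0) (at 0)"
      by (rule Lim_transform_eventually) (auto simp: eventually_at_filter flat_def)
    moreover have "flat ?Q 0 = 0" by (simp add: flat_def)
    ultimately show ?thesis unfolding 3 DERIV_def by simp
  qed
  then show ?thesis by (simp add: has_real_derivative_iff_has_vector_derivative)
qed

text \<open>Bumps supported in [0, 1]. Closure under differences suffices for closure under
  derivatives, because differentiating the reflected factor produces a minus sign.\<close>

inductive_set flat_products :: "(real \<Rightarrow> real) set" where
  product: "(\<lambda>x. flat P x * flat Q (1 - x)) \<in> flat_products"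
| diff: "f \<in> flat_products \<Longrightarrow> g \<in> flat_products \<Longrightarrow> (\<lambda>x. f x - g x) \<in> flat_products"

lemma flat_products_derivative:
  "f \<in> flat_products \<Longrightarrow> \<exists>g\<in>flat_products. \<forall>x. (f has_vector_derivative g x) (at x)"
proof (induction rule: flat_products.induct)
  case (product P Q)
  let ?D = "\<lambda>P. [:0,0,1:] * (P - pderiv P)"
  have *: "((\<lambda>x. flat P x * flat Q (1 - x)) has_vector_derivative
      flat (?D P) x * flat Q (1 - x) - flat P x * flat (?D Q) (1 - x)) (at x)" for x
  proof -
    have "(flat P has_real_derivative flat (?D P) x) (at x)" "(flat Q has_real_derivative flat (?D Q) (1 - x)) (at (1 - x))"
      using flat_has_derivative by (simp_all add: has_real_derivative_iff_has_vector_derivative)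
    then have "((\<lambda>x. flat P x * flat Q (1 - x)) has_real_derivative
        flat (?D P) x * flat Q (1 - x) + (flat (?D Q) (1 - x) * -1) * flat P x) (at x)"
      by (intro DERIV_mult DERIV_chain2[where g="\<lambda>x. 1 - x"]) (auto intro!: derivative_eq_intros)
    then show ?thesis by (simp add: has_real_derivative_iff_has_vector_derivative mult.commute)
  qed
  show ?case
    by (rule bexI[where x="\<lambda>x. flat (?D P) x * flat Q (1 - x) - flat P x * flat (?D Q) (1 - x)"])
      (use * in \<open>auto intro: flat_products.intros\<close>)
next
  case (diff f g)
  then obtain f' g' where fg: "f' \<in> flat_products" "g' \<in> flat_products"
    "\<And>x. (f has_vector_derivative f' x) (at x)" "\<And>x. (g has_vector_derivative g' x) (at x)" by metis
  then show ?case
    by (intro bexI[where x="\<lambda>x. f' x - g' x"]) (auto intro: flat_products.intros has_vector_derivative_diff)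
qed

text \<open>The bump \<open>?b\<close> is positive on (0, 1) and zero elsewhere, so its
  antiderivative is constant on either side of the interval and strictly larger on the right; an
  affine normalisation gives the values 0 and 1.\<close>

lemma smooth_step:
  "\<exists>F. derivative_sequence F \<and> (\<forall>x\<le>0. F 0 x = (0::real)) \<and> (\<forall>x\<ge>1. F 0 x = 1)"
proof -
  let ?b = "\<lambda>x. flat 1 x * flat 1 (1 - x)"
  obtain B where B: "derivative_sequence B" "B 0 = ?b"
    using derivative_sequence_closure[OF flat_products.product flat_products_derivative] by blast
  have cont: "isCont ?b x" for x
    using B unfolding derivative_sequence_def by (metis has_vector_derivative_continuous)
  obtain G where G: "\<And>x. (G has_vector_derivative ?b x) (at x)"
    using einterval_antiderivative[of "-\<infinity>" "\<infinity>" ?b] cont by auto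
  then have G': "(G has_real_derivative ?b x) (at x)" for x
    by (simp add: has_real_derivative_iff_has_vector_derivative)
  have 0: "G x = G 0" if "x \<le> 0" for x
  proof (cases "x = 0")
    case False
    have d: "(G has_real_derivative 0) (at y)" if "y < 0" for y
      using G'[of y] that by (simp add: flat_def)
    show ?thesis
      by (rule DERIV_isconst2[of x 0 G 0, symmetric])
        (use that False d in \<open>auto intro!: DERIV_continuous_on has_field_derivative_at_within[OF G']\<close>)
  qed simp
  have 1: "G x = G 1" if "x \<ge> 1" for x
  proof (cases "x = 1")
    case False
    have d: "(G has_real_derivative 0) (at y)" if "1 < y" for y
      using G'[of y] that by (simp add: flat_def)
    show ?thesis
      by (rule DERIV_isconst2[of 1 x G x])
        (use that False d in \<open>auto intro!: DERIV_continuous_on has_field_derivative_at_within[OF G']\<close>)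
  qed simp
  have less: "G 0 < G 1"
  proof (rule DERIV_pos_imp_increasing_open[where f=G])
    fix x :: real assume "0 < x" "x < 1"
    then show "\<exists>y. (G has_real_derivative y) (at x) \<and> y > 0"
      using G'[of x] by (intro exI[of _ "?b x"] conjI) (simp_all add: flat_def)
  qed (auto intro!: DERIV_continuous_on has_field_derivative_at_within[OF G'])
  define F where "F = case_nat (\<lambda>x. (G x - G 0) / (G 1 - G 0)) (\<lambda>k x. B k x / (G 1 - G 0))"
  have "derivative_sequence F"
    unfolding derivative_sequence_def
  proof (intro allI)
    fix k x
    show "(F k has_vector_derivative F (Suc k) x) (at x)"
    proof (cases k)
      case 0
      then show ?thesis using G'[of x] less B(2)
        by (auto simp: F_def has_real_derivative_iff_has_vector_derivative[symmetric] intro!: derivative_eq_intros)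
    next
      case (Suc l)
      have "(B l has_real_derivative B (Suc l) x) (at x)"
        using B(1) by (simp add: derivative_sequence_def has_real_derivative_iff_has_vector_derivative)
      then show ?thesis using less unfolding Suc
        by (auto simp: F_def has_real_derivative_iff_has_vector_derivative[symmetric] intro!: derivative_eq_intros)
    qed
  qed
  moreover have "F 0 x = 0" if "x \<le> 0" for x using 0[OF that] by (simp add: F_def)
  moreover have "F 0 x = 1" if "x \<ge> 1" for x using 1[OF that] less by (simp add: F_def)
  ultimately show ?thesis by blast
qed

lemma derivative_sequence_affine:
  fixes F :: "nat \<Rightarrow> real \<Rightarrow> real"
  assumes "derivative_sequence F"
  shows "derivative_sequence (\<lambda>k x. a ^ k * F k (a * x + b))"
  unfolding derivative_sequence_def
proof (intro allI)
  fix k x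
  have "(F k has_real_derivative F (Suc k) (a * x + b)) (at (a * x + b))"
    using assms by (simp add: derivative_sequence_def has_real_derivative_iff_has_vector_derivative)
  then have "((\<lambda>x. F k (a * x + b)) has_real_derivative F (Suc k) (a * x + b) * a) (at x)"
    by (rule DERIV_chain2) (auto intro!: derivative_eq_intros)
  then have "((\<lambda>x. a ^ k * F k (a * x + b)) has_real_derivative a ^ k * (F (Suc k) (a * x + b) * a)) (at x)"
    by (rule DERIV_cmult)
  then show "((\<lambda>x. a ^ k * F k (a * x + b)) has_vector_derivative a ^ Suc k * F (Suc k) (a * x + b)) (at x)"
    by (simp add: has_real_derivative_iff_has_vector_derivative mult_ac)
qed

lemma derivative_sequence_diff:
  "derivative_sequence F \<Longrightarrow> derivative_sequence G \<Longrightarrow> derivative_sequence (\<lambda>k x. F k x - G k x)"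
  by (auto simp: derivative_sequence_def intro: has_vector_derivative_diff)

text \<open>\<open>C\<close> is a plateau, equal to 1 for |x| \<le> 1/2 and to 0 for |x| \<ge> 1,
  and F(x) = C(x) - C(2x). Three consecutive dilates telescope to C(x/2) - C(4x), which is 1 - 0 on
  1/4 \<le> |x| \<le> 1.\<close>

lemma smooth_partition:
  "\<exists>F. derivative_sequence F \<and> (\<forall>x. \<bar>x\<bar> < 1/4 \<or> 1 < \<bar>x\<bar> \<longrightarrow> F 0 x = (0::real)) \<and>
    (\<forall>x. 1/4 \<le> \<bar>x\<bar> \<and> \<bar>x\<bar> \<le> 1 \<longrightarrow> F 0 (x / 2) + F 0 x + F 0 (2 * x) = 1)"
proof -
  obtain S :: "nat \<Rightarrow> real \<Rightarrow> real" where S: "derivative_sequence S"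
    "\<And>x. x \<le> 0 \<Longrightarrow> S 0 x = 0" "\<And>x. x \<ge> 1 \<Longrightarrow> S 0 x = 1"
    using smooth_step by blast
  define C where "C = (\<lambda>k x. 2 ^ k * S k (2 * x + 2) - 2 ^ k * S k (2 * x + (-1)))"
  have C: "derivative_sequence C"
    unfolding C_def by (intro derivative_sequence_diff derivative_sequence_affine S)
  have C1: "C 0 x = 1" if "\<bar>x\<bar> \<le> 1/2" for x using S that by (simp add: C_def abs_if split: if_splits)
  have C0: "C 0 x = 0" if "\<bar>x\<bar> \<ge> 1" for x using S that by (auto simp: C_def abs_if split: if_splits)
  define F where "F = (\<lambda>k x. C k x - 2 ^ k * C k (2 * x + 0))"
  have "derivative_sequence F"
    unfolding F_def by (intro derivative_sequence_diff derivative_sequence_affine C)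
  moreover have "F 0 x = 0" if "\<bar>x\<bar> < 1/4 \<or> 1 < \<bar>x\<bar>" for x
    using that C1[of x] C1[of "2 * x"] C0[of x] C0[of "2 * x"] by (auto simp: F_def)
  moreover have "F 0 (x / 2) + F 0 x + F 0 (2 * x) = 1" if "1/4 \<le> \<bar>x\<bar>" "\<bar>x\<bar> \<le> 1" for x
    using that C1[of "x / 2"] C0[of "4 * x"] by (simp add: F_def)
  ultimately show ?thesis by blast
qed

text \<open>Dilating one profile by \<open>2 powr (- of_int j)\<close> makes (ii) scale invariant,
  with the supremum of \<open>F k\<close> as constant. The sum of three neighbours is asserted only
  on the shell that carries \<open>\<phi> j\<close>, which is where the reproducing formula
  evaluates it.\<close>

lemma dyadic_partition:
  "\<exists>\<psi>. dyadic_family \<psi> \<and>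
    (\<forall>j x. 2 powr (of_int j - 2) \<le> \<bar>x\<bar> \<and> \<bar>x\<bar> \<le> 2 powr of_int j \<longrightarrow>
      \<psi> (j - 1) x + \<psi> j x + \<psi> (j + 1) x = 1)"
proof -
  obtain F :: "nat \<Rightarrow> real \<Rightarrow> real" where F: "derivative_sequence F"
    "\<And>x. \<bar>x\<bar> < 1/4 \<or> 1 < \<bar>x\<bar> \<Longrightarrow> F 0 x = 0"
    "\<And>x. 1/4 \<le> \<bar>x\<bar> \<Longrightarrow> \<bar>x\<bar> \<le> 1 \<Longrightarrow> F 0 (x / 2) + F 0 x + F 0 (2 * x) = 1"
    using smooth_partition by auto
  have "\<exists>c. \<forall>x. \<bar>F k x\<bar> \<le> c" for k
  proof -
    have "continuous_on {-1..1} (F k)"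
      using F(1) unfolding derivative_sequence_def
      by (intro continuous_at_imp_continuous_on ballI) (metis has_vector_derivative_continuous)
    then have "bounded (F k ` {-1..1})"
      by (intro compact_imp_bounded compact_continuous_image) auto
    then have "\<exists>c. \<forall>x\<in>{-1..1}. \<bar>F k x\<bar> \<le> c" by (simp add: bounded_iff)
    then obtain c where c: "\<And>x. x \<in> {-1..1} \<Longrightarrow> \<bar>F k x\<bar> \<le> c" by blast
    have "\<bar>F k x\<bar> \<le> c" for x
    proof (cases "x \<in> {-1..1}")
      case False
      have "F k x = 0"
        by (rule derivative_sequence_zero_on_open[OF F(1), of "- {-1..1}"])
          (use F(2) False in auto)
      then show ?thesis using c[of 0] by auto
    qed (use c in auto)
    then show ?thesis by blast
  qed
  then obtain c where c: "\<And>k x. \<bar>F k x\<bar> \<le> c k" by metis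
  define G where "G = (\<lambda>(j::int) k x. (2 powr (- of_int j)) ^ k * F k (2 powr (- of_int j) * x + 0))"
  have G: "derivative_sequence (G j)" for j
    unfolding G_def by (intro derivative_sequence_affine F)
  have Gc: "derivative_sequence (\<lambda>k x. complex_of_real (G j k x))" for j
    using G[of j] unfolding derivative_sequence_def
    by (intro allI bounded_linear.has_vector_derivative[OF bounded_linear_of_real]) simp
  define \<psi> where "\<psi> = (\<lambda>j x. complex_of_real (G j 0 x))"
  have supp: "\<psi> j x = 0" if "\<not> (2 powr (of_int j - 2) \<le> \<bar>x\<bar> \<and> \<bar>x\<bar> \<le> 2 powr of_int j)" for j x
  proof -
    have "\<bar>2 powr (- of_int j) * x\<bar> < 1/4 \<or> 1 < \<bar>2 powr (- of_int j) * x\<bar>"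
      using that by (auto simp: abs_mult powr_minus powr_diff field_simps)
    then show ?thesis using F(2) by (simp add: \<psi>_def G_def)
  qed
  have closed: "closed {x. 2 powr (of_int j - 2) \<le> \<bar>x\<bar> \<and> \<bar>x\<bar> \<le> (2::real) powr of_int j}" for j :: int
    by (intro closed_Collect_conj closed_Collect_le continuous_intros)
  have cl: "closure {x. \<psi> j x \<noteq> 0} \<subseteq> {x. 2 powr (of_int j - 2) \<le> \<bar>x\<bar> \<and> \<bar>x\<bar> \<le> 2 powr of_int j}" for j
    by (rule closure_minimal[OF _ closed]) (use supp in auto)
  have comp: "compact (closure {x. \<psi> j x \<noteq> 0})" for j
  proof -
    have "bounded {x. 2 powr (of_int j - 2) \<le> \<bar>x\<bar> \<and> \<bar>x\<bar> \<le> (2::real) powr of_int j}"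
      by (auto simp: bounded_iff)
    then show ?thesis using cl[of j] by (meson bounded_subset closed_closure compact_eq_bounded_closed)
  qed
  have "dyadic_family \<psi>"
    unfolding dyadic_family_def
  proof (intro conjI allI exI)
    show "\<psi> j \<in> test_functions" for j
      using comp[of j] smooth_derivative_sequence[OF Gc[of j]] by (simp add: test_functions_def \<psi>_def)
    show "closure {x. \<psi> j x \<noteq> 0} \<subseteq> {x. 2 powr (of_int j - 2) \<le> \<bar>x\<bar> \<and> \<bar>x\<bar> \<le> 2 powr of_int j}" for j
      by (rule cl)
    fix k j x
    have "norm ((pdiff 1 ^^ k) (\<psi> j) x) = \<bar>G j k x\<bar>"
      using pdiff_power_derivative_sequence[OF Gc[of j], of k] by (simp add: \<psi>_def)
    also have "\<dots> = 2 powr (- (of_nat k * of_int j)) * \<bar>F k (2 powr (- of_int j) * x)\<bar>"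
      by (simp add: G_def abs_mult powr_power mult_ac)
    also have "\<dots> \<le> 2 powr (- (of_nat k * of_int j)) * c k" by (intro mult_left_mono c) auto
    finally show "norm ((pdiff 1 ^^ k) (\<psi> j) x) \<le> c k * 2 powr (- (of_nat k * of_int j))" by (simp add: mult_ac)
  qed
  moreover have "\<psi> (j - 1) x + \<psi> j x + \<psi> (j + 1) x = 1"
    if "2 powr (of_int j - 2) \<le> \<bar>x\<bar>" "\<bar>x\<bar> \<le> 2 powr of_int j" for j x
  proof -
    let ?y = "2 powr (- of_int j) * x"
    have "1/4 \<le> \<bar>?y\<bar>" "\<bar>?y\<bar> \<le> 1"
      using that by (auto simp: abs_mult powr_minus powr_diff field_simps)
    from F(3)[OF this] have "F 0 (?y / 2) + F 0 ?y + F 0 (2 * ?y) = 1" .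
    moreover have y: "2 powr (- of_int (j - 1)) * x + 0 = 2 * ?y" "2 powr (- of_int (j + 1)) * x + 0 = ?y / 2"
      by (auto simp: powr_minus powr_diff powr_add field_simps)
    moreover have "G (j - 1) 0 x = F 0 (2 * ?y)" "G j 0 x = F 0 ?y" "G (j + 1) 0 x = F 0 (?y / 2)"
      unfolding G_def power_0 mult_1 y by (rule refl) (simp_all only: add_0_right)
    ultimately have "G (j - 1) 0 x + G j 0 x + G (j + 1) 0 x = 1" by linarith
    then show ?thesis unfolding \<psi>_def by (metis of_real_1 of_real_add)
  qed
  ultimately show ?thesis by blast
qed

section \<open>Functional calculus\<close>

lemma borel_measurable_cnj [measurable (raw)]:
  "f \<in> borel_measurable M \<Longrightarrow> (\<lambda>x. cnj (f x)) \<in> borel_measurable M"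
  by (rule borel_measurable_continuous_on[of cnj]) (intro continuous_intros, simp)

lemma L2_measurable [measurable_dest]: "f \<in> L2 \<Longrightarrow> f \<in> borel_measurable lborel"
  by (simp add: L2_def)

lemma L2_integrable_norm_sq: "f \<in> L2 \<Longrightarrow> integrable lborel (\<lambda>x. (norm (f x))\<^sup>2)"
  by (simp add: L2_def)

lemma L2_cmult: "f \<in> L2 \<Longrightarrow> (\<lambda>x. c * f x) \<in> L2"
  by (auto simp: L2_def norm_mult power_mult_distrib)

lemma L2_add:
  assumes "f \<in> L2" "g \<in> L2"
  shows "(\<lambda>x. f x + g x) \<in> L2"
proof -
  note [measurable] = assms[THEN L2_measurable]
  have "integrable lborel (\<lambda>x. (norm (f x + g x))\<^sup>2)"
  proof (rule Bochner_Integration.integrable_bound)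
    show "integrable lborel (\<lambda>x. 2 * (norm (f x))\<^sup>2 + 2 * (norm (g x))\<^sup>2)"
      using assms by (auto simp: L2_def)
    have "(norm (f x + g x))\<^sup>2 \<le> 2 * (norm (f x))\<^sup>2 + 2 * (norm (g x))\<^sup>2" for x
    proof -
      have "(norm (f x + g x))\<^sup>2 \<le> (norm (f x) + norm (g x))\<^sup>2"
        by (intro power_mono norm_triangle_ineq) auto
      also have "\<dots> \<le> 2 * (norm (f x))\<^sup>2 + 2 * (norm (g x))\<^sup>2"
        using zero_le_power2[of "norm (f x) - norm (g x)"] by (simp add: power2_sum power2_diff)
      finally show ?thesis .
    qed
    then show "AE x in lborel. norm ((norm (f x + g x))\<^sup>2) \<le> norm (2 * (norm (f x))\<^sup>2 + 2 * (norm (g x))\<^sup>2)"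
      by simp
  qed simp
  then show ?thesis by (simp add: L2_def)
qed

lemma L2_diff: "f \<in> L2 \<Longrightarrow> g \<in> L2 \<Longrightarrow> (\<lambda>x. f x - g x) \<in> L2"
  using L2_add[of f "\<lambda>x. (-1) * g x"] L2_cmult[of g "-1"] by simp

lemma L2_zero: "(\<lambda>x. 0) \<in> L2"
  by (simp add: L2_def)

lemma L2_sum: "(\<And>i. i \<in> I \<Longrightarrow> f i \<in> L2) \<Longrightarrow> (\<lambda>x. \<Sum>i\<in>I. f i x) \<in> L2"
  by (induction I rule: infinite_finite_induct) (auto intro: L2_add L2_zero)

lemma norm_mult_cnj_le: "norm (z * cnj w) \<le> (norm z)\<^sup>2 + (norm w)\<^sup>2"
proof -
  have "2 * (norm z * norm w) \<le> (norm z)\<^sup>2 + (norm w)\<^sup>2"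
    using sum_squares_bound[of "norm z" "norm w"] by simp
  moreover have "0 \<le> norm z * norm w" by simp
  ultimately have "norm z * norm w \<le> (norm z)\<^sup>2 + (norm w)\<^sup>2" by linarith
  then show ?thesis by (simp add: norm_mult)
qed

lemma L2_integrable_inner:
  assumes "f \<in> L2" "g \<in> L2"
  shows "integrable lborel (\<lambda>x. f x * cnj (g x))"
proof (rule Bochner_Integration.integrable_bound)
  note [measurable] = assms[THEN L2_measurable]
  show "integrable lborel (\<lambda>x. (norm (f x))\<^sup>2 + (norm (g x))\<^sup>2)"
    using assms by (auto simp: L2_def)
  show "(\<lambda>x. f x * cnj (g x)) \<in> borel_measurable lborel"
    by measurable
  show "AE x in lborel. norm (f x * cnj (g x)) \<le> norm ((norm (f x))\<^sup>2 + (norm (g x))\<^sup>2)"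
    using norm_mult_cnj_le by (auto simp: abs_of_nonneg)
qed

lemma l2_inner_add_left:
  "f \<in> L2 \<Longrightarrow> g \<in> L2 \<Longrightarrow> h \<in> L2 \<Longrightarrow> l2_inner (\<lambda>x. f x + g x) h = l2_inner f h + l2_inner g h"
  by (simp add: l2_inner_def distrib_right L2_integrable_inner Bochner_Integration.integral_add)

lemma l2_inner_diff_left:
  "f \<in> L2 \<Longrightarrow> g \<in> L2 \<Longrightarrow> h \<in> L2 \<Longrightarrow> l2_inner (\<lambda>x. f x - g x) h = l2_inner f h - l2_inner g h"
  by (simp add: l2_inner_def left_diff_distrib L2_integrable_inner Bochner_Integration.integral_diff)

lemma l2_inner_cmult_left: "l2_inner (\<lambda>x. c * f x) h = c * l2_inner f h"
  by (simp add: l2_inner_def mult.assoc)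

lemma l2_inner_cnj: "l2_inner g f = cnj (l2_inner f g)"
  unfolding l2_inner_def
  using Bochner_Integration.integral_cnj[where M=lborel and f="\<lambda>x. f x * cnj (g x)"] by (simp add: mult.commute)

lemma l2_inner_add_right:
  "f \<in> L2 \<Longrightarrow> g \<in> L2 \<Longrightarrow> h \<in> L2 \<Longrightarrow> l2_inner h (\<lambda>x. f x + g x) = l2_inner h f + l2_inner h g"
  using l2_inner_add_left[of f g h] by (simp add: l2_inner_cnj[of h])

lemma l2_inner_cmult_right: "l2_inner h (\<lambda>x. c * f x) = cnj c * l2_inner h f"
  using l2_inner_cmult_left[of c f h] by (simp add: l2_inner_cnj[of h])

lemma l2_inner_sum_left:
  "(\<And>i. i \<in> I \<Longrightarrow> f i \<in> L2) \<Longrightarrow> h \<in> L2 \<Longrightarrow>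
     l2_inner (\<lambda>x. \<Sum>i\<in>I. f i x) h = (\<Sum>i\<in>I. l2_inner (f i) h)"
proof (induction I rule: infinite_finite_induct)
  case (insert i I)
  then show ?case using l2_inner_add_left[of "f i" "\<lambda>x. \<Sum>i\<in>I. f i x" h] by (simp add: L2_sum)
qed (simp_all add: l2_inner_def)

lemma l2_inner_cong_AE:
  assumes "f \<in> L2" "f' \<in> L2" "g \<in> L2" "AE x in lborel. f x = f' x"
  shows "l2_inner f g = l2_inner f' g"
  unfolding l2_inner_def
proof (rule Bochner_Integration.integral_cong_AE)
  note [measurable] = assms(1-3)[THEN L2_measurable]
  show "(\<lambda>x. f x * cnj (g x)) \<in> borel_measurable lborel"
    "(\<lambda>x. f' x * cnj (g x)) \<in> borel_measurable lborel" by measurable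
  show "AE x in lborel. f x * cnj (g x) = f' x * cnj (g x)" using assms(4) by auto
qed

lemma l2_norm_nonneg: "0 \<le> l2_norm f"
  by (simp add: l2_norm_def)

lemma l2_norm_sq: "(l2_norm f)\<^sup>2 = (\<integral>x. (norm (f x))\<^sup>2 \<partial>lborel)"
  by (simp add: l2_norm_def)

lemma l2_inner_self: "l2_inner f f = of_real ((l2_norm f)\<^sup>2)"
proof -
  have "f x * cnj (f x) = of_real ((norm (f x))\<^sup>2)" for x
    using complex_norm_square[of "f x"] by simp
  then show ?thesis
    unfolding l2_inner_def l2_norm_sq using integral_complex_of_real[of lborel "\<lambda>x. (norm (f x))\<^sup>2"] by simp
qed

text \<open>A weak form of the Cauchy-Schwarz inequality. It comes from 2xy \<le> x^2/a + a y^2 with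
  \<open>a\<close> decreasing to \<open>l2_norm f\<close>, which itself may be 0. What matters is
  the linear dependence on \<open>l2_norm f\<close>: for fixed \<open>g\<close> the bound tends to 0
  with it.\<close>

lemma norm_l2_inner_le:
  assumes "f \<in> L2" "g \<in> L2"
  shows "norm (l2_inner f g) \<le> l2_norm f * (1 + (l2_norm g)\<^sup>2) / 2"
proof -
  have *: "norm (l2_inner f g) \<le> a * (1 + (l2_norm g)\<^sup>2) / 2" if a: "a > l2_norm f" for a
  proof -
    have a0: "a > 0" using a l2_norm_nonneg[of f] by linarith
    have "norm (l2_inner f g) \<le> (\<integral>x. norm (f x * cnj (g x)) \<partial>lborel)"
      unfolding l2_inner_def by (rule integral_norm_bound)
    also have "\<dots> \<le> (\<integral>x. (norm (f x))\<^sup>2 / (2*a) + a * (norm (g x))\<^sup>2 / 2 \<partial>lborel)"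
    proof (rule integral_mono)
      show "integrable lborel (\<lambda>x. norm (f x * cnj (g x)))"
        using L2_integrable_inner[OF assms] by (rule integrable_norm)
      show "integrable lborel (\<lambda>x. (norm (f x))\<^sup>2 / (2 * a) + a * (norm (g x))\<^sup>2 / 2)"
        using assms by (auto simp: L2_def)
      fix x
      have "norm (f x) * norm (g x) = norm (f x) / sqrt a * (sqrt a * norm (g x))"
        using a0 by simp
      also have "2 * \<dots> \<le> (norm (f x) / sqrt a)\<^sup>2 + (sqrt a * norm (g x))\<^sup>2"
        using sum_squares_bound[of "norm (f x) / sqrt a" "sqrt a * norm (g x)"] by (simp only: mult.assoc)
      also have "\<dots> = (norm (f x))\<^sup>2 / a + a * (norm (g x))\<^sup>2"
        using a0 by (simp add: power_divide power_mult_distrib)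
      finally show "norm (f x * cnj (g x)) \<le> (norm (f x))\<^sup>2 / (2 * a) + a * (norm (g x))\<^sup>2 / 2"
        using a0 by (simp add: norm_mult field_simps)
    qed
    also have "\<dots> = (l2_norm f)\<^sup>2 / (2 * a) + a * (l2_norm g)\<^sup>2 / 2"
      unfolding l2_norm_sq using assms by (subst Bochner_Integration.integral_add) (auto simp: L2_def)
    also have "\<dots> \<le> a\<^sup>2 / (2 * a) + a * (l2_norm g)\<^sup>2 / 2"
      using a a0 l2_norm_nonneg[of f] by (intro add_right_mono divide_right_mono power_mono) auto
    also have "\<dots> = a * (1 + (l2_norm g)\<^sup>2) / 2" using a0 by (simp add: field_simps power2_eq_square)
    finally show ?thesis .
  qed
  show ?thesis
  proof (rule field_le_epsilon)
    fix e :: real assume "e > 0"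
    let ?b = "(1 + (l2_norm g)\<^sup>2) / 2"
    have b: "?b > 0" by (simp add: add_pos_nonneg)
    have "norm (l2_inner f g) \<le> (l2_norm f + e / ?b) * ?b"
      using *[of "l2_norm f + e / ?b"] b \<open>e > 0\<close> by (simp only: times_divide_eq_right) (simp add: add_pos_nonneg)
    also have "\<dots> = l2_norm f * ?b + e" using b by (simp only: distrib_right) simp
    finally show "norm (l2_inner f g) \<le> l2_norm f * (1 + (l2_norm g)\<^sup>2) / 2 + e" by simp
  qed
qed

lemma AE_eq_if_l2_inner_eq:
  assumes "f \<in> L2" "h \<in> L2" "\<And>g. g \<in> L2 \<Longrightarrow> l2_inner f g = l2_inner h g"
  shows "AE x in lborel. f x = h x"
proof -
  let ?d = "\<lambda>x. f x - h x"
  have d: "?d \<in> L2" using assms by (intro L2_diff)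
  have "l2_inner ?d ?d = 0" using assms d by (simp add: l2_inner_diff_left)
  then have "(\<integral>x. (norm (?d x))\<^sup>2 \<partial>lborel) = 0" by (simp only: l2_inner_self l2_norm_sq) simp
  then have "AE x in lborel. (norm (?d x))\<^sup>2 = 0"
    using integral_nonneg_eq_0_iff_AE[OF L2_integrable_norm_sq[OF d]] by simp
  then show ?thesis by auto
qed

text \<open>Extends identities from projections to bounded Borel symbols. The approximating simple
  functions satisfy |F i| \<le> 2 |f|; this is the source of the uniform bound \<open>C\<close> in
  the limit rule, which dominated convergence against finite spectral measures requires.\<close>

lemma bounded_borel_induct [consumes 2, case_names indicator add cmult lim]:
  fixes f :: "real \<Rightarrow> complex"
  assumes "f \<in> borel_measurable borel" "bounded (range f)"
    and ind: "\<And>A. A \<in> sets borel \<Longrightarrow> P (indicator A)"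
    and add: "\<And>f g. f \<in> borel_measurable borel \<Longrightarrow> bounded (range f) \<Longrightarrow> P f \<Longrightarrow>
       g \<in> borel_measurable borel \<Longrightarrow> bounded (range g) \<Longrightarrow> P g \<Longrightarrow> P (\<lambda>x. f x + g x)"
    and cmult: "\<And>f c. f \<in> borel_measurable borel \<Longrightarrow> bounded (range f) \<Longrightarrow> P f \<Longrightarrow> P (\<lambda>x. c * f x)"
    and lim: "\<And>F f C. (\<And>i. F i \<in> borel_measurable borel) \<Longrightarrow> (\<And>i x. norm (F i x) \<le> C) \<Longrightarrow> (\<And>i. P (F i)) \<Longrightarrow>
       (\<And>x. (\<lambda>i::nat. F i x) \<longlonglongrightarrow> f x) \<Longrightarrow> f \<in> borel_measurable borel \<Longrightarrow> P f"
  shows "P f"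
proof -
  obtain C where C: "\<And>x. norm (f x) \<le> C" using assms(2) by (auto simp: bounded_iff)
  obtain F where F: "\<And>i. simple_function borel (F i)" "\<And>x. (\<lambda>i. F i x) \<longlonglongrightarrow> f x"
    "\<And>i x. norm (F i x) \<le> 2 * norm (f x)"
    using borel_measurable_implies_sequence_metric[OF assms(1), of 0] by auto
  have zero: "P (\<lambda>x. 0)"
  proof -
    have "(indicator {} :: real \<Rightarrow> complex) = (\<lambda>x. 0)" by (simp add: fun_eq_iff)
    then show ?thesis using ind[of "{}"] by simp
  qed
  have PF: "P (F i)" for i
  proof -
    let ?S = "F i ` UNIV"
    have fin: "finite ?S" using F(1)[of i] by (simp add: simple_function_def)
    have mb: "F i -` {y} \<in> sets borel" if "y \<in> ?S" for y
      using F(1)[of i] that by (auto simp: simple_function_def)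
    have "T \<subseteq> ?S \<Longrightarrow> (\<lambda>x. \<Sum>y\<in>T. y * indicator (F i -` {y}) x) \<in> borel_measurable borel \<and>
        bounded (range (\<lambda>x. \<Sum>y\<in>T. y * indicator (F i -` {y}) x)) \<and>
        P (\<lambda>x. \<Sum>y\<in>T. y * indicator (F i -` {y}) x)" if "finite T" for T
      using that
    proof (induction T rule: finite_induct)
      case empty
      then show ?case using zero by (auto simp: bounded_iff)
    next
      case (insert y T)
      then have y: "F i -` {y} \<in> sets borel" using mb by auto
      have 1: "(\<lambda>x. y * indicator (F i -` {y}) x) \<in> borel_measurable borel" using y by measurable
      have b0: "bounded (range (indicator (F i -` {y}) :: real \<Rightarrow> complex))"
        by (auto simp: bounded_iff indicator_def intro!: exI[of _ 1])
      have 2: "bounded (range (\<lambda>x. y * indicator (F i -` {y}) x))"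
        by (auto simp: bounded_iff indicator_def intro!: exI[of _ "norm y"])
      have 3: "P (\<lambda>x. y * indicator (F i -` {y}) x)"
        by (rule cmult[OF _ b0 ind[OF y]]) (use y in measurable)
      have 4: "bounded (range (\<lambda>x. u x + v x))" if "bounded (range u)" "bounded (range v)" for u v :: "real \<Rightarrow> complex"
        by (rule bounded_plus_comp[OF that])
      let ?s = "\<lambda>x. \<Sum>y\<in>T. y * indicator (F i -` {y}) x"
      have IH: "?s \<in> borel_measurable borel" "bounded (range ?s)" "P ?s" using insert by blast+
      have eq: "(\<lambda>x. \<Sum>y\<in>insert y T. y * indicator (F i -` {y}) x) =
          (\<lambda>x. y * indicator (F i -` {y}) x + ?s x)" by (simp only: sum.insert[OF insert(1,2)])
      show ?case unfolding eq
        by (intro conjI add[OF 1 2 3 IH] 4[OF 2 IH(2)] borel_measurable_add 1 IH)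
    qed
    from this[OF fin order_refl] have "P (\<lambda>x. \<Sum>y\<in>?S. y * indicator (F i -` {y}) x)" by blast
    moreover have "(\<Sum>y\<in>?S. y * indicator (F i -` {y}) x) = F i x" for x
    proof -
      have "(\<Sum>y\<in>?S. y * indicator (F i -` {y}) x) = (\<Sum>y\<in>?S. if y = F i x then y else 0)"
        by (intro sum.cong) (auto simp: indicator_def)
      then show ?thesis using fin by simp
    qed
    ultimately show ?thesis by simp
  qed
  show ?thesis
  proof (rule lim)
    show "F i \<in> borel_measurable borel" for i using F(1) by (rule borel_measurable_simple_function)
    show "norm (F i x) \<le> 2 * C" for i x using F(3)[of i x] C[of x] by linarith
  qed (use F PF assms in auto)
qed


section \<open>Projection-valued measures and the calculus of bounded symbols\<close>

locale pvm =
  fixes E :: "real set \<Rightarrow> ('a::euclidean_space \<Rightarrow> complex) \<Rightarrow> ('a \<Rightarrow> complex)"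
  assumes pvm: "projection_valued_measure E"
begin

lemma E_L2: "A \<in> sets borel \<Longrightarrow> f \<in> L2 \<Longrightarrow> E A f \<in> L2"
  using pvm by (simp add: projection_valued_measure_def orthogonal_projection_def)

lemma E_sym: "A \<in> sets borel \<Longrightarrow> f \<in> L2 \<Longrightarrow> g \<in> L2 \<Longrightarrow> l2_inner (E A f) g = l2_inner f (E A g)"
  using pvm by (simp add: projection_valued_measure_def orthogonal_projection_def)

lemma E_Int:
  "A \<in> sets borel \<Longrightarrow> B \<in> sets borel \<Longrightarrow> f \<in> L2 \<Longrightarrow> AE x in lborel. E (A \<inter> B) f x = E A (E B f) x"
  using pvm by (simp add: projection_valued_measure_def)

lemma l2_inner_E_E:
  assumes "A \<in> sets borel" "B \<in> sets borel" "f \<in> L2" "g \<in> L2"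
  shows "l2_inner (E A f) (E B g) = l2_inner (E (A \<inter> B) f) g"
proof -
  have "l2_inner (E A f) (E B g) = l2_inner (E B (E A f)) g"
    using assms by (simp add: E_sym E_L2)
  also have "\<dots> = l2_inner (E (B \<inter> A) f) g"
    using E_Int[OF assms(2,1,3)] assms by (intro l2_inner_cong_AE) (auto intro!: E_L2)
  finally show ?thesis by (simp add: Int_commute)
qed

lemma l2_inner_E_self:
  assumes "A \<in> sets borel" "f \<in> L2"
  shows "l2_inner (E A f) f = of_real ((l2_norm (E A f))\<^sup>2)"
  using l2_inner_E_E[OF assms(1,1,2,2)] l2_inner_self[of "E A f"] by simp

text \<open>Linearity of \<open>E A\<close> is seen weakly: symmetry moves the projection onto
  \<open>h\<close>, and the inner product is linear in its first argument.\<close>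

lemma l2_inner_E_add_cmult:
  assumes "A \<in> sets borel" "f \<in> L2" "g \<in> L2" "h \<in> L2"
  shows "l2_inner (E A (\<lambda>x. f x + c * g x)) h = l2_inner (E A f) h + c * l2_inner (E A g) h"
  using assms
  by (simp add: E_sym E_L2 L2_add L2_cmult l2_inner_add_left l2_inner_cmult_left)

text \<open>The remainder of the series tends to 0 in the norm by definition of a projection-valued
  measure, and \<open>norm_l2_inner_le\<close> turns this into convergence of inner
  products.\<close>

lemma E_sums:
  assumes A: "range A \<subseteq> sets borel" "disjoint_family A" and f: "f \<in> L2" "g \<in> L2"
  shows "(\<lambda>i. l2_inner (E (A i) f) g) sums l2_inner (E (\<Union>i::nat. A i) f) g"
proof -
  let ?r = "\<lambda>m x. E (\<Union>i. A i) f x - (\<Sum>i<m. E (A i) f x)"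
  have Ai: "A i \<in> sets borel" for i using A by auto
  then have UA: "(\<Union>i. A i) \<in> sets borel" by blast
  have s: "(\<lambda>x. \<Sum>i<m. E (A i) f x) \<in> L2" for m
    by (intro L2_sum E_L2 Ai f)
  have r: "?r m \<in> L2" for m
    by (intro L2_diff s E_L2 UA f)
  have lim: "(\<lambda>m. l2_norm (?r m)) \<longlonglongrightarrow> 0"
    using pvm A f by (simp add: projection_valued_measure_def)
  have "(\<lambda>m. l2_inner (?r m) g) \<longlonglongrightarrow> 0"
  proof (rule Lim_null_comparison)
    show "\<forall>\<^sub>F m in sequentially. norm (l2_inner (?r m) g) \<le> l2_norm (?r m) * ((1 + (l2_norm g)\<^sup>2) / 2)"
      using norm_l2_inner_le[OF r f(2)] by simp
    show "(\<lambda>m. l2_norm (?r m) * ((1 + (l2_norm g)\<^sup>2) / 2)) \<longlonglongrightarrow> 0"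
      by (rule tendsto_mult_left_zero[OF lim])
  qed
  moreover have "l2_inner (?r m) g = l2_inner (E (\<Union>i. A i) f) g - (\<Sum>i<m. l2_inner (E (A i) f) g)" for m
    using s f UA Ai by (simp add: l2_inner_diff_left E_L2 l2_inner_sum_left)
  ultimately have "(\<lambda>m. l2_inner (E (\<Union>i. A i) f) g - (\<Sum>i<m. l2_inner (E (A i) f) g)) \<longlonglongrightarrow> 0" by simp
  from tendsto_diff[OF tendsto_const[of "l2_inner (E (\<Union>i. A i) f) g"] this]
  show ?thesis by (simp add: sums_def)
qed

lemma sets_spectral_measure [simp, measurable_cong]: "sets (spectral_measure E f) = sets borel"
  by (simp add: spectral_measure_def sigma_algebra.sigma_sets_eq[OF sets.sigma_algebra_axioms[of borel, simplified]])

lemma space_spectral_measure [simp]: "space (spectral_measure E f) = UNIV"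
  by (simp add: spectral_measure_def)

text \<open>\<open>measure_of\<close> returns the zero measure unless its argument is positive and
  countably additive, so both properties are checked before the formula can be read off.\<close>

lemma emeasure_spectral_measure:
  assumes f: "f \<in> L2" and A: "A \<in> sets borel"
  shows "emeasure (spectral_measure E f) A = ennreal (Re (l2_inner (E A f) f))"
proof (rule emeasure_measure_of[OF spectral_measure_def])
  show "positive (sets (spectral_measure E f)) (\<lambda>A. ennreal (Re (l2_inner (E A f) f)))"
  proof -
    \<comment> \<open>The empty set is a disjoint union of infinitely many copies of itself; a
      summable constant sequence is 0.\<close>
    have "(\<lambda>i::nat. l2_inner (E {} f) f) sums l2_inner (E {} f) f"
      using E_sums[of "\<lambda>_. {}" f f] f by (simp add: disjoint_family_on_def)
    then have "(\<lambda>i::nat. l2_inner (E {} f) f) \<longlonglongrightarrow> 0" by (intro summable_LIMSEQ_zero) (rule sums_summable)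
    then have "l2_inner (E {} f) f = 0" using LIMSEQ_unique tendsto_const by blast
    then show ?thesis by (simp add: positive_def)
  qed
  show "countably_additive (sets (spectral_measure E f)) (\<lambda>A. ennreal (Re (l2_inner (E A f) f)))"
  proof (rule countably_additiveI)
    fix A :: "nat \<Rightarrow> real set"
    assume A: "range A \<subseteq> sets (spectral_measure E f)" "disjoint_family A"
    then have A': "range A \<subseteq> sets borel" by simp
    have "(\<lambda>i. Re (l2_inner (E (A i) f) f)) sums Re (l2_inner (E (\<Union>i. A i) f) f)"
      using E_sums[OF A' A(2) f f] by (rule sums_Re)
    moreover have "0 \<le> Re (l2_inner (E (A i) f) f)" for i
      using l2_inner_E_self[of "A i" f] A' f by auto
    ultimately show "(\<Sum>i. ennreal (Re (l2_inner (E (A i) f) f))) = ennreal (Re (l2_inner (E (\<Union>i. A i) f) f))"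
      by (rule suminf_ennreal_eq[rotated])
  qed
qed (use A sets.sets_into_space in auto)

lemma measure_spectral_measure:
  assumes f: "f \<in> L2" and A: "A \<in> sets borel"
  shows "of_real (measure (spectral_measure E f) A) = l2_inner (E A f) f"
  using l2_inner_E_self[OF A f]
  by (simp add: measure_def emeasure_spectral_measure[OF f A])

lemma finite_spectral_measure: "f \<in> L2 \<Longrightarrow> finite_measure (spectral_measure E f)"
  by (rule finite_measureI) (simp add: emeasure_spectral_measure)

lemma spectral_domain_bounded:
  assumes "\<phi> \<in> borel_measurable borel" "bounded (range \<phi>)"
  shows "spectral_domain E \<phi> = L2"
proof -
  obtain C where C: "\<And>x. norm (\<phi> x) \<le> C" using assms(2) by (auto simp: bounded_iff)
  have "(\<integral>\<^sup>+ t. ennreal ((norm (\<phi> t))\<^sup>2) \<partial>spectral_measure E f) < \<infinity>" if f: "f \<in> L2" for f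
  proof -
    interpret finite_measure "spectral_measure E f" by (rule finite_spectral_measure[OF f])
    have "(\<integral>\<^sup>+ t. ennreal ((norm (\<phi> t))\<^sup>2) \<partial>spectral_measure E f) \<le> (\<integral>\<^sup>+ t. ennreal (C\<^sup>2) \<partial>spectral_measure E f)"
      using C by (intro nn_integral_mono ennreal_leI power_mono) auto
    also have "\<dots> < \<infinity>" using emeasure_finite[of UNIV] by (simp add: ennreal_mult_eq_top_iff less_top[symmetric])
    finally show ?thesis .
  qed
  then show ?thesis by (auto simp: spectral_domain_def)
qed

lemma integrable_spectral_measure:
  fixes \<phi> :: "real \<Rightarrow> complex"
  assumes "f \<in> L2" "\<phi> \<in> borel_measurable borel" "bounded (range \<phi>)"
  shows "integrable (spectral_measure E f) \<phi>"
proof -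
  obtain C where C: "\<And>x. norm (\<phi> x) \<le> C" using assms(3) by (auto simp: bounded_iff)
  interpret finite_measure "spectral_measure E f" by (rule finite_spectral_measure[OF assms(1)])
  show ?thesis by (rule integrable_const_bound[where B=C]) (use C assms in auto)
qed

context
  fixes f g :: "'a \<Rightarrow> complex" assumes fg: "f \<in> L2" "g \<in> L2"
begin

lemma polar_L2: "(\<lambda>x. f x + \<i> ^ k * g x) \<in> L2"
  by (intro L2_add L2_cmult fg)

text \<open>Polarization. In the expansion of \<open>?B (?u k) (?u k)\<close>, multiplying by
  \<open>\<i> ^ k\<close> and summing over the four powers cancels every term except the one
  carrying \<open>cnj (\<i> ^ k)\<close>, which is counted four times.\<close>

lemma spectral_form_indicator:
  assumes A: "A \<in> sets borel"
  shows "spectral_form E (indicator A) f g = l2_inner (E A f) g"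
proof -
  let ?u = "\<lambda>k x. f x + \<i> ^ k * g x"
  let ?B = "\<lambda>u v. l2_inner (E A u) v"
  have int: "(\<integral>t. indicator A t \<partial>spectral_measure E (?u k)) = ?B (?u k) (?u k)" for k
  proof -
    interpret finite_measure "spectral_measure E (?u k)" by (rule finite_spectral_measure[OF polar_L2])
    have "(\<integral>t. indicator A t \<partial>spectral_measure E (?u k)) =
        (\<integral>t. complex_of_real (indicator A t) \<partial>spectral_measure E (?u k))"
      by (intro Bochner_Integration.integral_cong) (auto simp: indicator_def)
    also have "\<dots> = complex_of_real (measure (spectral_measure E (?u k)) A)"
      using A by simp
    finally show ?thesis using measure_spectral_measure[OF polar_L2 A] by simp
  qed
  have B: "?B (?u k) (?u k) = ?B f f + cnj (\<i> ^ k) * ?B f g + \<i> ^ k * ?B g f + \<i> ^ k * cnj (\<i> ^ k) * ?B g g" for k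
  proof -
    have "?B h (?u k) = ?B h f + cnj (\<i> ^ k) * ?B h g" if "h \<in> L2" for h
      using l2_inner_add_right[of f "\<lambda>x. \<i> ^ k * g x" "E A h"] fg that A
      by (simp only: l2_inner_cmult_right E_L2 L2_cmult simp_thms)
    then show ?thesis
      using fg A by (simp only: l2_inner_E_add_cmult polar_L2) (simp add: algebra_simps)
  qed
  have "(\<Sum>k<4::nat. \<i> ^ k * ?B (?u k) (?u k)) = 4 * ?B f g"
    unfolding B by (simp add: eval_nat_numeral algebra_simps)
  then show ?thesis unfolding spectral_form_def int by simp
qed

lemma spectral_form_add:
  assumes "\<phi> \<in> borel_measurable borel" "bounded (range \<phi>)" "\<psi> \<in> borel_measurable borel" "bounded (range \<psi>)"
  shows "spectral_form E (\<lambda>t. \<phi> t + \<psi> t) f g = spectral_form E \<phi> f g + spectral_form E \<psi> f g"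
  unfolding spectral_form_def
    Bochner_Integration.integral_add[OF integrable_spectral_measure[OF polar_L2 assms(1,2)]
      integrable_spectral_measure[OF polar_L2 assms(3,4)]]
  by (simp add: sum.distrib distrib_left add_divide_distrib)

lemma spectral_form_cmult: "spectral_form E (\<lambda>t. c * \<phi> t) f g = c * spectral_form E \<phi> f g"
  unfolding spectral_form_def integral_mult_right_zero by (simp add: sum_distrib_left mult.left_commute)

lemma spectral_form_tendsto:
  assumes "\<And>i. F i \<in> borel_measurable borel" "\<And>i x. norm (F i x) \<le> C"
    "\<And>x. (\<lambda>i::nat. F i x) \<longlonglongrightarrow> \<phi> x" "\<phi> \<in> borel_measurable borel"
  shows "(\<lambda>i. spectral_form E (F i) f g) \<longlonglongrightarrow> spectral_form E \<phi> f g"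
proof -
  have "(\<lambda>i. \<integral>t. F i t \<partial>spectral_measure E (\<lambda>x. f x + \<i> ^ k * g x)) \<longlonglongrightarrow>
      (\<integral>t. \<phi> t \<partial>spectral_measure E (\<lambda>x. f x + \<i> ^ k * g x))" for k
  proof -
    interpret finite_measure "spectral_measure E (\<lambda>x. f x + \<i> ^ k * g x)" by (rule finite_spectral_measure[OF polar_L2])
    show ?thesis
      by (rule integral_dominated_convergence[where w="\<lambda>_. C"]) (use assms in auto)
  qed
  then show ?thesis unfolding spectral_form_def by (intro tendsto_intros) auto
qed

end

text \<open>For indicators this is E(A) E(B) = E(A \<inter> B). It is the indicator case of
  multiplicativity, with the projection placed on the test function.\<close>

lemma spectral_form_restrict:
  assumes fg: "f \<in> L2" "g \<in> L2" and A: "A \<in> sets borel"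
    and \<phi>: "\<phi> \<in> borel_measurable borel" "bounded (range \<phi>)"
  shows "spectral_form E \<phi> f (E A g) = spectral_form E (\<lambda>t. indicator A t * \<phi> t) f g"
  using \<phi>
proof (induction \<phi> rule: bounded_borel_induct)
  case (indicator B)
  have "(\<lambda>t. indicator A t * indicator B t) = (indicator (B \<inter> A) :: real \<Rightarrow> complex)"
    by (auto simp: indicator_def)
  then show ?case
    using fg A indicator by (simp add: spectral_form_indicator E_L2 l2_inner_E_E sets.Int)
next
  case (add \<phi> \<psi>)
  have b: "bounded (range (\<lambda>t. indicator A t * \<phi> t))" if "bounded (range \<phi>)" for \<phi> :: "real \<Rightarrow> complex"
  proof -
    obtain C where "\<And>x. norm (\<phi> x) \<le> C" using \<open>bounded (range \<phi>)\<close> by (auto simp: bounded_iff)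
    then have "norm (indicator A t * \<phi> t) \<le> max C 0" for t
      by (auto simp: indicator_def intro: order_trans[of _ C])
    then show ?thesis by (auto simp: bounded_iff)
  qed
  have "spectral_form E (\<lambda>t. indicator A t * \<phi> t + indicator A t * \<psi> t) f g =
      spectral_form E (\<lambda>t. indicator A t * \<phi> t) f g + spectral_form E (\<lambda>t. indicator A t * \<psi> t) f g"
    using add A by (intro spectral_form_add fg b) auto
  then show ?case
    using add fg A by (simp add: spectral_form_add E_L2 distrib_left)
next
  case (cmult \<phi> c)
  have "spectral_form E (\<lambda>t. indicator A t * (c * \<phi> t)) f g = c * spectral_form E (\<lambda>t. indicator A t * \<phi> t) f g"
    using spectral_form_cmult[OF fg, of c "\<lambda>t. indicator A t * \<phi> t"] by (simp add: mult_ac)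
  then show ?case using cmult fg A by (simp add: spectral_form_cmult E_L2)
next
  case (lim F \<phi> C)
  have C: "0 \<le> C" using lim(2)[of 0 0] norm_ge_zero order_trans by blast
  have "(\<lambda>i. spectral_form E (F i) f (E A g)) \<longlonglongrightarrow> spectral_form E \<phi> f (E A g)"
    by (rule spectral_form_tendsto) (use lim fg A E_L2 in auto)
  moreover have "(\<lambda>i. spectral_form E (\<lambda>t. indicator A t * F i t) f g) \<longlonglongrightarrow> spectral_form E (\<lambda>t. indicator A t * \<phi> t) f g"
    by (rule spectral_form_tendsto[where C=C])
      (use lim fg A C in \<open>auto simp: norm_mult indicator_def intro!: tendsto_mult\<close>)
  ultimately show ?case using lim.IH LIMSEQ_unique by simp
qed

text \<open>The weak form of \<psi>(H) \<phi>(H) = (\<psi> \<phi>)(H), with \<open>h\<close> in the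
  role of \<phi>(H) f. For an indicator \<psi> the projection passes from \<open>h\<close> to
  \<open>g\<close>, where \<open>hf\<close> applies and \<open>spectral_form_restrict\<close>
  absorbs it into the symbol.\<close>

lemma spectral_form_mult:
  assumes f: "f \<in> L2" and h: "h \<in> L2" and g: "g \<in> L2"
    and \<phi>: "\<phi> \<in> borel_measurable borel" "bounded (range \<phi>)"
    and hf: "\<And>g. g \<in> L2 \<Longrightarrow> l2_inner h g = spectral_form E \<phi> f g"
    and \<psi>: "\<psi> \<in> borel_measurable borel" "bounded (range \<psi>)"
  shows "spectral_form E \<psi> h g = spectral_form E (\<lambda>t. \<psi> t * \<phi> t) f g"
proof -
  obtain K where K: "\<And>x. norm (\<phi> x) \<le> K" using \<phi> by (auto simp: bounded_iff)
  have K0: "0 \<le> K" using K[of 0] norm_ge_zero order_trans by blast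
  have b: "bounded (range (\<lambda>t. \<psi> t * \<phi> t))" if "bounded (range \<psi>)" for \<psi> :: "real \<Rightarrow> complex"
  proof -
    obtain C where C: "\<And>x. norm (\<psi> x) \<le> C" using \<open>bounded (range \<psi>)\<close> by (auto simp: bounded_iff)
    then have "norm (\<psi> t * \<phi> t) \<le> C * K" for t
      unfolding norm_mult using C[of t] K[of t] K0 by (intro mult_mono) (auto intro: order_trans[of _ "norm (\<psi> t)"])
    then show ?thesis by (auto simp: bounded_iff)
  qed
  show ?thesis
    using \<psi>
  proof (induction \<psi> rule: bounded_borel_induct)
    case (indicator A)
    have "spectral_form E (indicator A) h g = l2_inner h (E A g)"
      using h g indicator by (simp add: spectral_form_indicator E_sym)
    also have "\<dots> = spectral_form E \<phi> f (E A g)" using hf E_L2 indicator g by simp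
    finally show ?case using spectral_form_restrict[OF f g indicator \<phi>] by simp
  next
    case (add \<psi> \<eta>)
    have "spectral_form E (\<lambda>t. \<psi> t * \<phi> t + \<eta> t * \<phi> t) f g =
      spectral_form E (\<lambda>t. \<psi> t * \<phi> t) f g + spectral_form E (\<lambda>t. \<eta> t * \<phi> t) f g"
      using add \<phi> by (intro spectral_form_add f g b) auto
    then show ?case using add h g by (simp add: spectral_form_add distrib_right)
  next
    case (cmult \<psi> c)
    have "spectral_form E (\<lambda>t. c * \<psi> t * \<phi> t) f g = c * spectral_form E (\<lambda>t. \<psi> t * \<phi> t) f g"
      using spectral_form_cmult[OF f g, of c "\<lambda>t. \<psi> t * \<phi> t"] by (simp add: mult_ac)
    then show ?case using cmult h g by (simp add: spectral_form_cmult)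
  next
    case (lim F \<psi> C)
    have C: "0 \<le> C" using lim(2)[of 0 0] norm_ge_zero order_trans by blast
    have "(\<lambda>i. spectral_form E (F i) h g) \<longlonglongrightarrow> spectral_form E \<psi> h g"
      by (rule spectral_form_tendsto) (use lim h g in auto)
    moreover have "(\<lambda>i. spectral_form E (\<lambda>t. F i t * \<phi> t) f g) \<longlonglongrightarrow> spectral_form E (\<lambda>t. \<psi> t * \<phi> t) f g"
      by (rule spectral_form_tendsto[where C="C*K"])
        (use lim f g \<phi> in \<open>auto simp: norm_mult intro!: tendsto_mult mult_mono C K\<close>)
    ultimately show ?case using lim.IH LIMSEQ_unique by simp
  qed
qed

end

section \<open>Kernel estimates and slow variation\<close>

lemma ennreal_le_suminf: "f k \<le> (\<Sum>k. f k :: ennreal)"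
  using sum_le_suminf[of f "{k}"] by simp

text \<open>Take the least \<open>k\<close> with x \<le> 2^k. The second inequality, read as 1 / (1
  + x) \<le> 2 / 2^k, is what turns polynomial decay into a geometric series over balls.\<close>

lemma dyadic_shell:
  assumes "0 \<le> (x::real)"
  shows "\<exists>k::nat. x \<le> 2 ^ k \<and> 2 ^ k \<le> 2 * (1 + x)"
proof -
  define k where "k = (LEAST k::nat. x \<le> 2 ^ k)"
  have ex: "\<exists>k::nat. x \<le> 2 ^ k" by (meson less_imp_le one_less_numeral_iff real_arch_pow semiring_norm(76))
  have 1: "x \<le> 2 ^ k" unfolding k_def by (rule LeastI_ex[OF ex])
  have 2: "2 ^ k \<le> 2 * (1 + x)"
  proof (cases k)
    case (Suc l)
    have "\<not> x \<le> 2 ^ l" using not_less_Least[of l "\<lambda>k. x \<le> 2 ^ k"] Suc k_def by simp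
    then show ?thesis using Suc by simp
  qed (use assms in auto)
  show ?thesis using 1 2 by blast
qed

text \<open>The integrand is at most a sum over balls of radius 2^k / R. With n the dimension, the
  volume 2^(kn) against the weight (2 / 2^k)^(n+1) leaves a geometric series of ratio 1/2, whose sum
  2 completes the factor 2^(n+2).\<close>

lemma nn_integral_decay:
  fixes x :: "'a::euclidean_space"
  assumes R: "R > 0"
  shows "(\<integral>\<^sup>+y. ennreal (1 / (1 + R * norm (x - y)) ^ (DIM('a) + 1)) \<partial>lborel)
    \<le> ennreal (2 ^ (DIM('a) + 2) * unit_ball_vol DIM('a) / R ^ DIM('a))"
proof -
  let ?m = "DIM('a) + 1"
  let ?v = "unit_ball_vol (real DIM('a))"
  let ?a = "\<lambda>k::nat. (2 / 2 ^ k) ^ ?m :: real"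
  have "ennreal (1 / (1 + R * norm (x - y)) ^ ?m) \<le> (\<Sum>k. ennreal (?a k) * indicator (cball x (2 ^ k / R)) y)" for y
  proof -
    obtain k :: nat where k: "R * norm (x - y) \<le> 2 ^ k" "2 ^ k \<le> 2 * (1 + R * norm (x - y))"
      using dyadic_shell[of "R * norm (x - y)"] R by auto
    have "1 / (1 + R * norm (x - y)) \<le> 2 / 2 ^ k"
      using k(2) R by (simp add: field_simps add_pos_nonneg)
    then have "(1 / (1 + R * norm (x - y))) ^ ?m \<le> ?a k"
      using R by (intro power_mono) auto
    then have "ennreal (1 / (1 + R * norm (x - y)) ^ ?m) \<le> ennreal (?a k) * indicator (cball x (2 ^ k / R)) y"
      using k(1) R by (auto simp: power_divide dist_norm field_simps indicator_def intro!: ennreal_leI)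
    also have "\<dots> \<le> (\<Sum>k. ennreal (?a k) * indicator (cball x (2 ^ k / R)) y)"
      by (rule ennreal_le_suminf)
    finally show ?thesis .
  qed
  then have "(\<integral>\<^sup>+y. ennreal (1 / (1 + R * norm (x - y)) ^ ?m) \<partial>lborel) \<le>
      (\<integral>\<^sup>+y. (\<Sum>k. ennreal (?a k) * indicator (cball x (2 ^ k / R)) y) \<partial>lborel)"
    by (intro nn_integral_mono)
  also have "\<dots> = (\<Sum>k. \<integral>\<^sup>+y. ennreal (?a k) * indicator (cball x (2 ^ k / R)) y \<partial>lborel)"
    by (rule nn_integral_suminf) (auto intro!: borel_measurable_times_ennreal borel_measurable_indicator)
  also have "\<dots> = (\<Sum>k. ennreal (2 ^ ?m * ?v / R ^ DIM('a) * (1/2) ^ k))"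
  proof (rule suminf_cong)
    fix k :: nat
    have "(\<integral>\<^sup>+y. ennreal (?a k) * indicator (cball x (2 ^ k / R)) y \<partial>lborel)
        = ennreal (?a k) * ennreal (?v * (2 ^ k / R) ^ DIM('a))"
      using R by (subst nn_integral_cmult_indicator) (auto simp: emeasure_cball)
    also have "\<dots> = ennreal (?a k * (?v * (2 ^ k / R) ^ DIM('a)))"
      by (rule ennreal_mult'[symmetric]) simp
    also have "?a k * (?v * (2 ^ k / R) ^ DIM('a)) = 2 ^ ?m * ?v / R ^ DIM('a) * (1/2) ^ k"
      using R by (simp add: power_divide power_mult_distrib power_add field_simps)
    finally show "(\<integral>\<^sup>+y. ennreal (?a k) * indicator (cball x (2 ^ k / R)) y \<partial>lborel) =
        ennreal (2 ^ ?m * ?v / R ^ DIM('a) * (1/2) ^ k)" .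
  qed
  also have "\<dots> = ennreal (2 ^ ?m * ?v / R ^ DIM('a) * 2)"
  proof (rule suminf_ennreal_eq)
    show "0 \<le> 2 ^ ?m * ?v / R ^ DIM('a) * (1/2) ^ k" for k using R by simp
    have "(\<lambda>k. (1/2::real) ^ k) sums 2" using geometric_sums[of "1/2::real"] by simp
    then show "(\<lambda>k. 2 ^ ?m * ?v / R ^ DIM('a) * (1/2) ^ k) sums (2 ^ ?m * ?v / R ^ DIM('a) * 2)"
      by (rule sums_mult)
  qed
  also have "2 ^ ?m * ?v / R ^ DIM('a) * 2 = 2 ^ (DIM('a) + 2) * ?v / R ^ DIM('a)" by simp
  finally show ?thesis .
qed

lemma integral_decay_bound:
  fixes h :: "'a::euclidean_space \<Rightarrow> complex"
  assumes [measurable]: "h \<in> borel_measurable borel" and R: "R > 0" and B: "B \<ge> 0"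
    and h: "\<And>y. norm (h y) \<le> B / (1 + R * norm (x - y)) ^ (DIM('a) + 1)"
  shows "integrable lborel h"
    and "norm (\<integral>y. h y \<partial>lborel) \<le> B * (2 ^ (DIM('a) + 2) * unit_ball_vol DIM('a) / R ^ DIM('a))"
proof -
  let ?C = "2 ^ (DIM('a) + 2) * unit_ball_vol DIM('a) / R ^ DIM('a)"
  have "(\<integral>\<^sup>+y. norm (h y) \<partial>lborel) \<le> (\<integral>\<^sup>+y. ennreal B * ennreal (1 / (1 + R * norm (x - y)) ^ (DIM('a) + 1)) \<partial>lborel)"
    using h B R by (intro nn_integral_mono) (simp add: ennreal_mult'[symmetric] ennreal_leI)
  also have "\<dots> = ennreal B * (\<integral>\<^sup>+y. ennreal (1 / (1 + R * norm (x - y)) ^ (DIM('a) + 1)) \<partial>lborel)"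
    by (rule nn_integral_cmult) measurable
  also have "\<dots> \<le> ennreal B * ennreal ?C"
    by (intro mult_left_mono nn_integral_decay R) auto
  also have "\<dots> = ennreal (B * ?C)" by (rule ennreal_mult'[OF B, symmetric])
  finally have *: "(\<integral>\<^sup>+y. norm (h y) \<partial>lborel) \<le> ennreal (B * ?C)" .
  then show "integrable lborel h"
    by (intro integrableI_bounded) (auto intro: le_less_trans)
  then have "ennreal (norm (\<integral>y. h y \<partial>lborel)) \<le> ennreal (B * ?C)"
    using integral_norm_bound_ennreal * order_trans by blast
  then show "norm (\<integral>y. h y \<partial>lborel) \<le> B * ?C"
    using B R by (subst (asm) ennreal_le_iff) auto
qed

text \<open>The Cauchy-Schwarz inequality over the coordinates of \<open>v\<close>; the gradient is
  measured in the Euclidean norm of its complex components.\<close>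

lemma norm_frechet_derivative_le_gradient:
  fixes k :: "real^'n \<Rightarrow> complex"
  assumes "k differentiable (at x)"
  shows "norm (frechet_derivative k (at x) v) \<le> norm (gradient k x) * norm v"
proof -
  let ?D = "frechet_derivative k (at x)"
  have lin: "linear ?D" using assms by (rule linear_frechet_derivative)
  have "?D v = ?D (\<Sum>i\<in>UNIV. v $ i *\<^sub>R axis i 1)"
    using basis_expansion[of v] by (simp add: scalar_mult_eq_scaleR)
  also have "\<dots> = (\<Sum>i\<in>UNIV. v $ i *\<^sub>R ?D (axis i 1))"
    using lin by (simp add: linear_sum linear_scale)
  finally have "norm (?D v) \<le> (\<Sum>i\<in>UNIV. norm (v $ i *\<^sub>R ?D (axis i 1)))"
    by (simp only: norm_sum)
  also have "\<dots> = (\<Sum>i\<in>UNIV. \<bar>norm (gradient k x $ i)\<bar> * \<bar>norm (v $ i)\<bar>)"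
    by (simp add: gradient_def pdiff_def mult.commute)
  also have "\<dots> \<le> norm (gradient k x) * norm v"
    unfolding norm_vec_def by (rule L2_set_mult_ineq)
  finally show ?thesis .
qed

text \<open>The mean value inequality on the ball of radius 1 / R about \<open>x\<close>. There 1 +
  R |z - y| is at least half of 1 + R |x - y|, so the decay is the one at the centre up to
  2^N.\<close>

lemma kernel_difference_bound:
  fixes k :: "real^'n \<Rightarrow> complex"
  assumes diff: "\<And>x. k differentiable (at x)"
    and grad: "\<And>x. norm (gradient k x) \<le> G / (1 + R * norm (x - y)) ^ N"
    and R: "R > 0" and G: "G \<ge> 0" and x: "R * norm (x - x') \<le> 1"
  shows "norm (k x - k x') \<le> 2 ^ N * G / (1 + R * norm (x - y)) ^ N * norm (x - x')"
proof (rule differentiable_bound[where S="cball x (1 / R)" and f'="\<lambda>z. frechet_derivative k (at z)"])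
  show "(k has_derivative frechet_derivative k (at z)) (at z within cball x (1 / R))" for z
    using diff[of z] frechet_derivative_works has_derivative_at_withinI by blast
  fix z assume "z \<in> cball x (1 / R)"
  then have "R * norm (x - z) \<le> 1" using R by (simp add: dist_norm field_simps)
  moreover have "R * norm (x - y) \<le> R * norm (x - z) + R * norm (z - y)"
    using R norm_triangle_ineq[of "x - z" "z - y"] by (simp add: distrib_left[symmetric])
  moreover have "0 \<le> R * norm (z - y)" using R by simp
  ultimately have "(1 + R * norm (x - y)) / 2 \<le> 1 + R * norm (z - y)" by simp
  moreover have pos: "0 < (1 + R * norm (x - y)) / 2" using R by (simp add: add_pos_nonneg)
  ultimately have "((1 + R * norm (x - y)) / 2) ^ N \<le> (1 + R * norm (z - y)) ^ N"
    by (intro power_mono) auto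
  then have "G / (1 + R * norm (z - y)) ^ N \<le> G / ((1 + R * norm (x - y)) / 2) ^ N"
    using G pos by (intro divide_left_mono mult_pos_pos zero_less_power) (use R in \<open>auto simp: add_pos_nonneg\<close>)
  also have "\<dots> = 2 ^ N * G / (1 + R * norm (x - y)) ^ N" by (simp add: power_divide)
  finally have "norm (gradient k z) \<le> 2 ^ N * G / (1 + R * norm (x - y)) ^ N" using grad[of z] by simp
  then show "onorm (frechet_derivative k (at z)) \<le> 2 ^ N * G / (1 + R * norm (x - y)) ^ N"
    by (intro onorm_le order_trans[OF norm_frechet_derivative_le_gradient[OF diff]] mult_right_mono) auto
qed (use R x in \<open>auto simp: dist_norm field_simps\<close>)

text \<open>\<open>H\<close> has order two, so spectral size 2^j corresponds to the length 2^(-j/2);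
  \<open>freq j\<close> is the inverse of this length.\<close>

abbreviation freq :: "int \<Rightarrow> real" where
  "freq j \<equiv> 2 powr (of_int j / 2)"

text \<open>The kernel bounds at one scale \<open>R\<close>, detached from the index
  \<open>j\<close> so that a kernel can be regarded at a neighbouring scale.\<close>

definition decaying_kernel :: "real \<Rightarrow> nat \<Rightarrow> real \<Rightarrow> (real^'n \<Rightarrow> real^'n \<Rightarrow> complex) \<Rightarrow> bool" where
  "decaying_kernel c N R K \<longleftrightarrow>
     (\<lambda>(x, y). K x y) \<in> borel_measurable borel \<and>
     (\<forall>x y. (\<lambda>x. K x y) differentiable (at x)) \<and>
     (\<forall>x y. norm (K x y) \<le> c * R ^ CARD('n) / (1 + R * norm (x - y)) ^ N) \<and>
     (\<forall>x y. norm (gradient (\<lambda>x. K x y) x) \<le> c * R ^ (CARD('n) + 1) / (1 + R * norm (x - y)) ^ N)"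

context
  fixes K :: "real^'n \<Rightarrow> real^'n \<Rightarrow> complex" and u :: "real^'n \<Rightarrow> complex"
    and c R s D :: real and N :: nat and w :: "real^'n"
  assumes K: "decaying_kernel c N R K" and R: "R > 0" and c: "c \<ge> 0" and s: "s \<ge> 0"
    and N: "real N \<ge> s + CARD('n) + 1" and u[measurable]: "u \<in> borel_measurable borel"
    and D: "\<And>y. norm (u y) \<le> D * (1 + R * norm (w - y)) powr s"
begin

lemma decaying_kernel_measurable [measurable]: "(\<lambda>y. K x y) \<in> borel_measurable borel"
proof -
  have "(\<lambda>y. (\<lambda>(x, y). K x y) (x, y)) \<in> borel_measurable borel"
    by (rule measurable_compose[of "\<lambda>y. (x, y)" borel borel])
      (use K in \<open>auto simp: decaying_kernel_def borel_measurable_Pair intro!: borel_measurable_continuous_onI continuous_intros\<close>)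
  then show ?thesis by simp
qed

text \<open>Since 1 + R |w - y| \<le> (1 + R |w - x|) (1 + R |x - y|), growth of order
  \<open>s\<close> about \<open>w\<close> uses up \<open>s\<close> orders of decay about
  \<open>x\<close>. The assumption on \<open>N\<close> leaves \<open>CARD('n) + 1\<close> orders,
  which are integrable.\<close>

lemma decay_absorbs_growth:
  "norm (u y) / (1 + R * norm (x - y)) ^ N \<le>
     D * (1 + R * norm (w - x)) powr s / (1 + R * norm (x - y)) ^ (CARD('n) + 1)"
proof -
  let ?a = "1 + R * norm (w - x)" and ?b = "1 + R * norm (x - y)"
  have ab: "?a \<ge> 1" "?b \<ge> 1" using R by auto
  have D0: "D \<ge> 0"
  proof -
    have "0 \<le> D * (1 + R * norm (w - w)) powr s" using D[of w] norm_ge_zero order_trans by blast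
    then show ?thesis by simp
  qed
  have "R * norm (w - y) \<le> R * norm (w - x) + R * norm (x - y)"
    using R norm_triangle_ineq[of "w - x" "x - y"] by (simp add: distrib_left[symmetric])
  moreover have "0 \<le> R * norm (w - x) * (R * norm (x - y))" using R by simp
  ultimately have "1 + R * norm (w - y) \<le> ?a * ?b" by (simp add: algebra_simps)
  then have "(1 + R * norm (w - y)) powr s \<le> (?a * ?b) powr s" using R s by (intro powr_mono2) auto
  also have "\<dots> = ?a powr s * ?b powr s" using ab by (simp add: powr_mult)
  finally have "norm (u y) \<le> D * (?a powr s * ?b powr s)"
    using D[of y] D0 by (meson mult_left_mono order_trans)
  then have "norm (u y) / ?b ^ N \<le> D * (?a powr s * ?b powr s) / ?b ^ N"
    using ab by (intro divide_right_mono) auto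
  also have "\<dots> = D * ?a powr s * ?b powr (s - real N)"
    using ab by (simp add: powr_diff powr_realpow)
  also have "\<dots> \<le> D * ?a powr s * ?b powr (- real (CARD('n) + 1))"
    using ab N D0 by (intro mult_left_mono powr_mono) auto
  also have "\<dots> = D * ?a powr s / ?b ^ (CARD('n) + 1)"
  proof -
    have "?b powr (- real (CARD('n) + 1)) = 1 / ?b ^ (CARD('n) + 1)"
      using ab by (simp only: powr_minus powr_realpow) (simp add: divide_inverse)
    then show ?thesis by simp
  qed
  finally show ?thesis .
qed

lemma D_nonneg: "0 \<le> D * (1 + R * norm (w - x)) powr s"
  using D[of x] norm_ge_zero order_trans by blast

text \<open>The bound is free of the scale: the height \<open>R ^ CARD('n)\<close> of the kernel
  cancels the volume factor in \<open>integral_decay_bound\<close>.\<close>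

lemma decaying_kernel_apply:
  shows "integrable lborel (\<lambda>y. K x y * u y)"
    and "norm (\<integral>y. K x y * u y \<partial>lborel) \<le>
      c * (2 ^ (CARD('n) + 2) * unit_ball_vol CARD('n)) * D * (1 + R * norm (w - x)) powr s"
proof -
  let ?B = "c * R ^ CARD('n) * (D * (1 + R * norm (w - x)) powr s)"
  have 1: "norm (K x y * u y) \<le> ?B / (1 + R * norm (x - y)) ^ (DIM(real^'n) + 1)" for y
  proof -
    have "norm (K x y * u y) \<le> c * R ^ CARD('n) / (1 + R * norm (x - y)) ^ N * norm (u y)"
      unfolding norm_mult using K by (intro mult_right_mono) (auto simp: decaying_kernel_def)
    also have "\<dots> = c * R ^ CARD('n) * (norm (u y) / (1 + R * norm (x - y)) ^ N)" by simp
    also have "\<dots> \<le> c * R ^ CARD('n) * (D * (1 + R * norm (w - x)) powr s / (1 + R * norm (x - y)) ^ (CARD('n) + 1))"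
      using c R by (intro mult_left_mono decay_absorbs_growth) auto
    finally show ?thesis by simp
  qed
  have B: "0 \<le> ?B" by (intro mult_nonneg_nonneg[OF _ D_nonneg]) (use c R in auto)
  show "integrable lborel (\<lambda>y. K x y * u y)"
    by (rule integral_decay_bound(1)[OF _ R B 1]) measurable
  have "norm (\<integral>y. K x y * u y \<partial>lborel) \<le> ?B * (2 ^ (DIM(real^'n) + 2) * unit_ball_vol DIM(real^'n) / R ^ DIM(real^'n))"
    by (rule integral_decay_bound(2)[OF _ R B 1]) measurable
  then show "norm (\<integral>y. K x y * u y \<partial>lborel) \<le>
      c * (2 ^ (CARD('n) + 2) * unit_ball_vol CARD('n)) * D * (1 + R * norm (w - x)) powr s"
    using R by (simp add: field_simps)
qed

text \<open>The gradient carries one more power of \<open>R\<close> than the kernel; it pairs with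
  the displacement to form the scale-free quantity \<open>R * norm (x - x')\<close>.\<close>

lemma decaying_kernel_apply_diff:
  assumes x: "R * norm (x - x') \<le> 1"
  shows "norm ((\<integral>y. K x y * u y \<partial>lborel) - (\<integral>y. K x' y * u y \<partial>lborel)) \<le>
      2 ^ N * c * (2 ^ (CARD('n) + 2) * unit_ball_vol CARD('n)) * (R * norm (x - x')) * D * (1 + R * norm (w - x)) powr s"
proof -
  let ?B = "2 ^ N * (c * R ^ (CARD('n) + 1)) * norm (x - x') * (D * (1 + R * norm (w - x)) powr s)"
  have 1: "norm ((K x y - K x' y) * u y) \<le> ?B / (1 + R * norm (x - y)) ^ (DIM(real^'n) + 1)" for y
  proof -
    have "norm (K x y - K x' y) \<le> 2 ^ N * (c * R ^ (CARD('n) + 1)) / (1 + R * norm (x - y)) ^ N * norm (x - x')"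
      by (rule kernel_difference_bound) (use K R c x in \<open>auto simp: decaying_kernel_def\<close>)
    then have "norm ((K x y - K x' y) * u y) \<le>
        2 ^ N * (c * R ^ (CARD('n) + 1)) / (1 + R * norm (x - y)) ^ N * norm (x - x') * norm (u y)"
      unfolding norm_mult by (intro mult_right_mono) auto
    also have "\<dots> = 2 ^ N * (c * R ^ (CARD('n) + 1)) * norm (x - x') * (norm (u y) / (1 + R * norm (x - y)) ^ N)" by simp
    also have "\<dots> \<le> 2 ^ N * (c * R ^ (CARD('n) + 1)) * norm (x - x') *
        (D * (1 + R * norm (w - x)) powr s / (1 + R * norm (x - y)) ^ (CARD('n) + 1))"
      using c R by (intro mult_left_mono decay_absorbs_growth) auto
    finally show ?thesis by simp
  qed
  have B: "0 \<le> ?B" by (intro mult_nonneg_nonneg[OF _ D_nonneg]) (use c R in auto)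
  have "norm (\<integral>y. (K x y - K x' y) * u y \<partial>lborel) \<le> ?B * (2 ^ (DIM(real^'n) + 2) * unit_ball_vol DIM(real^'n) / R ^ DIM(real^'n))"
    by (rule integral_decay_bound(2)[OF _ R B 1]) measurable
  moreover have eq: "(\<integral>y. (K x y - K x' y) * u y \<partial>lborel) = (\<integral>y. K x y * u y \<partial>lborel) - (\<integral>y. K x' y * u y \<partial>lborel)"
    unfolding left_diff_distrib by (rule Bochner_Integration.integral_diff) (rule decaying_kernel_apply)+
  ultimately show ?thesis unfolding eq using R by (simp add: field_simps)
qed

end

section \<open>Continuous representatives and Schwartz functions\<close>

lemma continuous_AE_eq_imp_eq:
  fixes f g :: "'a::euclidean_space \<Rightarrow> complex"
  assumes "continuous_on UNIV f" "continuous_on UNIV g" "AE x in lborel. f x = g x"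
  shows "f = g"
proof -
  let ?S = "{x. f x \<noteq> g x}"
  have S: "open ?S" using assms by (intro open_Collect_neq)
  have "?S \<in> null_sets lborel"
    using assms(3) S by (simp add: AE_iff_null)
  then have "negligible ?S" using negligible_iff_null_sets null_sets_completionI by blast
  then have "?S = {}" using open_not_negligible[OF S] by blast
  then show ?thesis by auto
qed

lemma schwartz_continuous: "f \<in> schwartz_space \<Longrightarrow> continuous_on UNIV f"
  unfolding schwartz_space_def smooth_def
  by (auto intro!: continuous_at_imp_continuous_on differentiable_imp_continuous_within dest: bspec[where x="[]"])

lemma schwartz_measurable [measurable_dest]: "f \<in> schwartz_space \<Longrightarrow> f \<in> borel_measurable borel"
  by (intro borel_measurable_continuous_onI schwartz_continuous)

lemma schwartz_decay:
  assumes "f \<in> schwartz_space"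
  shows "\<exists>C\<ge>0. \<forall>x. norm (f x) \<le> C / (1 + norm x) ^ k"
proof -
  obtain C where C: "\<And>x. (1 + norm x) ^ k * norm (f x) \<le> C"
    using assms unfolding schwartz_space_def by (force dest: bspec[where x="[]"])
  have "0 \<le> (1 + norm (0::'a)) ^ k * norm (f 0)" by simp
  then have "C \<ge> 0" using C[of 0] by linarith
  moreover have "norm (f x) \<le> C / (1 + norm x) ^ k" for x
    using C[of x] by (simp add: field_simps add_pos_nonneg)
  ultimately show ?thesis by blast
qed

lemma schwartz_bounded: "f \<in> schwartz_space \<Longrightarrow> \<exists>C. \<forall>x. norm (f x) \<le> C"
  using schwartz_decay[of f 0] by auto

lemma schwartz_L2:
  assumes "f \<in> schwartz_space"
  shows "f \<in> L2"
proof -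
  note [measurable] = schwartz_measurable[OF assms]
  let ?m = "DIM('a) + 1"
  obtain C where C: "C \<ge> 0" "\<And>x. norm (f x) \<le> C / (1 + norm x) ^ ?m"
    using schwartz_decay[OF assms, of ?m] by auto
  have "integrable lborel (\<lambda>x. complex_of_real ((norm (f x))\<^sup>2))"
  proof (rule integral_decay_bound(1)[where R=1 and x=0 and B="C\<^sup>2"])
    fix x :: 'a
    let ?b = "(1 + norm x) ^ ?m"
    have b: "1 \<le> ?b" by (rule one_le_power) simp
    have "norm (complex_of_real ((norm (f x))\<^sup>2)) = (norm (f x))\<^sup>2" by (simp only: norm_of_real) simp
    also have "\<dots> \<le> (C / ?b)\<^sup>2" using C by (intro power_mono) auto
    also have "\<dots> = C\<^sup>2 / ?b\<^sup>2" by (simp only: power_divide)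
    also have "\<dots> \<le> C\<^sup>2 / ?b"
    proof -
      have "C\<^sup>2 / t\<^sup>2 \<le> C\<^sup>2 / t" if "t \<ge> 1" for t :: real
        using that by (intro divide_left_mono) (auto simp: power2_eq_square)
      then show ?thesis using b by blast
    qed
    finally show "norm (complex_of_real ((norm (f x))\<^sup>2)) \<le> C\<^sup>2 / (1 + 1 * norm (0 - x)) ^ ?m" by simp
  qed auto
  then have "integrable lborel (\<lambda>x. Re (complex_of_real ((norm (f x))\<^sup>2)))" by (rule integrable_Re)
  then show ?thesis by (simp only: L2_def Re_complex_of_real) simp
qed

lemma dyadic_family_borel:
  assumes "dyadic_family \<phi>"
  shows "\<phi> j \<in> borel_measurable borel" "bounded (range (\<phi> j))"
proof -
  have "smooth (\<phi> j)" using assms by (simp add: dyadic_family_def test_functions_def)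
  then have "\<phi> j differentiable (at x)" for x unfolding smooth_def by (auto dest: bspec[where x="[]"])
  then have "continuous_on UNIV (\<phi> j)"
    by (intro continuous_at_imp_continuous_on ballI differentiable_imp_continuous_within) auto
  then show "\<phi> j \<in> borel_measurable borel" by (rule borel_measurable_continuous_onI)
  obtain c :: "nat \<Rightarrow> real" where
    c: "\<And>k j x. norm ((pdiff 1 ^^ k) (\<phi> j) x) \<le> c k * 2 powr (- (of_nat k * of_int j))"
    using assms unfolding dyadic_family_def by blast
  have "norm (\<phi> j x) \<le> c 0" for x using c[of 0 j x] by simp
  then show "bounded (range (\<phi> j))" by (auto simp: bounded_iff)
qed

context pvm
begin

lemma spectral_integral_iff:
  assumes "\<phi> \<in> borel_measurable borel" "bounded (range \<phi>)"
  shows "(f, h) \<in> spectral_integral E \<phi> \<longleftrightarrow> f \<in> L2 \<and> h \<in> L2 \<and> (\<forall>g\<in>L2. l2_inner h g = spectral_form E \<phi> f g)"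
  by (simp add: spectral_integral_def spectral_domain_bounded[OF assms])

text \<open>Resolves the definite description: the graph fixes the class up to null sets, and
  continuity then fixes every value.\<close>

lemma spectral_apply_eqI:
  assumes \<phi>: "\<phi> \<in> borel_measurable borel" "bounded (range \<phi>)"
    and g: "continuous_on UNIV g" "(f, g) \<in> spectral_integral E \<phi>"
  shows "spectral_apply E \<phi> f = g"
  unfolding spectral_apply_def
proof (rule the_equality)
  fix h assume h: "continuous_on UNIV h \<and> (f, h) \<in> spectral_integral E \<phi>"
  have "AE x in lborel. h x = g x"
    using g h by (intro AE_eq_if_l2_inner_eq) (auto simp: spectral_integral_iff[OF \<phi>])
  then show "h = g" using g h by (intro continuous_AE_eq_imp_eq) auto
qed (use g in auto)

end

lemma decaying_kernel_continuous:
  fixes K :: "real^'n \<Rightarrow> real^'n \<Rightarrow> complex"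
  assumes K: "decaying_kernel c N R K" and R: "R > 0" and c: "c \<ge> 0" and N: "N \<ge> CARD('n) + 1"
    and u: "u \<in> borel_measurable borel" "\<And>y. norm (u y) \<le> D"
  shows "continuous_on UNIV (\<lambda>x. \<integral>y. K x y * u y \<partial>lborel)"
proof (rule continuous_at_imp_continuous_on, rule ballI)
  fix x :: "real^'n"
  let ?F = "\<lambda>x. \<integral>y. K x y * u y \<partial>lborel"
  let ?C = "2 ^ N * c * (2 ^ (CARD('n) + 2) * unit_ball_vol CARD('n))"
  \<comment> \<open>Exponent 0 makes a bounded \<open>u\<close> admissible for the weighted
    difference estimate. The base has to be nonzero, because \<open>0 powr 0 = 0\<close>.\<close>
  have u': "norm (u y) \<le> D * (1 + R * norm (x - y)) powr 0" for y
  proof -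
    have "1 + R * norm (x - y) > 0" using R by (simp add: add_pos_nonneg)
    then show ?thesis using u(2)[of y] by simp
  qed
  have N': "real N \<ge> 0 + real CARD('n) + 1" using N by simp
  have "((\<lambda>x'. ?F x - ?F x') \<longlongrightarrow> 0) (at x)"
      proof (rule Lim_null_comparison)
      show "\<forall>\<^sub>F x' in at x. norm (?F x - ?F x') \<le> ?C * (R * norm (x - x')) * D"
        unfolding eventually_at
      proof (intro exI[of _ "1 / R"] conjI ballI impI)
        fix x' assume "x' \<noteq> x \<and> dist x' x < 1 / R"
        then have "R * norm (x - x') \<le> 1" using R by (simp add: dist_norm norm_minus_commute field_simps)
        from decaying_kernel_apply_diff[OF K R c order_refl N' u(1) u' this]
        show "norm (?F x - ?F x') \<le> ?C * (R * norm (x - x')) * D" by simp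
      qed (use R in simp)
      have "((\<lambda>x'. ?C * (R * norm (x - x')) * D) \<longlongrightarrow> ?C * (R * norm (x - x)) * D) (at x)"
        by (intro tendsto_intros)
      then show "((\<lambda>x'. ?C * (R * norm (x - x')) * D) \<longlongrightarrow> 0) (at x)" by simp
    qed
  from tendsto_diff[OF tendsto_const[of "?F x"] this]
  show "isCont ?F x" by (simp add: isCont_def)
qed

lemma kernel_decay_decaying_kernel:
  fixes E :: "real set \<Rightarrow> (real^'n \<Rightarrow> complex) \<Rightarrow> (real^'n \<Rightarrow> complex)"
  assumes "kernel_decay E" "dyadic_family \<phi>"
  shows "\<exists>K. (\<forall>j. integral_kernel (spectral_integral E (\<phi> j)) (K j)) \<and>
    (\<forall>N. \<exists>c>0. \<forall>j. decaying_kernel c N (freq j) (K j))"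
proof -
  obtain K :: "int \<Rightarrow> real^'n \<Rightarrow> real^'n \<Rightarrow> complex" where K: "\<And>j. integral_kernel (spectral_integral E (\<phi> j)) (K j)"
    "\<And>j x y. (\<lambda>x. K j x y) differentiable (at x)"
    and bd: "\<And>N::nat. \<exists>c>0. \<forall>j x y.
                norm (K j x y) \<le>
                  c * 2 powr (of_nat CARD('n) * of_int j / 2)
                    / (1 + freq j * norm (x - y)) ^ N \<and>
                norm (gradient (\<lambda>x. K j x y) x) \<le>
                  c * 2 powr ((of_nat CARD('n) + 1) * of_int j / 2)
                    / (1 + freq j * norm (x - y)) ^ N"
    using assms unfolding kernel_decay_def by blast
  have p: "(2::real) powr (of_nat m * of_int j / 2) = (freq j) ^ m" for m and j :: int
    by (simp add: powr_power mult.commute)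
  have p': "(2::real) powr ((of_nat CARD('n) + 1) * of_int j / 2) = (freq j) ^ (CARD('n) + 1)" for j :: int
    using p[of "CARD('n) + 1" j] by (simp add: add.commute)
  have "\<exists>c>0. \<forall>j. decaying_kernel c N (freq j) (K j)" for N
    using bd[of N] K unfolding decaying_kernel_def p p' integral_kernel_def by blast
  then show ?thesis using K by blast
qed

text \<open>Scales within a factor 2 of each other are interchangeable: \<open>2 ^ N\<close> pays
  for the decay weight and \<open>2 ^ (CARD('n) + 1)\<close> for the power of the scale in front,
  which is largest in the gradient bound.\<close>

lemma decaying_kernel_rescale:
  fixes K :: "real^'n \<Rightarrow> real^'n \<Rightarrow> complex"
  assumes K: "decaying_kernel c N R' K" and c: "c \<ge> 0" and R: "0 < R" "R \<le> 2 * R'" "R' \<le> 2 * R"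
  shows "decaying_kernel (2 ^ (CARD('n) + 1) * 2 ^ N * c) N R K"
proof -
  have *: "c * R' ^ m / (1 + R' * d) ^ N \<le> 2 ^ (CARD('n) + 1) * 2 ^ N * c * R ^ m / (1 + R * d) ^ N"
    if m: "m \<le> CARD('n) + 1" and d: "d \<ge> 0" for m d
  proof -
    have R': "R' > 0" using R by linarith
    have "R * d \<le> 2 * R' * d" using R d by (intro mult_right_mono)
    then have "1 + R * d \<le> 2 * (1 + R' * d)" by simp
    then have "(1 + R * d) ^ N \<le> (2 * (1 + R' * d)) ^ N" using R d by (intro power_mono) auto
    then have 1: "(1 + R * d) ^ N \<le> 2 ^ N * (1 + R' * d) ^ N" unfolding power_mult_distrib[symmetric] .
    have "R' ^ m \<le> (2 * R) ^ m" using R R' by (intro power_mono) auto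
    also have "\<dots> = 2 ^ m * R ^ m" by (simp add: power_mult_distrib)
    also have "\<dots> \<le> 2 ^ (CARD('n) + 1) * R ^ m" using R m by (intro mult_right_mono power_increasing) auto
    finally have 2: "R' ^ m \<le> 2 ^ (CARD('n) + 1) * R ^ m" .
    have pos: "0 < (1 + R' * d) ^ N" "0 < (1 + R * d) ^ N" using R R' d by (auto simp: add_pos_nonneg)
    have "c * R' ^ m * (1 + R * d) ^ N \<le> c * (2 ^ (CARD('n) + 1) * R ^ m) * (2 ^ N * (1 + R' * d) ^ N)"
      using 1 2 c pos R by (intro mult_mono mult_left_mono) auto
    then show ?thesis using pos by (simp add: field_simps)
  qed
  show ?thesis
    unfolding decaying_kernel_def
  proof (intro conjI allI)
    fix x y
    have "norm (K x y) \<le> c * R' ^ CARD('n) / (1 + R' * norm (x - y)) ^ N"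
      using K by (simp add: decaying_kernel_def)
    also have "\<dots> \<le> 2 ^ (CARD('n) + 1) * 2 ^ N * c * R ^ CARD('n) / (1 + R * norm (x - y)) ^ N"
      by (rule *) auto
    finally show "norm (K x y) \<le> 2 ^ (CARD('n) + 1) * 2 ^ N * c * R ^ CARD('n) / (1 + R * norm (x - y)) ^ N" .
    have "norm (gradient (\<lambda>x. K x y) x) \<le> c * R' ^ (CARD('n) + 1) / (1 + R' * norm (x - y)) ^ N"
      using K unfolding decaying_kernel_def by blast
    also have "\<dots> \<le> 2 ^ (CARD('n) + 1) * 2 ^ N * c * R ^ (CARD('n) + 1) / (1 + R * norm (x - y)) ^ N"
      by (rule *) auto
    finally show "norm (gradient (\<lambda>x. K x y) x) \<le>
        2 ^ (CARD('n) + 1) * 2 ^ N * c * R ^ (CARD('n) + 1) / (1 + R * norm (x - y)) ^ N" .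
  qed (use K in \<open>auto simp: decaying_kernel_def\<close>)
qed

section \<open>The pointwise reproducing formula and slow variation\<close>

locale spectral_kernel = pvm E for E :: "real set \<Rightarrow> (real^'n \<Rightarrow> complex) \<Rightarrow> (real^'n \<Rightarrow> complex)" +
  assumes decay: "kernel_decay E"
begin

lemma spectral_apply_kernel:
  assumes \<phi>: "dyadic_family \<phi>" and K: "integral_kernel (spectral_integral E (\<phi> j)) K"
    "decaying_kernel c (CARD('n) + 1) R K" "R > 0" "c \<ge> 0" and f: "f \<in> schwartz_space"
  shows "spectral_apply E (\<phi> j) f = (\<lambda>x. \<integral>y. K x y * f y \<partial>lborel)"
proof (rule spectral_apply_eqI[OF dyadic_family_borel[OF \<phi>]])
  show "continuous_on UNIV (\<lambda>x. \<integral>y. K x y * f y \<partial>lborel)"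
    using schwartz_bounded[OF f] decaying_kernel_continuous[OF K(2-4) order_refl schwartz_measurable[OF f]] by blast
  show "(f, \<lambda>x. \<integral>y. K x y * f y \<partial>lborel) \<in> spectral_integral E (\<phi> j)"
    using K(1) schwartz_L2[OF f] by (simp add: integral_kernel_def)
qed

text \<open>Continuity licenses pointwise statements about an element of L^2; boundedness will make
  the Peetre maximal function finite, so that a fraction of it can be absorbed.\<close>

lemma spectral_apply_regular:
  assumes \<phi>: "dyadic_family \<phi>" and f: "f \<in> schwartz_space"
  shows "continuous_on UNIV (spectral_apply E (\<phi> j) f)"
    and "\<exists>D. \<forall>x. norm (spectral_apply E (\<phi> j) f x) \<le> D"
    and "(f, spectral_apply E (\<phi> j) f) \<in> spectral_integral E (\<phi> j)"
proof -
  obtain K where K: "\<And>j. integral_kernel (spectral_integral E (\<phi> j)) (K j)"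
    and bd: "\<And>N. \<exists>c>0. \<forall>j. decaying_kernel c N (freq j) (K j)"
    using kernel_decay_decaying_kernel[OF decay \<phi>] by blast
  obtain c where c: "c > 0" "decaying_kernel c (CARD('n) + 1) (freq j) (K j)"
    using bd by blast
  let ?R = "freq j"
  have R: "?R > 0" by simp
  have eq: "spectral_apply E (\<phi> j) f = (\<lambda>x. \<integral>y. K j x y * f y \<partial>lborel)"
    by (rule spectral_apply_kernel[OF \<phi> K c(2)]) (use c f in auto)
  obtain B where B: "\<And>x. norm (f x) \<le> B" using schwartz_bounded[OF f] by blast
  show "continuous_on UNIV (spectral_apply E (\<phi> j) f)"
    unfolding eq by (rule decaying_kernel_continuous[OF c(2) R _ _ schwartz_measurable[OF f] B]) (use c in auto)
  show "(f, spectral_apply E (\<phi> j) f) \<in> spectral_integral E (\<phi> j)"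
    unfolding eq using K[of j] schwartz_L2[OF f] by (simp add: integral_kernel_def)
  have "norm (spectral_apply E (\<phi> j) f x) \<le> c * (2 ^ (CARD('n) + 2) * unit_ball_vol CARD('n)) * B" for x
  proof -
    have B': "norm (f y) \<le> B * (1 + ?R * norm (x - y)) powr 0" for y
    proof -
      have "1 + ?R * norm (x - y) > 0" by (simp add: add_pos_nonneg)
      then show ?thesis using B[of y] by simp
    qed
    show ?thesis
      unfolding eq using decaying_kernel_apply(2)[OF c(2) R _ order_refl _ schwartz_measurable[OF f] B', of x] c by simp
  qed
  then show "\<exists>D. \<forall>x. norm (spectral_apply E (\<phi> j) f x) \<le> D" by blast
qed

text \<open>Multiplicativity and (\<psi>(j-1) + \<psi>(j) + \<psi>(j+1)) \<phi>(j) = \<phi>(j) give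
  the identity between classes, tested against every \<open>g\<close>. Both sides are continuous, so
  it holds at every point.\<close>

lemma reproducing_formula:
  assumes \<phi>: "dyadic_family \<phi>" and f: "f \<in> schwartz_space" and \<psi>: "dyadic_family \<psi>"
    and sum: "\<And>x. \<phi> j x \<noteq> 0 \<Longrightarrow> \<psi> (j - 1) x + \<psi> j x + \<psi> (j + 1) x = 1"
    and K: "\<And>j. integral_kernel (spectral_integral E (\<psi> j)) (K j)"
      "\<And>j. decaying_kernel c (CARD('n) + 1) (freq j) (K j)" "c \<ge> 0"
  shows "spectral_apply E (\<phi> j) f x = (\<Sum>i\<in>{j - 1, j, j + 1}. \<integral>y. K i x y * spectral_apply E (\<phi> j) f y \<partial>lborel)"
proof -
  let ?h = "spectral_apply E (\<phi> j) f"
  let ?u = "\<lambda>i x. \<integral>y. K i x y * ?h y \<partial>lborel"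
  note h = spectral_apply_regular[OF \<phi> f, of j]
  note \<phi>b = dyadic_family_borel[OF \<phi>, of j] and \<psi>b = dyadic_family_borel[OF \<psi>]
  have hL2: "?h \<in> L2" and hf: "\<And>g. g \<in> L2 \<Longrightarrow> l2_inner ?h g = spectral_form E (\<phi> j) f g" and fL2: "f \<in> L2"
    using h(3) by (auto simp: spectral_integral_iff[OF \<phi>b])
  have u: "(?h, ?u i) \<in> spectral_integral E (\<psi> i)" for i
    using K(1)[of i] hL2 by (simp add: integral_kernel_def)
  have uL2: "?u i \<in> L2" for i using u[of i] by (simp add: spectral_integral_iff[OF \<psi>b])
  have bp: "bounded (range (\<lambda>t. \<psi> i t * \<phi> j t))" for i
  proof -
    obtain A B where "\<And>t. norm (\<psi> i t) \<le> A" "\<And>t. norm (\<phi> j t) \<le> B"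
      using \<psi>b(2)[of i] \<phi>b(2) by (auto simp: bounded_iff)
    then have "norm (\<psi> i t * \<phi> j t) \<le> A * B" for t
      unfolding norm_mult by (intro mult_mono) (auto intro: order_trans[OF norm_ge_zero])
    then show ?thesis by (auto simp: bounded_iff)
  qed
  have mp: "(\<lambda>t. \<psi> i t * \<phi> j t) \<in> borel_measurable borel" for i
    using \<psi>b \<phi>b by measurable
  have "AE x in lborel. (\<Sum>i\<in>{j - 1, j, j + 1}. ?u i x) = ?h x"
  proof (rule AE_eq_if_l2_inner_eq)
    show "(\<lambda>x. \<Sum>i\<in>{j - 1, j, j + 1}. ?u i x) \<in> L2" by (intro L2_sum uL2)
    show "?h \<in> L2" by (rule hL2)
    fix g :: "real^'n \<Rightarrow> complex" assume g: "g \<in> L2"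
    have "l2_inner (\<lambda>x. \<Sum>i\<in>{j - 1, j, j + 1}. ?u i x) g = (\<Sum>i\<in>{j - 1, j, j + 1}. l2_inner (?u i) g)"
      by (rule l2_inner_sum_left) (use uL2 g in auto)
    also have "\<dots> = (\<Sum>i\<in>{j - 1, j, j + 1}. spectral_form E (\<lambda>t. \<psi> i t * \<phi> j t) f g)"
    proof (rule sum.cong[OF refl])
      fix i
      have "l2_inner (?u i) g = spectral_form E (\<psi> i) ?h g"
        using u[of i] g by (simp add: spectral_integral_iff[OF \<psi>b])
      also have "\<dots> = spectral_form E (\<lambda>t. \<psi> i t * \<phi> j t) f g"
        by (rule spectral_form_mult[OF fL2 hL2 g \<phi>b hf \<psi>b])
      finally show "l2_inner (?u i) g = spectral_form E (\<lambda>t. \<psi> i t * \<phi> j t) f g" .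
    qed
    also have "\<dots> = spectral_form E (\<lambda>t. \<psi> (j - 1) t * \<phi> j t) f g +
        (spectral_form E (\<lambda>t. \<psi> j t * \<phi> j t) f g + spectral_form E (\<lambda>t. \<psi> (j + 1) t * \<phi> j t) f g)"
      by simp
    also have "\<dots> = spectral_form E (\<lambda>t. \<psi> (j - 1) t * \<phi> j t + (\<psi> j t * \<phi> j t + \<psi> (j + 1) t * \<phi> j t)) f g"
    proof -
      have b2: "bounded (range (\<lambda>t. \<psi> j t * \<phi> j t + \<psi> (j + 1) t * \<phi> j t))"
        by (rule bounded_plus_comp[OF bp bp])
      have m2: "(\<lambda>t. \<psi> j t * \<phi> j t + \<psi> (j + 1) t * \<phi> j t) \<in> borel_measurable borel"
        by (intro borel_measurable_add mp)
      show ?thesis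
        unfolding spectral_form_add[OF fL2 g mp bp m2 b2] spectral_form_add[OF fL2 g mp bp mp bp] ..
    qed
    also have "(\<lambda>t. \<psi> (j - 1) t * \<phi> j t + (\<psi> j t * \<phi> j t + \<psi> (j + 1) t * \<phi> j t)) = \<phi> j"
    proof
      fix t
      have "\<psi> (j - 1) t * \<phi> j t + (\<psi> j t * \<phi> j t + \<psi> (j + 1) t * \<phi> j t) =
        (\<psi> (j - 1) t + \<psi> j t + \<psi> (j + 1) t) * \<phi> j t" by (simp add: algebra_simps)
      then show "\<psi> (j - 1) t * \<phi> j t + (\<psi> j t * \<phi> j t + \<psi> (j + 1) t * \<phi> j t) = \<phi> j t"
        using sum[of t] by (cases "\<phi> j t = 0") auto
    qed
    also have "spectral_form E (\<phi> j) f g = l2_inner ?h g" using hf[OF g] by simp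
    finally show "l2_inner (\<lambda>x. \<Sum>i\<in>{j - 1, j, j + 1}. ?u i x) g = l2_inner ?h g" .
  qed
  moreover have "continuous_on UNIV (\<lambda>x. \<Sum>i\<in>{j - 1, j, j + 1}. ?u i x)"
  proof (rule continuous_on_sum)
    fix i
    obtain D where "\<And>x. norm (?h x) \<le> D" using h(2) by blast
    then show "continuous_on UNIV (?u i)"
      by (intro decaying_kernel_continuous[OF K(2)] borel_measurable_continuous_onI h(1)) (use K(3) in auto)
  qed
  ultimately have "(\<lambda>x. \<Sum>i\<in>{j - 1, j, j + 1}. ?u i x) = ?h"
    by (intro continuous_AE_eq_imp_eq h(1))
  then show ?thesis by (rule fun_cong[symmetric])
qed

text \<open>In the reproducing formula \<open>spectral_apply E (\<phi> j) f\<close> is integrated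
  against kernel differences, and its own weighted bound \<open>D\<close> controls the result.
  \<open>C\<close> is chosen before \<open>f\<close>, \<open>j\<close> and \<open>D\<close>, and the
  final factor 3 counts the neighbouring kernels.\<close>

lemma slow_variation:
  assumes \<phi>: "dyadic_family \<phi>" and s: "s \<ge> 0"
  shows "\<exists>C>0. \<forall>f\<in>schwartz_space. \<forall>j x x' w D.
    (\<forall>t. norm (spectral_apply E (\<phi> j) f t) \<le> D * (1 + freq j * norm (w - t)) powr s) \<longrightarrow>
    freq j * norm (x - x') \<le> 1 \<longrightarrow>
    norm (spectral_apply E (\<phi> j) f x - spectral_apply E (\<phi> j) f x') \<le>
      C * (freq j * norm (x - x')) * D * (1 + freq j * norm (w - x)) powr s"
proof -
  obtain \<psi> where \<psi>: "dyadic_family \<psi>"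
    "\<And>j x. 2 powr (of_int j - 2) \<le> \<bar>x\<bar> \<Longrightarrow> \<bar>x\<bar> \<le> 2 powr of_int j \<Longrightarrow> \<psi> (j - 1) x + \<psi> j x + \<psi> (j + 1) x = 1"
    using dyadic_partition by blast
  obtain K where K: "\<And>j. integral_kernel (spectral_integral E (\<psi> j)) (K j)"
    and bd: "\<And>N. \<exists>c>0. \<forall>j. decaying_kernel c N (freq j) (K j)"
    using kernel_decay_decaying_kernel[OF decay \<psi>(1)] by blast
  obtain c0 where c0: "c0 > 0" "\<And>j. decaying_kernel c0 (CARD('n) + 1) (freq j) (K j)"
    using bd by blast
  \<comment> \<open>Order \<open>CARD('n) + 1\<close> is enough for the representation; differences
    of weighted functions also need \<open>s\<close> orders to absorb the growth.\<close>
  define N where "N = nat \<lceil>s + CARD('n) + 1\<rceil>"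
  have N: "real N \<ge> s + CARD('n) + 1" unfolding N_def by linarith
  obtain c where c: "c > 0" "\<And>j. decaying_kernel c N (freq j) (K j)"
    using bd by blast
  define c' where "c' = 2 ^ (CARD('n) + 1) * 2 ^ N * c"
  define C where "C = 2 ^ N * c' * (2 ^ (CARD('n) + 2) * unit_ball_vol CARD('n))"
  have c': "c' > 0" using c by (simp add: c'_def)
  then have C: "C > 0" by (simp add: C_def)
  have "norm (spectral_apply E (\<phi> j) f x - spectral_apply E (\<phi> j) f x') \<le>
      3 * C * (freq j * norm (x - x')) * D * (1 + freq j * norm (w - x)) powr s"
    if f: "f \<in> schwartz_space" and x: "freq j * norm (x - x') \<le> 1"
      and D: "\<And>t. norm (spectral_apply E (\<phi> j) f t) \<le> D * (1 + freq j * norm (w - t)) powr s"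
    for f j x x' w D
  proof -
    let ?h = "spectral_apply E (\<phi> j) f"
    let ?R = "freq j"
    let ?u = "\<lambda>i x. \<integral>y. K i x y * ?h y \<partial>lborel"
    have hm: "?h \<in> borel_measurable borel"
      by (intro borel_measurable_continuous_onI spectral_apply_regular \<phi> f)
    have sum: "\<psi> (j - 1) x + \<psi> j x + \<psi> (j + 1) x = 1" if "\<phi> j x \<noteq> 0" for x
    proof -
      have "x \<in> closure {x. \<phi> j x \<noteq> 0}" by (rule subsetD[OF closure_subset]) (simp add: that)
      then have "2 powr (of_int j - 2) \<le> \<bar>x\<bar> \<and> \<bar>x\<bar> \<le> 2 powr of_int j"
        using \<phi> unfolding dyadic_family_def by (auto dest!: spec[where x=j])
      then show ?thesis using \<psi>(2) by blast
    qed
    have rep: "?h x = (\<Sum>i\<in>{j - 1, j, j + 1}. ?u i x)" for x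
      by (rule reproducing_formula[OF \<phi> f \<psi>(1) sum K c0(2)]) (use c0 in auto)
    have Kj: "decaying_kernel c' N ?R (K i)" if "i \<in> {j - 1, j, j + 1}" for i
      unfolding c'_def
    proof (rule decaying_kernel_rescale[OF c(2)[of i]])
      have "real_of_int j / 2 \<le> 1 + real_of_int i / 2" "real_of_int i / 2 \<le> 1 + real_of_int j / 2"
        using that by auto
      then have "2 powr (real_of_int j / 2) \<le> 2 powr (1 + real_of_int i / 2)"
        "2 powr (real_of_int i / 2) \<le> 2 powr (1 + real_of_int j / 2)"
        by (intro powr_mono; simp)+
      then show "2 powr (real_of_int j / 2) \<le> 2 * 2 powr (real_of_int i / 2)"
        "2 powr (real_of_int i / 2) \<le> 2 * 2 powr (real_of_int j / 2)"
        by (simp_all add: powr_add)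
    qed (use c in auto)
    have *: "norm (?u i x - ?u i x') \<le> C * (?R * norm (x - x')) * D * (1 + ?R * norm (w - x)) powr s"
      if "i \<in> {j - 1, j, j + 1}" for i
      unfolding C_def by (rule decaying_kernel_apply_diff[OF Kj[OF that] _ _ s N hm D x]) (use c' in auto)
    have "norm (?h x - ?h x') = norm (\<Sum>i\<in>{j - 1, j, j + 1}. ?u i x - ?u i x')"
      unfolding rep[of x] rep[of x'] by (simp only: sum_subtractf)
    also have "\<dots> \<le> (\<Sum>i\<in>{j - 1, j, j + 1}. norm (?u i x - ?u i x'))" by (rule norm_sum)
    also have "\<dots> \<le> (\<Sum>i\<in>{j - 1, j, j + 1}. C * (?R * norm (x - x')) * D * (1 + ?R * norm (w - x)) powr s)"
      by (rule sum_mono) (rule *)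
    also have "\<dots> = 3 * C * (?R * norm (x - x')) * D * (1 + ?R * norm (w - x)) powr s"
      by simp
    finally show ?thesis .
  qed
  then show ?thesis using C by (intro exI[of _ "3 * C"]) auto
qed

end

section \<open>The Hardy-Littlewood maximal function\<close>

lemma nn_integral_count_space_ge_point:
  assumes "x \<in> A"
  shows "f x \<le> (\<integral>\<^sup>+i. f i \<partial>count_space A)"
proof -
  have "f x = (\<integral>\<^sup>+i. f i * indicator {x} i \<partial>count_space A)"
    using assms by (subst nn_integral_indicator_singleton) auto
  also have "\<dots> \<le> (\<integral>\<^sup>+i. f i \<partial>count_space A)"
    by (intro nn_integral_mono) (auto simp: indicator_def)
  finally show ?thesis .
qed

text \<open>As an integral over counting measure, the sum over \<open>j\<close> can be exchanged
  with Lebesgue integrals and takes values in the extended half-line without summability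
  conditions.\<close>

abbreviation int_sum :: "(int \<Rightarrow> ennreal) \<Rightarrow> ennreal" where
  "int_sum f \<equiv> integral\<^sup>N (count_space UNIV) f"

lemma epowr_top [simp]: "epowr \<infinity> a = \<infinity>" "epowr top a = \<infinity>"
  by (simp_all add: epowr_def)

lemma epowr_ennreal: "0 \<le> r \<Longrightarrow> epowr (ennreal r) a = ennreal (r powr a)"
  by (simp add: epowr_def)

lemma epowr_0 [simp]: "epowr 0 a = 0"
  by (simp add: epowr_def)

lemma epowr_1 [simp]: "epowr 1 a = 1"
  by (simp add: epowr_def)

lemma epowr_one_exponent [simp]: "epowr x 1 = x"
  by (cases x) (auto simp: epowr_ennreal)

lemma epowr_mono: "x \<le> y \<Longrightarrow> 0 \<le> a \<Longrightarrow> epowr x a \<le> epowr y a"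
  by (cases x; cases y) (auto simp: epowr_ennreal top_unique intro!: ennreal_leI powr_mono2)

lemma epowr_mult: "0 < a \<Longrightarrow> epowr (x * y) a = epowr x a * epowr y a"
proof (cases x; cases y)
  fix r t :: real assume "0 \<le> r" "x = ennreal r" "0 \<le> t" "y = ennreal t"
  then show ?thesis by (simp add: epowr_ennreal ennreal_mult[symmetric] powr_mult)
next
  fix r :: real assume "0 < a" "0 \<le> r" "x = ennreal r" "y = top"
  then show ?thesis by (cases "r = 0") (auto simp: epowr_ennreal ennreal_mult_top ennreal_mult_eq_top_iff)
next
  fix r :: real assume "0 < a" "0 \<le> r" "y = ennreal r" "x = top"
  then show ?thesis by (cases "r = 0") (auto simp: epowr_ennreal ennreal_top_mult)
next
  assume "x = top" "y = top"
  then show ?thesis by simp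
qed

lemma epowr_epowr: "epowr (epowr x a) b = epowr x (a * b)"
  by (cases x) (auto simp: epowr_ennreal powr_powr)

lemma epowr_add: "0 < a \<Longrightarrow> 0 < b \<Longrightarrow> epowr x (a + b) = epowr x a * epowr x b"
  by (cases x) (auto simp: epowr_ennreal ennreal_mult[symmetric] powr_add)

lemma epowr_le_iff: "0 < a \<Longrightarrow> epowr x a \<le> c \<longleftrightarrow> x \<le> epowr c (1 / a)"
proof
  assume a: "0 < a" and "epowr x a \<le> c"
  then have "epowr (epowr x a) (1 / a) \<le> epowr c (1 / a)" by (intro epowr_mono) auto
  then show "x \<le> epowr c (1 / a)" using a by (simp add: epowr_epowr)
next
  assume a: "0 < a" and "x \<le> epowr c (1 / a)"
  then have "epowr x a \<le> epowr (epowr c (1 / a)) a" by (intro epowr_mono) auto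
  then show "epowr x a \<le> c" using a by (simp add: epowr_epowr)
qed

lemma epowr_measurable [measurable (raw)]:
  assumes [measurable]: "f \<in> borel_measurable M"
  shows "(\<lambda>x. epowr (f x) a) \<in> borel_measurable M"
proof -
  have "{x \<in> space M. f x = \<infinity>} \<in> sets M" by measurable
  moreover have "(\<lambda>x. ennreal (enn2real (f x) powr a)) \<in> borel_measurable M"
    by (intro measurable_compose[OF _ measurable_ennreal] powr_real_measurable borel_measurable_const) measurable
  ultimately show ?thesis unfolding epowr_def by (intro measurable_If) auto
qed

text \<open>After division by x + y both fractions lie in [0, 1], where u \<le> u^a, and the
  fractions add up to 1.\<close>

lemma epowr_add_le:
  assumes "0 < a" "a \<le> 1"
  shows "epowr (x + y) a \<le> epowr x a + epowr y a"
proof (cases "x + y = 0 \<or> x + y = \<infinity>")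
  case True
  then show ?thesis using assms by (auto simp: epowr_def)
next
  case False
  then obtain r t where rt: "x = ennreal r" "y = ennreal t" "r \<ge> 0" "t \<ge> 0"
    by (cases x; cases y) auto
  then have pos: "r + t > 0" using False by (auto simp: ennreal_plus[symmetric] simp del: ennreal_plus)
  have *: "u \<le> u powr a" if "0 \<le> u" "u \<le> 1" for u :: real
    using that assms powr_mono'[of a 1 u] by (cases "u = 0") auto
  have "1 = r / (r + t) + t / (r + t)" using pos by (simp add: add_divide_distrib[symmetric])
  also have "\<dots> \<le> (r / (r + t)) powr a + (t / (r + t)) powr a"
    using rt pos by (intro add_mono *) auto
  also have "\<dots> = (r powr a + t powr a) / (r + t) powr a"
    using rt pos by (simp add: powr_divide add_divide_distrib)
  finally have "(r + t) powr a \<le> r powr a + t powr a" using pos by (simp add: field_simps)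
  then show ?thesis using rt
    by (simp add: epowr_ennreal ennreal_plus[symmetric] ennreal_leI del: ennreal_plus)
qed

lemma epowr_suminf_le:
  assumes a: "0 < a" "a \<le> 1"
  shows "epowr (\<Sum>k. f k) a \<le> (\<Sum>k. epowr (f k) a)"
proof -
  have fin: "epowr (\<Sum>k<m. f k) a \<le> (\<Sum>k<m. epowr (f k) a)" for m
  proof (induction m)
    case (Suc m)
    then show ?case using epowr_add_le[OF a, of "\<Sum>k<m. f k" "f m"]
      by (simp add: add.commute) (meson add_left_mono order_trans)
  qed simp
  have "(\<Sum>k<m. f k) \<le> epowr (\<Sum>k. epowr (f k) a) (1 / a)" for m
    using fin[of m] sum_le_suminf[of "\<lambda>k. epowr (f k) a" "{..<m}"] a
    by (subst epowr_le_iff[symmetric]) (auto intro: order_trans)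
  then have "(\<Sum>k. f k) \<le> epowr (\<Sum>k. epowr (f k) a) (1 / a)"
    by (simp add: suminf_eq_SUP SUP_le_iff)
  then show ?thesis using a by (simp add: epowr_le_iff)
qed

section \<open>Ball averages and the weak type inequality\<close>

definition Av :: "real \<Rightarrow> ('a::euclidean_space \<Rightarrow> ennreal) \<Rightarrow> 'a \<Rightarrow> ennreal" where
  "Av r h x = ennreal (1 / r ^ DIM('a)) * (\<integral>\<^sup>+y. h y * indicator (cball x r) y \<partial>lborel)"

text \<open>Only radii 2^(i/2) enter. They include all radii of the later shells, and a countable
  supremum keeps the function measurable.\<close>

definition maximal :: "('a::euclidean_space \<Rightarrow> ennreal) \<Rightarrow> 'a \<Rightarrow> ennreal" where
  "maximal h x = (SUP i::int. Av (2 powr (of_int i / 2)) h x)"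

lemma unit_ball_vol_neq_0 [simp]: "0 \<le> n \<Longrightarrow> unit_ball_vol n \<noteq> 0"
  by (drule unit_ball_vol_pos) linarith

lemma cball_sets_borel [measurable]: "cball x r \<in> sets borel"
  by (rule borel_closed) simp

lemma indicator_cball_measurable [measurable]:
  "(\<lambda>p. indicator (cball (fst p) r) (snd p) :: ennreal) \<in> borel_measurable (lborel \<Otimes>\<^sub>M lborel)"
proof -
  have "closed {p :: 'a \<times> 'a. dist (fst p) (snd p) \<le> r}"
    by (intro closed_Collect_le continuous_intros)
  then have "{p :: 'a \<times> 'a. dist (fst p) (snd p) \<le> r} \<in> sets borel"
    by (rule borel_closed)
  moreover have "sets (lborel \<Otimes>\<^sub>M lborel) = sets (borel :: ('a \<times> 'a) measure)"
    unfolding lborel_prod by (rule sets_lborel)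
  ultimately have "{p :: 'a \<times> 'a. dist (fst p) (snd p) \<le> r} \<in> sets (lborel \<Otimes>\<^sub>M lborel)"
    by blast
  then have "(indicator {p :: 'a \<times> 'a. dist (fst p) (snd p) \<le> r} :: _ \<Rightarrow> ennreal) \<in> borel_measurable (lborel \<Otimes>\<^sub>M lborel)"
    by (rule borel_measurable_indicator)
  moreover have "(\<lambda>p. indicator (cball (fst p) r) (snd p)) = (indicator {p :: 'a \<times> 'a. dist (fst p) (snd p) \<le> r} :: _ \<Rightarrow> ennreal)"
    by (auto simp: indicator_def)
  ultimately show ?thesis by simp
qed

lemma Av_measurable [measurable]:
  assumes [measurable]: "h \<in> borel_measurable borel"
  shows "Av r h \<in> borel_measurable borel"
proof -
  have "(\<lambda>p. h (snd p) * indicator (cball (fst p) r) (snd p)) \<in> borel_measurable (lborel \<Otimes>\<^sub>M lborel)"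
    by measurable
  then have "(\<lambda>x. \<integral>\<^sup>+y. h y * indicator (cball x r) y \<partial>lborel) \<in> borel_measurable lborel"
    by (intro lborel.borel_measurable_nn_integral) (simp add: case_prod_unfold)
  then show ?thesis unfolding Av_def[abs_def] by simp
qed

lemma maximal_measurable [measurable]:
  "h \<in> borel_measurable borel \<Longrightarrow> maximal h \<in> borel_measurable borel"
  unfolding maximal_def[abs_def] by measurable

lemma Av_mono: "(\<And>y. g y \<le> h y) \<Longrightarrow> Av r g x \<le> Av r h x"
  unfolding Av_def by (intro mult_left_mono nn_integral_mono mult_right_mono) auto

text \<open>Averages are normalised by \<open>r ^ DIM('a)\<close> and not by the volume of the ball,
  hence the factor that accompanies all later constants.\<close>

lemma Av_const:
  assumes "r > 0"
  shows "Av r (\<lambda>_. c) (x::'a::euclidean_space) = c * ennreal (unit_ball_vol DIM('a))"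
proof -
  have "Av r (\<lambda>_. c) x = ennreal (1 / r ^ DIM('a)) * (c * ennreal (unit_ball_vol DIM('a) * r ^ DIM('a)))"
    using assms by (simp add: Av_def nn_integral_cmult_indicator emeasure_cball)
  also have "\<dots> = c * (ennreal (1 / r ^ DIM('a)) * ennreal (unit_ball_vol DIM('a) * r ^ DIM('a)))"
    by (simp add: mult_ac)
  also have "ennreal (1 / r ^ DIM('a)) * ennreal (unit_ball_vol DIM('a) * r ^ DIM('a)) = ennreal (unit_ball_vol DIM('a))"
    using assms by (subst ennreal_mult'[symmetric]) (auto simp: field_simps)
  finally show ?thesis .
qed

text \<open>Membership in a ball of fixed radius is symmetric in centre and point, so Tonelli
  exchanges the roles of \<open>g\<close> and \<open>h\<close>.\<close>

lemma Av_symmetric: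
  fixes g h :: "'a::euclidean_space \<Rightarrow> ennreal"
  assumes [measurable]: "g \<in> borel_measurable borel" "h \<in> borel_measurable borel"
  shows "(\<integral>\<^sup>+x. Av r h x * g x \<partial>lborel) = (\<integral>\<^sup>+x. h x * Av r g x \<partial>lborel)"
proof -
  let ?c = "ennreal (1 / r ^ DIM('a))"
  have m: "(\<lambda>(x, y). ?c * (h y * indicator (cball x r) y * g x)) \<in> borel_measurable (lborel \<Otimes>\<^sub>M lborel)"
  proof -
    have "(\<lambda>p. ?c * (h (snd p) * indicator (cball (fst p) r) (snd p) * g (fst p))) \<in> borel_measurable (lborel \<Otimes>\<^sub>M lborel)"
      by measurable
    then show ?thesis by (simp add: case_prod_unfold)
  qed
  have "(\<integral>\<^sup>+x. Av r h x * g x \<partial>lborel) = (\<integral>\<^sup>+x. (\<integral>\<^sup>+y. ?c * (h y * indicator (cball x r) y * g x) \<partial>lborel) \<partial>lborel)"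
  proof (rule nn_integral_cong)
    fix x
    have "(\<integral>\<^sup>+y. ?c * (h y * indicator (cball x r) y * g x) \<partial>lborel) = ?c * (\<integral>\<^sup>+y. h y * indicator (cball x r) y * g x \<partial>lborel)"
      by (rule nn_integral_cmult) measurable
    also have "(\<integral>\<^sup>+y. h y * indicator (cball x r) y * g x \<partial>lborel) = (\<integral>\<^sup>+y. h y * indicator (cball x r) y \<partial>lborel) * g x"
      by (rule nn_integral_multc) measurable
    finally show "Av r h x * g x = (\<integral>\<^sup>+y. ?c * (h y * indicator (cball x r) y * g x) \<partial>lborel)"
      by (simp add: Av_def mult.assoc)
  qed
  also have "\<dots> = (\<integral>\<^sup>+y. (\<integral>\<^sup>+x. ?c * (h y * indicator (cball x r) y * g x) \<partial>lborel) \<partial>lborel)"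
    by (rule lborel_pair.Fubini'[OF m, symmetric])
  also have "\<dots> = (\<integral>\<^sup>+y. (\<integral>\<^sup>+x. h y * (?c * (g x * indicator (cball y r) x)) \<partial>lborel) \<partial>lborel)"
    by (intro nn_integral_cong) (auto simp: indicator_def dist_commute mult_ac)
  also have "\<dots> = (\<integral>\<^sup>+y. h y * Av r g y \<partial>lborel)"
    by (intro nn_integral_cong) (simp add: Av_def nn_integral_cmult)
  finally show ?thesis .
qed

lemma nn_integral_Av:
  fixes h :: "'a::euclidean_space \<Rightarrow> ennreal"
  assumes "r > 0" and [measurable]: "h \<in> borel_measurable borel"
  shows "(\<integral>\<^sup>+x. Av r h x \<partial>lborel) = ennreal (unit_ball_vol DIM('a)) * (\<integral>\<^sup>+x. h x \<partial>lborel)"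
  using Av_symmetric[of "\<lambda>_. 1" h r] by (simp add: Av_const[OF assms(1)] nn_integral_multc mult.commute)

lemma Av_le_maximal: "Av (2 powr (of_int i / 2)) h x \<le> maximal h x"
  unfolding maximal_def by (rule SUP_upper) simp

lemma maximal_mono: "(\<And>y. g y \<le> h y) \<Longrightarrow> maximal g x \<le> maximal h x"
  unfolding maximal_def by (intro SUP_mono') (rule Av_mono)

text \<open>Each point of the level set is the centre of a ball with \<open>h\<close>-mass at least
  \<open>l * r ^ DIM('a)\<close>. Vitali selects disjoint balls whose fivefold enlargements cover
  the set; the enlargement is the factor \<open>5 ^ DIM('a)\<close>.\<close>

lemma weak_type:
  fixes h :: "'a::euclidean_space \<Rightarrow> ennreal"
  assumes [measurable]: "h \<in> borel_measurable borel" and l: "l > 0"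
  shows "emeasure lborel {x. maximal h x > ennreal l} \<le>
    ennreal (5 ^ DIM('a) * unit_ball_vol DIM('a) / l) * (\<integral>\<^sup>+x. h x \<partial>lborel)"
proof (cases "(\<integral>\<^sup>+x. h x \<partial>lborel) = \<infinity>")
  case True
  have "ennreal (5 ^ DIM('a) * unit_ball_vol DIM('a) / l) \<noteq> 0" using l by (simp add: ennreal_eq_0_iff not_le)
  then show ?thesis using True by (simp add: ennreal_mult_top)
next
  case False
  define I where "I = enn2real (\<integral>\<^sup>+x. h x \<partial>lborel)"
  have I: "(\<integral>\<^sup>+x. h x \<partial>lborel) = ennreal I" "I \<ge> 0" using False by (auto simp: I_def less_top)
  let ?K = "{x. maximal h x > ennreal l}"
  let ?J = "\<lambda>x r. \<integral>\<^sup>+y. h y * indicator (cball x r) y \<partial>lborel"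
  let ?v = "unit_ball_vol (real DIM('a))"
  have "\<exists>r>0. ennreal (l * r ^ DIM('a)) \<le> ?J x r" if "x \<in> ?K" for x
  proof -
    have "\<exists>i::int. ennreal l < Av (2 powr (of_int i / 2)) h x"
      using that by (simp add: maximal_def less_SUP_iff)
    then obtain i :: int where i: "ennreal l < Av (2 powr (of_int i / 2)) h x" by blast
    let ?r = "2 powr (of_int i / 2) :: real"
    have r: "?r > 0" by simp
    have "ennreal (l * ?r ^ DIM('a)) = ennreal (?r ^ DIM('a)) * ennreal l" using l by (simp add: ennreal_mult'[symmetric] mult.commute)
    also have "\<dots> \<le> ennreal (?r ^ DIM('a)) * Av ?r h x" using i by (intro mult_left_mono) auto
    also have "\<dots> = (ennreal (?r ^ DIM('a)) * ennreal (1 / ?r ^ DIM('a))) * ?J x ?r"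
      by (simp only: Av_def mult.assoc)
    also have "ennreal (?r ^ DIM('a)) * ennreal (1 / ?r ^ DIM('a)) = 1"
      by (subst ennreal_mult'[symmetric]) auto
    finally have "ennreal (l * ?r ^ DIM('a)) \<le> ?J x ?r" by simp
    then show ?thesis using r by (intro exI[of _ ?r] conjI)
  qed
  then obtain r where r: "\<And>x. x \<in> ?K \<Longrightarrow> r x > 0" "\<And>x. x \<in> ?K \<Longrightarrow> ennreal (l * r x ^ DIM('a)) \<le> ?J x (r x)"
    by metis
  \<comment> \<open>The covering lemma asks for bounded radii. For a radius above 1, r \<le> r^n
    with n the dimension, and the total mass \<open>I\<close> bounds l r^n.\<close>
  have B: "0 < r x \<and> r x \<le> max 1 (I / l)" if "x \<in> ?K" for x
  proof (intro conjI r(1) that)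
    have "ennreal (l * r x ^ DIM('a)) \<le> (\<integral>\<^sup>+x. h x \<partial>lborel)"
      using r(2)[OF that] by (rule order_trans) (auto intro!: nn_integral_mono simp: indicator_def)
    then have *: "l * r x ^ DIM('a) \<le> I" using I by simp
    show "r x \<le> max 1 (I / l)"
    proof (cases "r x \<le> 1")
      case False
      then have "r x ^ 1 \<le> r x ^ DIM('a)" by (intro power_increasing) (auto simp: Suc_leI)
      then have "l * r x \<le> I" using * l by (smt (verit) mult_left_mono power_one_right)
      then show ?thesis using l by (simp add: field_simps le_max_iff_disj)
    qed simp
  qed
  have cov: "?K \<subseteq> (\<Union>x\<in>?K. cball x (r x))"
  proof
    fix x assume "x \<in> ?K"
    then have "x \<in> cball x (r x)" using r(1)[of x] by simp
    then show "x \<in> (\<Union>x\<in>?K. cball x (r x))" using \<open>x \<in> ?K\<close> by (rule UN_I[rotated])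
  qed
  obtain C where C: "countable C" "C \<subseteq> ?K"
    "pairwise (\<lambda>i j. disjnt (cball i (r i)) (cball j (r j))) C"
    "?K \<subseteq> (\<Union>i\<in>C. cball i (5 * r i))"
    by (rule Vitali_covering_lemma_cballs[where a="\<lambda>x. x", OF cov B]) (assumption, rule that)
  have "emeasure lborel ?K = (\<integral>\<^sup>+x. indicator ?K x \<partial>lborel)" by simp
  also have "\<dots> \<le> (\<integral>\<^sup>+x. (\<integral>\<^sup>+c. indicator (cball c (5 * r c)) x \<partial>count_space C) \<partial>lborel)"
  proof (rule nn_integral_mono)
    fix x
    show "indicator ?K x \<le> (\<integral>\<^sup>+c. indicator (cball c (5 * r c)) x \<partial>count_space C)"
    proof (cases "x \<in> ?K")
      case True
      then obtain c where c: "c \<in> C" "x \<in> cball c (5 * r c)" using C(4) by blast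
      have "(indicator (cball c (5 * r c)) x :: ennreal) \<le> (\<integral>\<^sup>+c. indicator (cball c (5 * r c)) x \<partial>count_space C)"
        by (rule nn_integral_count_space_ge_point[OF c(1), of "\<lambda>c. indicator (cball c (5 * r c)) x"])
      then show ?thesis using c True by (simp add: indicator_def)
    qed (simp add: indicator_def)
  qed
  also have "\<dots> = (\<integral>\<^sup>+c. (\<integral>\<^sup>+x. indicator (cball c (5 * r c)) x \<partial>lborel) \<partial>count_space C)"
    by (intro nn_integral_count_space_nn_integral C(1)) simp
  also have "\<dots> \<le> (\<integral>\<^sup>+c. ennreal (5 ^ DIM('a) * ?v / l) * ?J c (r c) \<partial>count_space C)"
  proof (rule nn_integral_mono)
    fix c assume "c \<in> space (count_space C)"
    then have c: "c \<in> ?K" using C by auto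
    have "(\<integral>\<^sup>+x. indicator (cball c (5 * r c)) x \<partial>lborel) = ennreal (?v * (5 * r c) ^ DIM('a))"
      using r(1)[OF c] by (simp add: emeasure_cball)
    also have "?v * (5 * r c) ^ DIM('a) = (5 ^ DIM('a) * ?v / l) * (l * r c ^ DIM('a))"
      using l by (simp add: power_mult_distrib)
    also have "ennreal \<dots> = ennreal (5 ^ DIM('a) * ?v / l) * ennreal (l * r c ^ DIM('a))"
      using l by (intro ennreal_mult') auto
    also have "\<dots> \<le> ennreal (5 ^ DIM('a) * ?v / l) * ?J c (r c)"
      by (intro mult_left_mono r(2) c) auto
    finally show "(\<integral>\<^sup>+x. indicator (cball c (5 * r c)) x \<partial>lborel) \<le> ennreal (5 ^ DIM('a) * ?v / l) * ?J c (r c)" .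
  qed
  also have "\<dots> = ennreal (5 ^ DIM('a) * ?v / l) * (\<integral>\<^sup>+c. emeasure (density lborel h) (cball c (r c)) \<partial>count_space C)"
    by (subst nn_integral_cmult) (auto simp: emeasure_density)
  \<comment> \<open>Read as values of the measure with density \<open>h\<close>, the masses of
    disjoint balls add up to at most the total mass.\<close>
  also have "(\<integral>\<^sup>+c. emeasure (density lborel h) (cball c (r c)) \<partial>count_space C) = emeasure (density lborel h) (\<Union>c\<in>C. cball c (r c))"
  proof (rule emeasure_UN_countable[symmetric])
    show "disjoint_family_on (\<lambda>c. cball c (r c)) C"
      using C(3) by (auto simp: disjoint_family_on_def pairwise_def disjnt_def)
  qed (use C in auto)
  also have "\<dots> \<le> (\<integral>\<^sup>+x. h x \<partial>lborel)"
  proof -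
    have "emeasure (density lborel h) (\<Union>c\<in>C. cball c (r c)) \<le> emeasure (density lborel h) (space (density lborel h))"
      by (rule emeasure_space)
    also have "\<dots> = (\<integral>\<^sup>+x. h x \<partial>lborel)" by (subst emeasure_density) auto
    finally show ?thesis .
  qed
  finally show ?thesis by (simp add: mult_left_mono)
qed


section \<open>Dyadic layers and the strong type inequality\<close>

lemma nn_integral_int_atMost_powr:
  assumes "a > 0"
  shows "(int_sum (\<lambda>i. ennreal (2 powr (of_int i * a)) * indicator {..m} i)) =
    ennreal (2 powr (of_int m * a) / (1 - 2 powr (- a)))"
proof -
  have q: "0 < 2 powr (- a)" "2 powr (- a) < (1::real)" using assms by (auto simp: powr_less_one)
  have bij: "bij_betw (\<lambda>n. m - int n) UNIV {..m}"
    by (rule bij_betwI[where g="\<lambda>i. nat (m - i)"]) auto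
  have "(int_sum (\<lambda>i. ennreal (2 powr (of_int i * a)) * indicator {..m} i)) =
      (\<integral>\<^sup>+i. ennreal (2 powr (of_int i * a)) \<partial>count_space {..m})"
    by (subst nn_integral_count_space_indicator) auto
  also have "\<dots> = (\<integral>\<^sup>+n. ennreal (2 powr (of_int (m - int n) * a)) \<partial>count_space UNIV)"
    by (rule nn_integral_bij_count_space[OF bij, symmetric])
  also have "\<dots> = (\<Sum>n. ennreal (2 powr (of_int m * a) * (2 powr (- a)) ^ n))"
    unfolding nn_integral_count_space_nat
    by (intro suminf_cong arg_cong[where f=ennreal])
      (simp add: powr_power powr_add[symmetric] algebra_simps)
  also have "\<dots> = ennreal (2 powr (of_int m * a) * (1 / (1 - 2 powr (- a))))"
    using q by (intro suminf_ennreal_eq sums_mult geometric_sums) auto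
  finally show ?thesis by simp
qed

lemma nn_integral_int_atLeast_powr:
  assumes "a > 0"
  shows "(int_sum (\<lambda>i. ennreal (2 powr (- of_int i * a)) * indicator {m..} i)) =
    ennreal (2 powr (- of_int m * a) / (1 - 2 powr (- a)))"
proof -
  have bij: "bij_betw (uminus :: int \<Rightarrow> int) UNIV UNIV"
    by (rule bij_betwI[where g=uminus]) auto
  have "(int_sum (\<lambda>i. ennreal (2 powr (- of_int i * a)) * indicator {m..} i)) =
      (int_sum (\<lambda>i. ennreal (2 powr (of_int (- i) * a)) * indicator {..- m} (- i)))"
    by (intro nn_integral_cong) (auto simp: indicator_def)
  also have "\<dots> = (int_sum (\<lambda>i. ennreal (2 powr (of_int i * a)) * indicator {..- m} i))"
    by (rule nn_integral_bij_count_space[OF bij])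
  also have "\<dots> = ennreal (2 powr (of_int (- m) * a) / (1 - 2 powr (- a)))"
    by (rule nn_integral_int_atMost_powr[OF assms])
  finally show ?thesis by simp
qed

lemma dyadic_bracket:
  assumes "t > (0::real)"
  shows "\<exists>m::int. 2 powr of_int m < t \<and> t \<le> 2 powr (of_int m + 1)"
proof -
  let ?m = "\<lceil>log 2 t\<rceil> - 1"
  have "of_int ?m < log 2 t" "log 2 t \<le> of_int ?m + 1" by linarith+
  then have "2 powr of_int ?m < 2 powr (log 2 t)" "2 powr (log 2 t) \<le> 2 powr (of_int ?m + 1)"
    by (simp_all only: powr_less_cancel_iff powr_le_cancel_iff one_less_numeral_iff semiring_norm)
  then show ?thesis using assms by (intro exI[of _ ?m]) simp
qed

text \<open>For finite nonzero \<open>T\<close> the single top layer, 2^m < T \<le> 2^(m+1), already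
  suffices; this is why the weight has exponent \<open>i + 1\<close>. For infinite \<open>T\<close>
  the terms are unbounded.\<close>

lemma epowr_le_layers:
  assumes a: "a > 0"
  shows "epowr T a \<le> (int_sum (\<lambda>i. ennreal (2 powr ((of_int i + 1) * a)) * indicator {i. ennreal (2 powr of_int i) < T} i))" (is "_ \<le> int_sum ?f")
proof -
  have ge: "?f i \<le> int_sum ?f" for i
    by (rule nn_integral_count_space_ge_point) simp
  show ?thesis
  proof (cases T)
    case (real t)
    show ?thesis
    proof (cases "t = 0")
      case False
      then obtain m :: int where m: "2 powr of_int m < t" "t \<le> 2 powr (of_int m + 1)"
        using dyadic_bracket[of t] real by auto
      have "t powr a \<le> (2 powr (of_int m + 1)) powr a" using m a real by (intro powr_mono2) auto
      then have "t powr a \<le> 2 powr ((of_int m + 1) * a)" by (simp add: powr_powr)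
      then have "epowr T a \<le> ?f m" using m real by (simp add: epowr_ennreal ennreal_leI ennreal_less_iff indicator_def)
      then show ?thesis using ge order_trans by blast
    qed (use real in simp)
  next
    case top
    have "int_sum ?f = top"
    proof (rule ccontr)
      assume "int_sum ?f \<noteq> top"
      then obtain B where B: "int_sum ?f = ennreal B" "B \<ge> 0" by (cases "int_sum ?f") auto
      \<comment> \<open>Chosen so that the layer with index \<open>i\<close> alone exceeds the
        supposed finite value \<open>B\<close> of the sum.\<close>
      define i where "i = \<lceil>log 2 (B + 1) / a\<rceil>"
      have "log 2 (B + 1) / a \<le> of_int i + 1" unfolding i_def by linarith
      then have "log 2 (B + 1) \<le> (of_int i + 1) * a" using a by (simp add: field_simps)
      then have "2 powr (log 2 (B + 1)) \<le> 2 powr ((of_int i + 1) * a)" by simp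
      then have "B < 2 powr ((of_int i + 1) * a)" using B by simp
      moreover have "ennreal (2 powr ((of_int i + 1) * a)) \<le> ennreal B"
        using ge[of i] B top by (simp add: ennreal_less_top indicator_def)
      ultimately show False using B by simp
    qed
    then show ?thesis by simp
  qed
qed

text \<open>Converse of the layer bound: the layers below \<open>T\<close> form a geometric series
  dominated by its top term.\<close>

lemma layers_le_epowr:
  assumes a: "a > 0"
  shows "(int_sum (\<lambda>i. ennreal (2 powr (of_int i * a)) * indicator {i. ennreal (2 powr of_int i) < T} i)) \<le> ennreal (1 / (1 - 2 powr (- a))) * epowr T a"
proof (cases T)
  case (real t)
  show ?thesis
  proof (cases "t = 0")
    case True
    then show ?thesis using real by (simp add: not_less)
  next
    case False
    then have t: "t > 0" using real by simp
    have q: "2 powr (- a) < (1::real)" using a by (simp add: powr_less_one)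
    obtain m :: int where m: "2 powr of_int m < t" "t \<le> 2 powr (of_int m + 1)"
      using dyadic_bracket[OF t] by auto
    have "(int_sum (\<lambda>i. ennreal (2 powr (of_int i * a)) * indicator {i. ennreal (2 powr of_int i) < T} i))
      \<le> (int_sum (\<lambda>i. ennreal (2 powr (of_int i * a)) * indicator {..m} i))"
    proof (intro nn_integral_mono mult_left_mono)
      fix i :: int
      have "i \<le> m" if "ennreal (2 powr of_int i) < T"
      proof -
        have "2 powr real_of_int i < t" using that real by (simp add: ennreal_less_iff)
        then have "2 powr real_of_int i < 2 powr (of_int m + 1)" using m by linarith
        then show ?thesis by simp
      qed
      then show "(indicator {i. ennreal (2 powr of_int i) < T} i :: ennreal) \<le> indicator {..m} i"
        by (auto simp: indicator_def)
    qed simp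
    also have "\<dots> = ennreal (2 powr (of_int m * a) / (1 - 2 powr (- a)))"
      by (rule nn_integral_int_atMost_powr[OF a])
    also have "\<dots> \<le> ennreal (1 / (1 - 2 powr (- a)) * t powr a)"
    proof (rule ennreal_leI)
      have "2 powr (of_int m * a) = (2 powr of_int m) powr a" by (simp add: powr_powr)
      also have "\<dots> \<le> t powr a" using m a by (intro powr_mono2) auto
      finally show "2 powr (of_int m * a) / (1 - 2 powr (- a)) \<le> 1 / (1 - 2 powr (- a)) * t powr a"
        using q by (simp add: divide_right_mono)
    qed
    also have "\<dots> = ennreal (1 / (1 - 2 powr (- a))) * epowr T a"
      using real q by (simp add: epowr_ennreal ennreal_mult'[symmetric])
    finally show ?thesis .
  qed
next
  case top
  have "2 powr (- a) < (1::real)" using a by (simp add: powr_less_one)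
  then have "ennreal (1 / (1 - 2 powr (- a))) \<noteq> 0" by (simp add: ennreal_eq_0_iff not_le)
  then show ?thesis using top by (simp add: ennreal_mult_top)
qed

text \<open>The counterpart for levels above \<open>T\<close>. The exponent a - 1 is negative, so
  the series converges upwards and its lowest term, of size T^(a-1), dominates.\<close>

lemma upper_layers_le_epowr:
  assumes a: "0 < a" "a < 1"
  shows "T * (int_sum (\<lambda>i. ennreal (2 powr (of_int i * (a - 1))) * indicator {i. T \<le> ennreal (2 powr of_int i)} i)) \<le> ennreal (1 / (1 - 2 powr (a - 1))) * epowr T a"
proof (cases T)
  case (real t)
  show ?thesis
  proof (cases "t = 0")
    case True
    then show ?thesis using real by simp
  next
    case False
    then have t: "t > 0" using real by simp
    have q: "2 powr (a - 1) < (1::real)" using a by (simp add: powr_less_one)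
    obtain m :: int where m: "2 powr of_int m < t" "t \<le> 2 powr (of_int m + 1)"
      using dyadic_bracket[OF t] by auto
    have "(int_sum (\<lambda>i. ennreal (2 powr (of_int i * (a - 1))) * indicator {i. T \<le> ennreal (2 powr of_int i)} i))
      \<le> (int_sum (\<lambda>i. ennreal (2 powr (- of_int i * (1 - a))) * indicator {m + 1..} i))"
    proof (intro nn_integral_mono mult_mono)
      fix i :: int
      have "m + 1 \<le> i" if "T \<le> ennreal (2 powr of_int i)"
      proof -
        have "t \<le> 2 powr real_of_int i" using that real by simp
        then have "2 powr real_of_int m < 2 powr real_of_int i" using m by linarith
        then show ?thesis by simp
      qed
      then show "(indicator {i. T \<le> ennreal (2 powr of_int i)} i :: ennreal) \<le> indicator {m + 1..} i"
        by (auto simp: indicator_def)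
    qed (auto simp: algebra_simps)
    also have "\<dots> = ennreal (2 powr (- of_int (m + 1) * (1 - a)) / (1 - 2 powr (- (1 - a))))"
      using a by (intro nn_integral_int_atLeast_powr) simp
    also have "\<dots> \<le> ennreal (t powr (a - 1) / (1 - 2 powr (a - 1)))"
    proof (rule ennreal_leI)
      have "2 powr (- of_int (m + 1) * (1 - a)) = (2 powr (of_int m + 1)) powr (a - 1)"
        by (simp add: powr_powr algebra_simps)
      also have "\<dots> \<le> t powr (a - 1)" using m a t by (intro powr_mono2') auto
      finally show "2 powr (- of_int (m + 1) * (1 - a)) / (1 - 2 powr (- (1 - a))) \<le> t powr (a - 1) / (1 - 2 powr (a - 1))"
        using q by (simp add: divide_right_mono)
    qed
    finally have "T * (int_sum (\<lambda>i. ennreal (2 powr (of_int i * (a - 1))) * indicator {i. T \<le> ennreal (2 powr of_int i)} i))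
      \<le> T * ennreal (t powr (a - 1) / (1 - 2 powr (a - 1)))"
      by (intro mult_left_mono) auto
    also have "\<dots> = ennreal (1 / (1 - 2 powr (a - 1)) * t powr a)"
      using real t by (simp add: ennreal_mult'[symmetric] powr_diff)
    also have "\<dots> = ennreal (1 / (1 - 2 powr (a - 1))) * epowr T a"
      using real q by (simp add: epowr_ennreal ennreal_mult'[symmetric])
    finally show ?thesis .
  qed
next
  case top
  have "2 powr (a - 1) < (1::real)" using a by (simp add: powr_less_one)
  then have "ennreal (1 / (1 - 2 powr (a - 1))) \<noteq> 0" by (simp add: ennreal_eq_0_iff not_le)
  then show ?thesis using top by (simp add: ennreal_mult_top)
qed

text \<open>The part of \<open>h\<close> that does not exceed \<open>c\<close> contributes at most
  \<open>c * unit_ball_vol\<close> to every average.\<close>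

lemma maximal_truncate:
  fixes h :: "'a::euclidean_space \<Rightarrow> ennreal"
  assumes "h \<in> borel_measurable borel"
  shows "maximal h x \<le> maximal (\<lambda>y. h y * indicator {y. c < h y} y) x + c * ennreal (unit_ball_vol DIM('a))"
proof -
  have "Av r h x \<le> maximal (\<lambda>y. h y * indicator {y. c < h y} y) x + c * ennreal (unit_ball_vol DIM('a))"
    if r: "r = 2 powr (of_int i / 2)" for r and i :: int
  proof -
    note [measurable] = assms
    have "Av r h x \<le> Av r (\<lambda>y. h y * indicator {y. c < h y} y + c) x"
      by (rule Av_mono) (auto simp: indicator_def)
    also have "\<dots> = Av r (\<lambda>y. h y * indicator {y. c < h y} y) x + Av r (\<lambda>_. c) x"
          proof -
      have "(\<integral>\<^sup>+y. h y * indicator {y. c < h y} y * indicator (cball x r) y + c * indicator (cball x r) y \<partial>lborel) =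
          (\<integral>\<^sup>+y. h y * indicator {y. c < h y} y * indicator (cball x r) y \<partial>lborel) + (\<integral>\<^sup>+y. c * indicator (cball x r) y \<partial>lborel)"
        by (rule nn_integral_add) measurable
      then show ?thesis by (simp only: Av_def distrib_right distrib_left)
    qed
    also have "\<dots> \<le> maximal (\<lambda>y. h y * indicator {y. c < h y} y) x + c * ennreal (unit_ball_vol DIM('a))"
      using Av_le_maximal r by (intro add_mono) (auto simp: Av_const)
    finally show ?thesis .
  qed
  then show ?thesis unfolding maximal_def[of h] by (auto intro: SUP_least)
qed

text \<open>Marcinkiewicz interpolation between the weak type inequality and boundedness, by dyadic
  levels: at level 2^i the weak type inequality is applied to the large part of \<open>h\<close>
  only. For fixed \<open>x\<close> the factors 2^(i(P-1)) then sum over the levels below a multiple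
  of \<open>h x\<close> and give \<open>h x\<close> to the power P - 1.\<close>

lemma maximal_strong_type:
  fixes P :: real
  assumes P: "P > 1"
  shows "\<exists>C>0. \<forall>h::'a::euclidean_space \<Rightarrow> ennreal. h \<in> borel_measurable borel \<longrightarrow> (\<integral>\<^sup>+x. epowr (maximal h x) P \<partial>lborel) \<le>
    ennreal C * (\<integral>\<^sup>+x. epowr (h x) P \<partial>lborel)"
proof -
  let ?v = "unit_ball_vol (real DIM('a))"
  have v: "?v > 0" by simp
  define A where "A = 2 powr (P + 1) * 5 ^ DIM('a) * ?v"
  define B where "B = 1 / (1 - 2 powr (- (P - 1)))"
  have A: "A > 0" using v by (simp add: A_def)
  have B: "B > 0" using P by (simp add: B_def powr_less_one)
  define C where "C = A * B * (2 * ?v) powr (P - 1)"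
  have "(2 * ?v) powr (P - 1) > 0" using v by (simp only: powr_gt_zero)
  then have C: "C > 0" using A B by (simp add: C_def)
  have "(\<integral>\<^sup>+x. epowr (maximal h x) P \<partial>lborel) \<le> ennreal C * (\<integral>\<^sup>+x. epowr (h x) P \<partial>lborel)"
    if h[measurable]: "h \<in> borel_measurable borel" for h :: "'a \<Rightarrow> ennreal"
  proof -
    \<comment> \<open>The cut-off height: what lies below \<open>c i\<close> contributes at most
      \<open>c i * ?v\<close> to the maximal function, which is half of the level.\<close>
    define c :: "int \<Rightarrow> real" where "c i = 2 powr of_int i / (2 * ?v)" for i
    define g :: "int \<Rightarrow> 'a \<Rightarrow> ennreal" where "g i y = h y * indicator {y. ennreal (c i) < h y} y" for i y
    have g[measurable]: "g i \<in> borel_measurable borel" for i unfolding g_def by measurable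
    have level: "emeasure lborel {x. ennreal (2 powr of_int i) < maximal h x} \<le>
        ennreal (5 ^ DIM('a) * ?v / 2 powr (of_int i - 1)) * (\<integral>\<^sup>+x. g i x \<partial>lborel)" for i :: int
    proof -
      have sub: "{x. ennreal (2 powr of_int i) < maximal h x} \<subseteq> {x. ennreal (2 powr (of_int i - 1)) < maximal (g i) x}"
      proof (rule subsetI, rule CollectI, rule ccontr)
        fix x assume x: "x \<in> {x. ennreal (2 powr of_int i) < maximal h x}" and n: "\<not> ennreal (2 powr (of_int i - 1)) < maximal (g i) x"
        have "maximal h x \<le> maximal (g i) x + ennreal (c i) * ennreal ?v"
          unfolding g_def[abs_def] by (rule maximal_truncate[OF h])
        also have "\<dots> \<le> ennreal (2 powr (of_int i - 1)) + ennreal (c i) * ennreal ?v"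
          using n by (intro add_right_mono) simp
        also have "ennreal (c i) * ennreal ?v = ennreal (2 powr (of_int i - 1))"
          using v by (simp add: ennreal_mult'[symmetric] c_def powr_diff)
        also have "ennreal (2 powr (of_int i - 1)) + ennreal (2 powr (of_int i - 1)) = ennreal (2 powr of_int i)"
          by (simp add: ennreal_plus[symmetric] powr_diff del: ennreal_plus)
        finally show False using x by simp
      qed
      have "emeasure lborel {x. ennreal (2 powr of_int i) < maximal h x} \<le> emeasure lborel {x. ennreal (2 powr (of_int i - 1)) < maximal (g i) x}"
        by (rule emeasure_mono[OF sub]) measurable
      also have "\<dots> \<le> ennreal (5 ^ DIM('a) * ?v / 2 powr (of_int i - 1)) * (\<integral>\<^sup>+x. g i x \<partial>lborel)"
        by (rule weak_type) auto
      finally show ?thesis .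
    qed
    have "(\<integral>\<^sup>+x. epowr (maximal h x) P \<partial>lborel) \<le>
      (\<integral>\<^sup>+x. (int_sum (\<lambda>i. ennreal (2 powr ((of_int i + 1) * P)) * indicator {x. ennreal (2 powr of_int i) < maximal h x} x)) \<partial>lborel)"
      using P by (intro nn_integral_mono order_trans[OF epowr_le_layers[of P]]) (auto simp: indicator_def)
    also have "\<dots> = (int_sum (\<lambda>i. (\<integral>\<^sup>+x. ennreal (2 powr ((of_int i + 1) * P)) * indicator {x. ennreal (2 powr of_int i) < maximal h x} x \<partial>lborel)))"
      by (rule nn_integral_count_space_nn_integral) auto
    also have "\<dots> = (int_sum (\<lambda>i. ennreal (2 powr ((of_int i + 1) * P)) * emeasure lborel {x. ennreal (2 powr of_int i) < maximal h x}))"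
      by (intro nn_integral_cong nn_integral_cmult_indicator) measurable
    also have "\<dots> \<le> (int_sum (\<lambda>i. (\<integral>\<^sup>+x. ennreal A * (ennreal (2 powr (of_int i * (P - 1))) * g i x) \<partial>lborel)))"
    proof (rule nn_integral_mono)
      fix i :: int
      have "ennreal (2 powr ((of_int i + 1) * P)) * emeasure lborel {x. ennreal (2 powr of_int i) < maximal h x} \<le>
        ennreal (2 powr ((of_int i + 1) * P)) * (ennreal (5 ^ DIM('a) * ?v / 2 powr (of_int i - 1)) * (\<integral>\<^sup>+x. g i x \<partial>lborel))"
        by (intro mult_left_mono level) auto
      also have "\<dots> = ennreal (2 powr ((of_int i + 1) * P) * (5 ^ DIM('a) * ?v / 2 powr (of_int i - 1))) * (\<integral>\<^sup>+x. g i x \<partial>lborel)"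
        by (subst ennreal_mult') (auto simp: mult.assoc)
      also have "2 powr ((of_int i + 1) * P) * (5 ^ DIM('a) * ?v / 2 powr (of_int i - 1)) = A * 2 powr (of_int i * (P - 1))"
        unfolding A_def by (simp add: powr_diff powr_add field_simps)
      also have "ennreal \<dots> * (\<integral>\<^sup>+x. g i x \<partial>lborel) = ennreal A * (ennreal (2 powr (of_int i * (P - 1))) * (\<integral>\<^sup>+x. g i x \<partial>lborel))"
        using A by (subst ennreal_mult') (auto simp: mult.assoc)
      also have "\<dots> = (\<integral>\<^sup>+x. ennreal A * (ennreal (2 powr (of_int i * (P - 1))) * g i x) \<partial>lborel)"
        by (simp add: nn_integral_cmult)
      finally show "ennreal (2 powr ((of_int i + 1) * P)) * emeasure lborel {x. ennreal (2 powr of_int i) < maximal h x} \<le>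
        (\<integral>\<^sup>+x. ennreal A * (ennreal (2 powr (of_int i * (P - 1))) * g i x) \<partial>lborel)" .
    qed
    also have "\<dots> = (\<integral>\<^sup>+x. (int_sum (\<lambda>i. ennreal A * (ennreal (2 powr (of_int i * (P - 1))) * g i x))) \<partial>lborel)"
      by (rule nn_integral_count_space_nn_integral[symmetric]) auto
    also have "\<dots> \<le> (\<integral>\<^sup>+x. ennreal C * epowr (h x) P \<partial>lborel)"
    proof (rule nn_integral_mono)
      fix x
      have ind: "indicator {y. ennreal (c i) < h y} x = (indicator {i. ennreal (2 powr of_int i) < ennreal (2 * ?v) * h x} i :: ennreal)" for i
      proof -
        have "ennreal (c i) < h x \<longleftrightarrow> ennreal (2 powr of_int i) < ennreal (2 * ?v) * h x"
        proof (cases "h x")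
          case (real t)
          then show ?thesis using v by (simp add: ennreal_mult'[symmetric] ennreal_less_iff c_def field_simps)
        next
          case top
          then show ?thesis using v by (simp add: ennreal_mult_top ennreal_eq_0_iff not_le)
        qed
        then show ?thesis by (simp add: indicator_def)
      qed
      have "(int_sum (\<lambda>i. ennreal A * (ennreal (2 powr (of_int i * (P - 1))) * g i x))) =
        (int_sum (\<lambda>i. (ennreal A * h x) * (ennreal (2 powr (of_int i * (P - 1))) * indicator {i. ennreal (2 powr of_int i) < ennreal (2 * ?v) * h x} i)))"
        unfolding g_def ind by (simp add: mult_ac)
      also have "\<dots> = ennreal A * h x * (int_sum (\<lambda>i. ennreal (2 powr (of_int i * (P - 1))) * indicator {i. ennreal (2 powr of_int i) < ennreal (2 * ?v) * h x} i))"
        by (rule nn_integral_cmult) simp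
      also have "\<dots> \<le> ennreal A * h x * (ennreal B * epowr (ennreal (2 * ?v) * h x) (P - 1))"
        unfolding B_def using P by (intro mult_left_mono layers_le_epowr) auto
      also have "\<dots> = ennreal A * h x * (ennreal B * (ennreal ((2 * ?v) powr (P - 1)) * epowr (h x) (P - 1)))"
        using P v by (simp add: epowr_mult epowr_ennreal)
      also have "\<dots> = ennreal A * ennreal B * ennreal ((2 * ?v) powr (P - 1)) * (epowr (h x) 1 * epowr (h x) (P - 1))"
        by (simp add: mult_ac)
      also have "epowr (h x) 1 * epowr (h x) (P - 1) = epowr (h x) P"
        using P epowr_add[of 1 "P - 1" "h x"] by simp
      also have "ennreal A * ennreal B * ennreal ((2 * ?v) powr (P - 1)) = ennreal C"
        unfolding C_def using A B by (simp add: ennreal_mult)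
      finally show "(int_sum (\<lambda>i. ennreal A * (ennreal (2 powr (of_int i * (P - 1))) * g i x))) \<le>
        ennreal C * epowr (h x) P" .
    qed
    also have "\<dots> = ennreal C * (\<integral>\<^sup>+x. epowr (h x) P \<partial>lborel)"
      by (rule nn_integral_cmult) simp
    finally show ?thesis .
  qed
  then show ?thesis using C by blast
qed

section \<open>Averages over shells\<close>

text \<open>
  The maximal functions \<open>v j\<close> will only be used through a bound by the infima of \<open>u j\<close> over balls of
  radius \<open>d 2\<^bsup>-j/2\<^esup>\<close>. An infimum is controlled by the average over any subset of at least half the
  volume of the ball, which lets one discard the set where the square function is large.
\<close>

lemma ennreal_divide_mult_cancel: "b > 0 \<Longrightarrow> ennreal (1 / b) * ennreal b = 1"
  by (subst ennreal_mult'[symmetric]) auto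

lemma nn_integral_count_space_int:
  "(int_sum (\<lambda>j. f j)) = (\<Sum>k. f (int_decode k))"
  using nn_integral_bij_count_space[OF bij_int_decode, of f] by (simp add: nn_integral_count_space_nat)

lemma borel_measurable_count_space_int [measurable (raw)]:
  assumes "\<And>j. f j \<in> borel_measurable M"
  shows "(\<lambda>x. int_sum (\<lambda>j. f j x)) \<in> borel_measurable M"
  unfolding nn_integral_count_space_int using assms by (intro borel_measurable_suminf_order) auto

definition dominated :: "real \<Rightarrow> real \<Rightarrow> (int \<Rightarrow> 'a::euclidean_space \<Rightarrow> ennreal) \<Rightarrow> (int \<Rightarrow> 'a \<Rightarrow> ennreal) \<Rightarrow> bool" where
  "dominated d s u v \<longleftrightarrow> (\<forall>j. u j \<in> borel_measurable borel) \<and>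
     (\<forall>j x. v j x \<le> 2 * (SUP t. (INF y\<in>ball t (d / freq j). u j y) *
        ennreal (1 / (1 + freq j * norm (x - t)) powr s)))"

text \<open>Full balls take the place of annuli, which only enlarges the supremum and lets one
  average over a ball about \<open>x\<close>.\<close>

definition shell_sup :: "real \<Rightarrow> (int \<Rightarrow> 'a::euclidean_space \<Rightarrow> ennreal) \<Rightarrow> int \<Rightarrow> nat \<Rightarrow> 'a \<Rightarrow> ennreal" where
  "shell_sup d u j k x = (SUP t\<in>cball x (2 ^ k / freq j). INF y\<in>ball t (d / freq j). u j y)"

text \<open>Twice the radius of the \<open>k\<close>-th shell: for d \<le> 1 it leaves room for the
  small balls about points of the shell.\<close>

abbreviation shell_radius :: "int \<Rightarrow> nat \<Rightarrow> real" where
  "shell_radius j k \<equiv> 2 ^ (k + 1) / freq j"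

lemma shell_radius_eq: "shell_radius j k = 2 powr (of_int (2 * (int k + 1) - j) / 2)"
proof -
  have "(2::real) ^ (k + 1) = 2 powr (real k + 1)" using powr_realpow[of "2::real" "k + 1"] by (simp add: add.commute)
  moreover have "real_of_int (2 * (int k + 1) - j) / 2 = (real k + 1) - of_int j / 2" by (simp add: field_simps)
  ultimately show ?thesis by (simp only: powr_diff)
qed

lemma Av_shell_le_maximal: "Av (shell_radius j k) h x \<le> maximal h x"
  unfolding shell_radius_eq by (rule Av_le_maximal)

lemma dominated_measurable: "dominated d s u v \<Longrightarrow> u j \<in> borel_measurable borel"
  by (simp add: dominated_def)

lemma dominated_shells:
  assumes "dominated d s u v" "s > 0"
  shows "v j x \<le> ennreal (2 * 2 powr s) * (SUP k. ennreal (2 powr (- real k * s)) * shell_sup d u j k x)"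
proof -
  let ?R = "freq j"
  let ?m = "\<lambda>t. INF y\<in>ball t (d / ?R). u j y"
  let ?S = "SUP k. ennreal (2 powr (- real k * s)) * shell_sup d u j k x"
  have "?m t * ennreal (1 / (1 + ?R * norm (x - t)) powr s) \<le> ennreal (2 powr s) * ?S" for t
  proof -
    obtain k :: nat where k: "?R * norm (x - t) \<le> 2 ^ k" "2 ^ k \<le> 2 * (1 + ?R * norm (x - t))"
      using dyadic_shell[of "?R * norm (x - t)"] by auto
    have "t \<in> cball x (2 ^ k / ?R)" using k(1) by (simp add: dist_norm field_simps)
    then have m: "?m t \<le> shell_sup d u j k x" unfolding shell_sup_def by (rule SUP_upper)
    have pos: "0 < 1 + ?R * norm (x - t)" by (simp add: add_pos_nonneg)
    have "1 / (1 + ?R * norm (x - t)) \<le> 2 / 2 ^ k" using k(2) pos by (simp add: field_simps)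
    then have "(1 / (1 + ?R * norm (x - t))) powr s \<le> (2 / 2 ^ k) powr s"
      using pos assms(2) by (intro powr_mono2) auto
    also have "(2 / 2 ^ k) powr s = 2 powr s * 2 powr (- real k * s)"
    proof -
      have "(2::real) / 2 ^ k = 2 powr (1 - real k)" by (simp add: powr_diff powr_realpow)
      then show ?thesis by (simp add: powr_powr powr_add[symmetric] algebra_simps)
    qed
    finally have "1 / (1 + ?R * norm (x - t)) powr s \<le> 2 powr s * 2 powr (- real k * s)"
      using pos by (simp add: powr_divide)
    then have "?m t * ennreal (1 / (1 + ?R * norm (x - t)) powr s) \<le> shell_sup d u j k x * ennreal (2 powr s * 2 powr (- real k * s))"
      by (intro mult_mono m ennreal_leI) auto
    also have "\<dots> = ennreal (2 powr s) * (ennreal (2 powr (- real k * s)) * shell_sup d u j k x)"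
      by (simp add: ennreal_mult mult_ac)
    also have "\<dots> \<le> ennreal (2 powr s) * ?S"
      by (intro mult_left_mono SUP_upper) auto
    finally show ?thesis .
  qed
  then have *: "(SUP t. ?m t * ennreal (1 / (1 + ?R * norm (x - t)) powr s)) \<le> ennreal (2 powr s) * ?S"
    by (intro SUP_least)
  have "v j x \<le> 2 * (SUP t. ?m t * ennreal (1 / (1 + ?R * norm (x - t)) powr s))"
    using assms(1) by (simp add: dominated_def)
  also have "\<dots> \<le> 2 * (ennreal (2 powr s) * ?S)" using * by (intro mult_left_mono) auto
  also have "\<dots> = ennreal (2 * 2 powr s) * ?S"
    by (simp add: ennreal_mult mult_ac)
  finally show ?thesis .
qed

text \<open>A supremum raised to the power \<open>a\<close> is at most the sum of the
  \<open>a\<close>-th powers, for every a > 0; the sum can be integrated term by term.\<close>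

lemma dominated_shell_sum:
  assumes "dominated d s u v" "s > 0" and a: "a > 0"
  shows "epowr (v j x) a \<le> ennreal ((2 * 2 powr s) powr a) *
    (\<Sum>k. ennreal (2 powr (- real k * s * a)) * epowr (shell_sup d u j k x) a)"
proof -
  let ?f = "\<lambda>k. ennreal (2 powr (- real k * s * a)) * epowr (shell_sup d u j k x) a"
  have "ennreal (2 powr (- real k * s)) * shell_sup d u j k x \<le> epowr (\<Sum>k. ?f k) (1 / a)" for k
  proof -
    have "epowr (ennreal (2 powr (- real k * s)) * shell_sup d u j k x) a = ?f k"
      using a by (simp add: epowr_mult epowr_ennreal powr_powr)
    also have "\<dots> \<le> (\<Sum>k. ?f k)" by (rule ennreal_le_suminf)
    finally show ?thesis using a by (simp add: epowr_le_iff)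
  qed
  then have "(SUP k. ennreal (2 powr (- real k * s)) * shell_sup d u j k x) \<le> epowr (\<Sum>k. ?f k) (1 / a)"
    by (intro SUP_least)
  then have *: "epowr (SUP k. ennreal (2 powr (- real k * s)) * shell_sup d u j k x) a \<le> (\<Sum>k. ?f k)"
    using a by (simp add: epowr_le_iff)
  have "epowr (v j x) a \<le> epowr (ennreal (2 * 2 powr s) * (SUP k. ennreal (2 powr (- real k * s)) * shell_sup d u j k x)) a"
    using a dominated_shells[OF assms(1,2)] by (intro epowr_mono) auto
  also have "\<dots> = ennreal ((2 * 2 powr s) powr a) * epowr (SUP k. ennreal (2 powr (- real k * s)) * shell_sup d u j k x) a"
    using a by (simp add: epowr_mult epowr_ennreal)
  also have "\<dots> \<le> ennreal ((2 * 2 powr s) powr a) * (\<Sum>k. ?f k)"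
    using * by (intro mult_left_mono) auto
  finally show ?thesis .
qed

text \<open>The ratio of \<open>shell_radius j k ^ n\<close> to half the volume of a ball of radius
  \<open>d / freq j\<close>, with the factor \<open>(2 ^ k) ^ n\<close> taken out.\<close>

definition shell_const :: "real \<Rightarrow> nat \<Rightarrow> real" where
  "shell_const d n = 2 / unit_ball_vol n * (2 / d) ^ n"

lemma shell_const_pos: "d > 0 \<Longrightarrow> shell_const d n > 0"
  by (simp add: shell_const_def)

text \<open>On the part of the small ball that lies in \<open>G\<close> the integrand is at least
  the power of the infimum, and \<open>half\<close> bounds the volume of that part from below.
  \<open>G\<close> is everything for plain averages and a sublevel set of the square function in the
  level set argument.\<close>

lemma shell_sup_le_Av:
  fixes u :: "int \<Rightarrow> 'a::euclidean_space \<Rightarrow> ennreal"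
  assumes u[measurable]: "u j \<in> borel_measurable borel" and G[measurable]: "G \<in> sets borel"
    and d: "0 < d" "d \<le> 1" and a: "a > 0"
    and half: "\<And>t. t \<in> cball x (2 ^ k / freq j) \<Longrightarrow>
      ennreal (unit_ball_vol DIM('a) / 2 * (d / freq j) ^ DIM('a)) \<le>
        emeasure lborel (ball t (d / freq j) \<inter> G)"
  shows "epowr (shell_sup d u j k x) a \<le> ennreal (shell_const d DIM('a) * (2 ^ k) ^ DIM('a)) *
    Av (shell_radius j k) (\<lambda>y. epowr (u j y) a * indicator G y) x"
proof -
  let ?R = "freq j"
  let ?n = "DIM('a)"
  let ?v = "unit_ball_vol (real ?n)"
  let ?h = "\<lambda>y. epowr (u j y) a * indicator G y"
  let ?c = "ennreal (shell_const d ?n * (2 ^ k) ^ ?n) * Av (shell_radius j k) ?h x"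
  have R: "?R > 0" and v: "?v > 0" by simp_all
  have "(INF y\<in>ball t (d / ?R). u j y) \<le> epowr ?c (1 / a)" if t: "t \<in> cball x (2 ^ k / ?R)" for t
  proof -
    let ?m = "INF y\<in>ball t (d / ?R). u j y"
    let ?b = "?v / 2 * (d / ?R) ^ ?n"
    have b: "?b > 0" and d0: "d \<noteq> 0" using v d R by simp_all
    have sub: "ball t (d / ?R) \<subseteq> cball x (shell_radius j k)"
    proof
      fix y assume "y \<in> ball t (d / ?R)"
      then have "dist x y \<le> 2 ^ k / ?R + d / ?R" using t dist_triangle[of x y t] by simp
      also have "\<dots> \<le> 2 ^ k / ?R + 2 ^ k / ?R"
      proof (intro add_left_mono divide_right_mono)
        show "d \<le> 2 ^ k" using d(2) one_le_power[of "2::real" k] by linarith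
      qed (use R in simp)
      finally show "y \<in> cball x (shell_radius j k)" by (simp add: field_simps)
    qed
    have "epowr ?m a * ennreal ?b \<le> epowr ?m a * emeasure lborel (ball t (d / ?R) \<inter> G)"
      by (rule mult_left_mono[OF half[OF t]]) simp
    also have "\<dots> = (\<integral>\<^sup>+y. epowr ?m a * indicator (ball t (d / ?R) \<inter> G) y \<partial>lborel)"
      by (rule nn_integral_cmult_indicator[symmetric]) simp
    also have "\<dots> \<le> (\<integral>\<^sup>+y. ?h y * indicator (cball x (shell_radius j k)) y \<partial>lborel)"
    proof (rule nn_integral_mono)
      fix y
      show "epowr ?m a * indicator (ball t (d / ?R) \<inter> G) y \<le> ?h y * indicator (cball x (shell_radius j k)) y"
      proof (cases "y \<in> ball t (d / ?R) \<inter> G")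
        case True
        then have "?m \<le> u j y" by (intro INF_lower) auto
        then have "epowr ?m a \<le> epowr (u j y) a" using a by (intro epowr_mono) auto
        moreover have "y \<in> cball x (shell_radius j k)" using True sub by blast
        ultimately show ?thesis using True by (simp add: indicator_def)
      qed (simp add: indicator_def)
    qed
    also have "\<dots> = ennreal (shell_radius j k ^ ?n) * Av (shell_radius j k) ?h x"
    proof -
      have "ennreal (shell_radius j k ^ ?n) * ennreal (1 / shell_radius j k ^ ?n) = 1"
        using R by (subst ennreal_mult'[symmetric]) auto
      then show ?thesis unfolding Av_def by (simp only: mult.assoc[symmetric] mult_1)
    qed
    finally have "ennreal (1 / ?b) * (epowr ?m a * ennreal ?b) \<le>
        ennreal (1 / ?b) * (ennreal (shell_radius j k ^ ?n) * Av (shell_radius j k) ?h x)"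
      by (intro mult_left_mono) auto
    also have "ennreal (1 / ?b) * (epowr ?m a * ennreal ?b) = epowr ?m a * (ennreal (1 / ?b) * ennreal ?b)"
      by (simp only: mult_ac)
    also have "ennreal (1 / ?b) * ennreal ?b = 1" by (rule ennreal_divide_mult_cancel[OF b])
    also have "ennreal (1 / ?b) * (ennreal (shell_radius j k ^ ?n) * Av (shell_radius j k) ?h x) =
        ennreal (1 / ?b * shell_radius j k ^ ?n) * Av (shell_radius j k) ?h x"
      using b by (subst ennreal_mult') (auto simp: mult.assoc)
    also have "1 / ?b * shell_radius j k ^ ?n = shell_const d ?n * (2 ^ k) ^ ?n"
      using d0 by (simp add: shell_const_def power_divide power_mult_distrib field_simps)
    finally have "epowr ?m a \<le> ?c" by simp
    then show ?thesis using a by (simp add: epowr_le_iff)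
  qed
  then have "shell_sup d u j k x \<le> epowr ?c (1 / a)"
    unfolding shell_sup_def by (intro SUP_least)
  then show ?thesis using a by (simp add: epowr_le_iff)
qed

text \<open>All factors of the \<open>k\<close>-th shell together. The exponent weighs the decay
  \<open>s * a\<close> of the Peetre weight against the loss \<open>n\<close> from replacing infima
  by averages.\<close>

definition shell_weight :: "real \<Rightarrow> real \<Rightarrow> real \<Rightarrow> nat \<Rightarrow> nat \<Rightarrow> real" where
  "shell_weight d s a n k = (2 * 2 powr s) powr a * shell_const d n * 2 powr (- (s * a - n) * real k)"

lemma shell_weight_nonneg: "d > 0 \<Longrightarrow> 0 \<le> shell_weight d s a n k"
  using shell_const_pos[of d n] by (simp add: shell_weight_def)

lemma shell_weight_summable:
  assumes "d > 0" "s * a > n"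
  shows "\<exists>C>0. (\<Sum>k. ennreal (shell_weight d s a n k)) = ennreal C"
proof -
  let ?q = "2 powr (- (s * a - n)) :: real"
  let ?K = "(2 * 2 powr s) powr a * shell_const d n"
  have q: "0 < ?q" "?q < 1" using assms by (auto simp: powr_less_one)
  have K: "?K > 0" using shell_const_pos[OF assms(1), of n] by simp
  have "(\<lambda>k. ?K * ?q ^ k) sums (?K * (1 / (1 - ?q)))"
    using q by (intro sums_mult geometric_sums) auto
  moreover have "?K * ?q ^ k = shell_weight d s a n k" for k
    by (simp add: shell_weight_def powr_power mult.commute)
  ultimately have "(\<lambda>k. shell_weight d s a n k) sums (?K * (1 / (1 - ?q)))" by simp
  then have "(\<Sum>k. ennreal (shell_weight d s a n k)) = ennreal (?K * (1 / (1 - ?q)))"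
    using shell_weight_nonneg[OF assms(1)] by (intro suminf_ennreal_eq)
  moreover have "?K * (1 / (1 - ?q)) > 0" using q by (intro mult_pos_pos[OF K]) auto
  ultimately show ?thesis by blast
qed

lemma dominated_Av:
  fixes u :: "int \<Rightarrow> 'a::euclidean_space \<Rightarrow> ennreal"
  assumes dom: "dominated d s u v" and s: "s > 0" and a: "a > 0" and d: "0 < d" "d \<le> 1"
  shows "epowr (v j x) a \<le> (\<Sum>k. ennreal (shell_weight d s a DIM('a) k) * Av (shell_radius j k) (\<lambda>y. epowr (u j y) a) x)"
proof -
  let ?n = "DIM('a)"
  note u[measurable] = dominated_measurable[OF dom]
  have "epowr (v j x) a \<le> ennreal ((2 * 2 powr s) powr a) *
    (\<Sum>k. ennreal (2 powr (- real k * s * a)) * epowr (shell_sup d u j k x) a)"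
    by (rule dominated_shell_sum[OF dom s a])
  also have "\<dots> \<le> ennreal ((2 * 2 powr s) powr a) *
    (\<Sum>k. ennreal (2 powr (- real k * s * a)) * (ennreal (shell_const d ?n * (2 ^ k) ^ ?n) * Av (shell_radius j k) (\<lambda>y. epowr (u j y) a) x))"
  proof (intro mult_left_mono suminf_le allI)
    fix k
    have "epowr (shell_sup d u j k x) a \<le> ennreal (shell_const d ?n * (2 ^ k) ^ ?n) *
        Av (shell_radius j k) (\<lambda>y. epowr (u j y) a * indicator UNIV y) x"
    proof (rule shell_sup_le_Av[OF u _ d a])
      fix t :: 'a
      have "unit_ball_vol (real ?n) / 2 * (d / freq j) ^ ?n \<le> unit_ball_vol (real ?n) * (d / freq j) ^ ?n"
        using d by (intro mult_right_mono) auto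
      then show "ennreal (unit_ball_vol (real ?n) / 2 * (d / freq j) ^ ?n) \<le> emeasure lborel (ball t (d / freq j) \<inter> UNIV)"
        using d by (simp add: emeasure_ball ennreal_leI)
    qed simp
    then show "epowr (shell_sup d u j k x) a \<le> ennreal (shell_const d ?n * (2 ^ k) ^ ?n) * Av (shell_radius j k) (\<lambda>y. epowr (u j y) a) x"
      by simp
  qed auto
  also have "\<dots> = (\<Sum>k. ennreal (shell_weight d s a ?n k) * Av (shell_radius j k) (\<lambda>y. epowr (u j y) a) x)"
  proof -
    have "ennreal ((2 * 2 powr s) powr a) * (ennreal (2 powr (- real k * s * a)) * (ennreal (shell_const d ?n * (2 ^ k) ^ ?n) * z)) =
      ennreal (shell_weight d s a ?n k) * z" for k z
    proof -
      have "(2 ^ k) ^ ?n = (2::real) powr (real k * real ?n)"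
        by (simp add: powr_realpow[symmetric] powr_powr)
      then have w: "shell_weight d s a ?n k = (2 * 2 powr s) powr a * (2 powr (- real k * s * a) * (shell_const d ?n * (2 ^ k) ^ ?n))"
        by (simp add: shell_weight_def powr_add[symmetric] algebra_simps)
      have "0 \<le> shell_const d ?n * (2 ^ k) ^ ?n" using shell_const_pos[OF d(1), of ?n] by simp
      then show ?thesis unfolding w by (simp add: ennreal_mult mult.assoc)
    qed
    then show ?thesis by (simp only: ennreal_suminf_cmult[symmetric])
  qed
  finally show ?thesis .
qed

text \<open>With a = p the pointwise bound is linear in the \<open>p\<close>-th power of
  \<open>u j\<close>, and averaging multiplies an integral by the volume of the unit ball at every
  radius; hence one constant for all \<open>j\<close>.\<close>

lemma dominated_Lp:
  assumes s: "s > 0" and p: "p > 0" and d: "0 < d" "d \<le> 1" and sp: "s * p > real DIM('a)"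
  shows "\<exists>C>0. \<forall>(u :: int \<Rightarrow> 'a::euclidean_space \<Rightarrow> ennreal) v j. dominated d s u v \<longrightarrow>
    (\<integral>\<^sup>+x. epowr (v j x) p \<partial>lborel) \<le> ennreal C * (\<integral>\<^sup>+x. epowr (u j x) p \<partial>lborel)"
proof -
  let ?c = "shell_weight d s p DIM('a)"
  obtain C where C: "C > 0" "(\<Sum>k. ennreal (?c k)) = ennreal C"
    using shell_weight_summable[OF d(1) sp] by auto
  let ?v = "unit_ball_vol (real DIM('a))"
  have "(\<integral>\<^sup>+x. epowr (v j x) p \<partial>lborel) \<le> ennreal (C * ?v) * (\<integral>\<^sup>+x. epowr (u j x) p \<partial>lborel)"
    if dom: "dominated d s u v" for u v :: "int \<Rightarrow> 'a \<Rightarrow> ennreal" and j :: int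
  proof -
    note u[measurable] = dominated_measurable[OF dom]
    have "(\<integral>\<^sup>+x. epowr (v j x) p \<partial>lborel) \<le> (\<integral>\<^sup>+x. (\<Sum>k. ennreal (?c k) * Av (shell_radius j k) (\<lambda>y. epowr (u j y) p) x) \<partial>lborel)"
      by (intro nn_integral_mono dominated_Av[OF dom s p d])
    also have "\<dots> = (\<Sum>k. \<integral>\<^sup>+x. ennreal (?c k) * Av (shell_radius j k) (\<lambda>y. epowr (u j y) p) x \<partial>lborel)"
      by (rule nn_integral_suminf) measurable
    also have "\<dots> = (\<Sum>k. ennreal (?c k) * (ennreal ?v * (\<integral>\<^sup>+x. epowr (u j x) p \<partial>lborel)))"
      by (intro suminf_cong) (simp add: nn_integral_cmult nn_integral_Av)
    also have "\<dots> = (\<Sum>k. ennreal (?c k)) * (ennreal ?v * (\<integral>\<^sup>+x. epowr (u j x) p \<partial>lborel))"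
      by (rule ennreal_suminf_multc)
    also have "\<dots> = ennreal (C * ?v) * (\<integral>\<^sup>+x. epowr (u j x) p \<partial>lborel)"
      using C by (simp add: ennreal_mult mult.assoc)
    finally show ?thesis .
  qed
  moreover have "C * ?v > 0" using C by simp
  ultimately show ?thesis by blast
qed

text \<open>Either c a \<le> e b^(1/(P-1)), and multiplying by \<open>b\<close> gives the second
  term, or the opposite inequality bounds \<open>b\<close> by a multiple of a^(P-1), which produces
  the value of \<open>K\<close>.\<close>

lemma young_epsilon:
  assumes P: "P > 1" and e: "e > 0" and c: "c \<ge> 0"
  shows "\<exists>K\<ge>0. \<forall>a b. ennreal c * (a * b) \<le> ennreal K * epowr a P + ennreal e * epowr b (P / (P - 1))"
proof -
  define K where "K = c * (c / e) powr (P - 1)"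
  have "ennreal c * (a * b) \<le> ennreal K * epowr a P + ennreal e * epowr b (P / (P - 1))" for a b
  proof (cases "ennreal c * a \<le> ennreal e * epowr b (1 / (P - 1))")
    case True
    have "ennreal c * (a * b) = (ennreal c * a) * b" by (simp only: mult.assoc)
    also have "\<dots> \<le> (ennreal e * epowr b (1 / (P - 1))) * b" using True by (rule mult_right_mono) simp
    also have "\<dots> = ennreal e * (epowr b (1 / (P - 1)) * epowr b 1)" by (simp add: mult.assoc)
    also have "epowr b (1 / (P - 1)) * epowr b 1 = epowr b (P / (P - 1))"
      using P by (subst epowr_add[symmetric]) (auto simp: field_simps)
    finally show ?thesis by (simp add: add_increasing)
  next
    case False
    have "ennreal (1 / e) * (ennreal e * epowr b (1 / (P - 1))) \<le> ennreal (1 / e) * (ennreal c * a)"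
      using False by (intro mult_left_mono) auto
    moreover have "ennreal (1 / e) * (ennreal e * epowr b (1 / (P - 1))) = epowr b (1 / (P - 1))"
      using e by (subst mult.assoc[symmetric], subst ennreal_mult'[symmetric]) auto
    moreover have "ennreal (1 / e) * (ennreal c * a) = ennreal (c / e) * a"
      using e c by (subst mult.assoc[symmetric], subst ennreal_mult'[symmetric]) auto
    ultimately have "epowr b (1 / (P - 1)) \<le> ennreal (c / e) * a" by simp
    then have "b \<le> epowr (ennreal (c / e) * a) (1 / (1 / (P - 1)))"
      using P by (subst epowr_le_iff[symmetric]) auto
    also have "\<dots> = ennreal ((c / e) powr (P - 1)) * epowr a (P - 1)"
      using P e c by (simp add: epowr_mult epowr_ennreal)
    finally have "ennreal c * (a * b) \<le> ennreal c * (a * (ennreal ((c / e) powr (P - 1)) * epowr a (P - 1)))"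
      by (intro mult_left_mono) auto
    also have "\<dots> = ennreal c * ennreal ((c / e) powr (P - 1)) * (epowr a 1 * epowr a (P - 1))"
      by (simp add: mult_ac)
    also have "ennreal c * ennreal ((c / e) powr (P - 1)) = ennreal K"
      unfolding K_def using c by (simp add: ennreal_mult)
    also have "epowr a 1 * epowr a (P - 1) = epowr a P" using P epowr_add[of 1 "P - 1" a] by simp
    finally show ?thesis by (simp add: add_increasing2)
  qed
  moreover have "K \<ge> 0" using c by (simp add: K_def)
  ultimately show ?thesis by blast
qed

text \<open>The sum over \<open>j\<close> is linear, so one test function \<open>g\<close> serves
  all \<open>j\<close>: symmetry moves every average onto \<open>g\<close>, where all of them are
  below the one scalar function \<open>maximal g\<close>, whatever the radii
  \<open>r j k\<close>.\<close>

lemma averages_strong_type: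
  fixes r :: "int \<Rightarrow> nat \<Rightarrow> real" and c :: "nat \<Rightarrow> ennreal"
  assumes P: "P > 1" and r: "\<And>j k (h :: 'a::euclidean_space \<Rightarrow> ennreal) x. Av (r j k) h x \<le> maximal h x"
    and c: "(\<Sum>k. c k) \<le> ennreal B" "B \<ge> 0"
  shows "\<exists>C>0. \<forall>h :: int \<Rightarrow> 'a \<Rightarrow> ennreal. (\<forall>j. h j \<in> borel_measurable borel) \<longrightarrow>
    (\<integral>\<^sup>+x. epowr (int_sum (\<lambda>j. (\<Sum>k. c k * Av (r j k) (h j) x))) P \<partial>lborel) \<le>
    ennreal C * (\<integral>\<^sup>+x. epowr (int_sum (\<lambda>j. h j x)) P \<partial>lborel)"
proof -
  define P' where "P' = P / (P - 1)"
  have P': "P' > 1" using P by (simp add: P'_def field_simps)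
  obtain D where D: "D > 0" "\<And>h :: 'a \<Rightarrow> ennreal. h \<in> borel_measurable borel \<Longrightarrow>
      (\<integral>\<^sup>+x. epowr (maximal h x) P' \<partial>lborel) \<le> ennreal D * (\<integral>\<^sup>+x. epowr (h x) P' \<partial>lborel)"
    using maximal_strong_type[OF P', where 'a='a] by blast
  \<comment> \<open>The weight 1 / (2 D) cancels the constant of the dual maximal inequality and
    leaves 1/2. The power \<open>P'\<close> of \<open>g\<close> is the power \<open>P\<close> of
    \<open>W m\<close>, because (P - 1) P' = P.\<close>
  obtain K where K: "K \<ge> 0" "\<And>a b. ennreal B * (a * b) \<le> ennreal K * epowr a P + ennreal (1 / (2 * D)) * epowr b P'"
    using young_epsilon[OF P, of "1 / (2 * D)" B] D c unfolding P'_def by auto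
  have "(\<integral>\<^sup>+x. epowr (int_sum (\<lambda>j. (\<Sum>k. c k * Av (r j k) (h j) x))) P \<partial>lborel) \<le>
    ennreal (2 * K + 1) * (\<integral>\<^sup>+x. epowr (int_sum (\<lambda>j. h j x)) P \<partial>lborel)"
    if h: "\<And>j. h j \<in> borel_measurable borel" for h :: "int \<Rightarrow> 'a \<Rightarrow> ennreal"
  proof -
    note h[measurable]
    define U where "U x = (int_sum (\<lambda>j. (\<Sum>k. c k * Av (r j k) (h j) x)))" for x
    define G where "G x = (int_sum (\<lambda>j. h j x))" for x
    have U[measurable]: "U \<in> borel_measurable borel"
      unfolding U_def by (intro borel_measurable_count_space_int) measurable
    have G[measurable]: "G \<in> borel_measurable borel"
      unfolding G_def by (intro borel_measurable_count_space_int) measurable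
    \<comment> \<open>Testing \<open>U\<close> against \<open>U\<^bsup>P-1\<^esup>\<close> bounds the integral of \<open>U\<^bsup>P\<^esup>\<close> by half of itself plus the claim; the truncation makes it finite.\<close>
    define W where "W m x = min (U x) (of_nat m) * indicator (cball 0 (real m)) x" for m :: nat and x
    have W[measurable]: "W m \<in> borel_measurable borel" for m
      unfolding W_def by measurable
    have Wbound: "(\<integral>\<^sup>+x. epowr (W m x) P \<partial>lborel) \<le> ennreal (2 * K) * (\<integral>\<^sup>+x. epowr (G x) P \<partial>lborel)" for m
    proof -
      define g where "g x = epowr (W m x) (P - 1)" for x
      have g[measurable]: "g \<in> borel_measurable borel" unfolding g_def by measurable
      let ?I = "\<integral>\<^sup>+x. epowr (W m x) P \<partial>lborel"
      have fin: "?I < \<infinity>"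
      proof -
        have "?I \<le> (\<integral>\<^sup>+x. ennreal (real m powr P) * indicator (cball (0::'a) (real m)) x \<partial>lborel)"
        proof (rule nn_integral_mono)
          fix x
          have "epowr (W m x) P \<le> epowr (ennreal (real m) * indicator (cball 0 (real m)) x) P"
            using P by (intro epowr_mono) (auto simp: W_def indicator_def ennreal_of_nat_eq_real_of_nat)
          then show "epowr (W m x) P \<le> ennreal (real m powr P) * indicator (cball 0 (real m)) x"
            using P by (simp add: epowr_mult epowr_ennreal) (auto simp: indicator_def)
        qed
        also have "\<dots> < \<infinity>"
          by (subst nn_integral_cmult_indicator) (auto simp: emeasure_cball ennreal_mult_less_top)
        finally show ?thesis .
      qed
      have "?I = (\<integral>\<^sup>+x. W m x * g x \<partial>lborel)"
        unfolding g_def using P epowr_add[of 1 "P - 1"] by simp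
      also have "\<dots> \<le> (\<integral>\<^sup>+x. U x * g x \<partial>lborel)"
        by (intro nn_integral_mono mult_right_mono) (auto simp: W_def indicator_def)
      also have "\<dots> = (\<integral>\<^sup>+x. (int_sum (\<lambda>j. (\<Sum>k. c k * Av (r j k) (h j) x) * g x)) \<partial>lborel)"
        unfolding U_def by (intro nn_integral_cong nn_integral_multc[symmetric]) simp
      also have "\<dots> = (int_sum (\<lambda>j. (\<integral>\<^sup>+x. (\<Sum>k. c k * Av (r j k) (h j) x) * g x \<partial>lborel)))"
        by (rule nn_integral_count_space_nn_integral) auto
      also have "\<dots> \<le> (int_sum (\<lambda>j. (\<integral>\<^sup>+x. ennreal B * (h j x * maximal g x) \<partial>lborel)))"
      proof (rule nn_integral_mono)
        fix j :: int
        have "(\<integral>\<^sup>+x. (\<Sum>k. c k * Av (r j k) (h j) x) * g x \<partial>lborel) = (\<integral>\<^sup>+x. (\<Sum>k. c k * Av (r j k) (h j) x * g x) \<partial>lborel)"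
          by simp
        also have "\<dots> = (\<Sum>k. \<integral>\<^sup>+x. c k * Av (r j k) (h j) x * g x \<partial>lborel)"
          by (rule nn_integral_suminf) measurable
        also have "\<dots> = (\<Sum>k. c k * (\<integral>\<^sup>+x. h j x * Av (r j k) g x \<partial>lborel))"
          by (intro suminf_cong) (simp add: mult.assoc nn_integral_cmult Av_symmetric)
        also have "\<dots> \<le> (\<Sum>k. c k * (\<integral>\<^sup>+x. h j x * maximal g x \<partial>lborel))"
          by (intro suminf_le mult_left_mono nn_integral_mono r) auto
        also have "\<dots> = (\<Sum>k. c k) * (\<integral>\<^sup>+x. h j x * maximal g x \<partial>lborel)"
          by (rule ennreal_suminf_multc)
        also have "\<dots> \<le> ennreal B * (\<integral>\<^sup>+x. h j x * maximal g x \<partial>lborel)"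
          using c by (intro mult_right_mono) auto
        also have "\<dots> = (\<integral>\<^sup>+x. ennreal B * (h j x * maximal g x) \<partial>lborel)"
          by (simp add: nn_integral_cmult)
        finally show "(\<integral>\<^sup>+x. (\<Sum>k. c k * Av (r j k) (h j) x) * g x \<partial>lborel) \<le> (\<integral>\<^sup>+x. ennreal B * (h j x * maximal g x) \<partial>lborel)" .
      qed
      also have "\<dots> = (\<integral>\<^sup>+x. (int_sum (\<lambda>j. ennreal B * (h j x * maximal g x))) \<partial>lborel)"
        by (rule nn_integral_count_space_nn_integral[symmetric]) auto
      also have "\<dots> = (\<integral>\<^sup>+x. ennreal B * (G x * maximal g x) \<partial>lborel)"
        unfolding G_def by (simp add: nn_integral_cmult nn_integral_multc)
      also have "\<dots> \<le> (\<integral>\<^sup>+x. ennreal K * epowr (G x) P + ennreal (1 / (2 * D)) * epowr (maximal g x) P' \<partial>lborel)"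
        by (intro nn_integral_mono K)
      also have "\<dots> = ennreal K * (\<integral>\<^sup>+x. epowr (G x) P \<partial>lborel) + ennreal (1 / (2 * D)) * (\<integral>\<^sup>+x. epowr (maximal g x) P' \<partial>lborel)"
        by (simp add: nn_integral_add nn_integral_cmult)
      also have "\<dots> \<le> ennreal K * (\<integral>\<^sup>+x. epowr (G x) P \<partial>lborel) + ennreal (1 / (2 * D)) * (ennreal D * (\<integral>\<^sup>+x. epowr (g x) P' \<partial>lborel))"
        by (intro add_left_mono mult_left_mono D) auto
      also have "(\<integral>\<^sup>+x. epowr (g x) P' \<partial>lborel) = ?I"
        unfolding g_def P'_def using P by (simp add: epowr_epowr)
      also have "ennreal (1 / (2 * D)) * (ennreal D * ?I) = ennreal (1/2) * ?I"
        using D by (subst mult.assoc[symmetric], subst ennreal_mult'[symmetric]) auto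
      finally have le: "?I \<le> ennreal K * (\<integral>\<^sup>+x. epowr (G x) P \<partial>lborel) + ennreal (1/2) * ?I" .
      \<comment> \<open>Half of \<open>?I\<close> may be subtracted because \<open>?I\<close> is
        finite; an infinite right-hand side makes the claim trivial.\<close>
      show ?thesis
      proof (cases "ennreal K * (\<integral>\<^sup>+x. epowr (G x) P \<partial>lborel)")
        case (real z)
        obtain y where y: "?I = ennreal y" "y \<ge> 0" using fin by (cases ?I) auto
        have "ennreal (1/2) * ennreal y = ennreal (1/2 * y)" by (rule ennreal_mult'[symmetric]) simp
        then have "ennreal y \<le> ennreal z + ennreal (1/2 * y)" using le unfolding y(1) real(2) by metis
        also have "\<dots> = ennreal (z + 1/2 * y)" using y real by (intro ennreal_plus[symmetric]) auto
        finally have "y \<le> z + 1/2 * y" using y real by (subst (asm) ennreal_le_iff) auto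
        then have "?I \<le> ennreal (2 * z)" using y by (simp add: ennreal_leI)
        also have "\<dots> = 2 * ennreal z" using real by (simp add: ennreal_mult)
        also have "\<dots> = ennreal (2 * K) * (\<integral>\<^sup>+x. epowr (G x) P \<partial>lborel)"
          using K unfolding real(2)[symmetric] by (simp add: ennreal_mult mult.assoc)
        finally show ?thesis .
      next
        case top
        then have "2 * (ennreal K * (\<integral>\<^sup>+x. epowr (G x) P \<partial>lborel)) = top" by (simp add: ennreal_mult_top)
        then have "ennreal (2 * K) * (\<integral>\<^sup>+x. epowr (G x) P \<partial>lborel) = top"
          using K by (simp add: ennreal_mult mult.assoc)
        then show ?thesis by simp
      qed
    qed
    \<comment> \<open>The bound does not depend on \<open>m\<close>, so monotone convergence removes
      the truncation.\<close>
    have inc: "incseq (\<lambda>m x. epowr (W m x) P)"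
      using P by (intro incseq_SucI le_funI epowr_mono) (auto simp: W_def indicator_def min_def intro: order_trans)
    have "epowr (U x) P \<le> (SUP m. epowr (W m x) P)" for x
    proof -
      have le: "W m x \<le> epowr (SUP m. epowr (W m x) P) (1 / P)" for m
        using P by (subst epowr_le_iff[symmetric]) (auto intro: SUP_upper)
      obtain N where N: "norm x \<le> real N" using real_arch_simple by blast
      have "U x \<le> (SUP m. W m x)"
      proof (cases "U x")
        case (real y)
        obtain m where m: "max y (norm x) \<le> real m" using real_arch_simple by blast
        then have "W m x = U x" using real by (simp add: W_def min_def indicator_def ennreal_of_nat_eq_real_of_nat ennreal_leI)
        then show ?thesis by (metis SUP_upper UNIV_I)
      next
        case top
        have "(SUP m. W m x) = top"
        proof (rule ennreal_SUP_eq_top)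
          fix m :: nat
          have "of_nat m \<le> W (max m N) x"
            using N top by (simp add: W_def indicator_def min_def top_unique)
          then show "\<exists>i\<in>UNIV. of_nat m \<le> W i x" by blast
        qed
        then show ?thesis by (simp only: top_greatest)
      qed
      also have "\<dots> \<le> epowr (SUP m. epowr (W m x) P) (1 / P)" by (intro SUP_least le)
      finally show ?thesis using P by (simp add: epowr_le_iff)
    qed
    then have "(\<integral>\<^sup>+x. epowr (U x) P \<partial>lborel) \<le> (\<integral>\<^sup>+x. (SUP m. epowr (W m x) P) \<partial>lborel)"
      by (intro nn_integral_mono)
    also have "\<dots> = (SUP m. \<integral>\<^sup>+x. epowr (W m x) P \<partial>lborel)"
      by (rule nn_integral_monotone_convergence_SUP[OF inc]) measurable
    also have "\<dots> \<le> ennreal (2 * K) * (\<integral>\<^sup>+x. epowr (G x) P \<partial>lborel)" by (intro SUP_least Wbound)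
    also have "\<dots> \<le> ennreal (2 * K + 1) * (\<integral>\<^sup>+x. epowr (G x) P \<partial>lborel)" by (intro mult_right_mono ennreal_leI) auto
    finally show ?thesis unfolding U_def G_def .
  qed
  moreover have "2 * K + 1 > 0" using K by simp
  ultimately show ?thesis by blast
qed

text \<open>The common form of the bounds for the different orders of \<open>p\<close> and
  \<open>q\<close>; \<open>N\<close> will be the \<open>p\<close>-th power of the quasi-norm,
  without the weights in \<open>j\<close>.\<close>

definition controlled :: "real \<Rightarrow> real \<Rightarrow> ((int \<Rightarrow> 'a::euclidean_space \<Rightarrow> ennreal) \<Rightarrow> ennreal) \<Rightarrow> bool" where
  "controlled d s N \<longleftrightarrow> (\<exists>C>0. \<forall>u v. dominated d s u v \<longrightarrow> (\<forall>j. v j \<in> borel_measurable borel) \<longrightarrow> N v \<le> ennreal C * N u)"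

lemma controlledE:
  assumes "controlled d s N"
  obtains C where "C > 0" "\<And>u v. dominated d s u v \<Longrightarrow> (\<And>j. v j \<in> borel_measurable borel) \<Longrightarrow> N v \<le> ennreal C * N u"
  using assms unfolding controlled_def by blast

lemma controlledI:
  assumes "C > 0" "\<And>u v. dominated d s u v \<Longrightarrow> (\<And>j. v j \<in> borel_measurable borel) \<Longrightarrow> N v \<le> ennreal C * N u"
  shows "controlled d s N"
  using assms unfolding controlled_def by blast

section \<open>Square functions\<close>

lemma square_function_eq:
  assumes s: "s > 0" and p: "p > 0" and d: "0 < d" "d \<le> 1" and sp: "s * p > real DIM('a)"
  shows "controlled d s (\<lambda>u :: int \<Rightarrow> 'a::euclidean_space \<Rightarrow> ennreal. \<integral>\<^sup>+x. int_sum (\<lambda>j. epowr (u j x) p) \<partial>lborel)"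
proof -
  obtain C where C: "C > 0" "\<And>(u :: int \<Rightarrow> 'a \<Rightarrow> ennreal) v j. dominated d s u v \<Longrightarrow>
    (\<integral>\<^sup>+x. epowr (v j x) p \<partial>lborel) \<le> ennreal C * (\<integral>\<^sup>+x. epowr (u j x) p \<partial>lborel)"
    using dominated_Lp[OF s p d sp] by blast
  show ?thesis
  proof (rule controlledI[OF C(1)])
    fix u v :: "int \<Rightarrow> 'a \<Rightarrow> ennreal"
    assume dom: "dominated d s u v" and v[measurable]: "\<And>j. v j \<in> borel_measurable borel"
    note u[measurable] = dominated_measurable[OF dom]
    have "(\<integral>\<^sup>+x. (int_sum (\<lambda>j. epowr (v j x) p)) \<partial>lborel) = (int_sum (\<lambda>j. (\<integral>\<^sup>+x. epowr (v j x) p \<partial>lborel)))"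
      by (rule nn_integral_count_space_nn_integral) auto
    also have "\<dots> \<le> (int_sum (\<lambda>j. ennreal C * (\<integral>\<^sup>+x. epowr (u j x) p \<partial>lborel)))"
      by (intro nn_integral_mono C dom)
    also have "\<dots> = ennreal C * (int_sum (\<lambda>j. (\<integral>\<^sup>+x. epowr (u j x) p \<partial>lborel)))"
      by (rule nn_integral_cmult) simp
    also have "(int_sum (\<lambda>j. (\<integral>\<^sup>+x. epowr (u j x) p \<partial>lborel))) = (\<integral>\<^sup>+x. (int_sum (\<lambda>j. epowr (u j x) p)) \<partial>lborel)"
      by (rule nn_integral_count_space_nn_integral[symmetric]) auto
    finally show "(\<integral>\<^sup>+x. int_sum (\<lambda>j. epowr (v j x) p) \<partial>lborel) \<le> ennreal C * (\<integral>\<^sup>+x. int_sum (\<lambda>j. epowr (u j x) p) \<partial>lborel)" .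
  qed
qed

lemma square_function_less:
  assumes s: "s > 0" and q: "0 < q" "q < p" and d: "0 < d" "d \<le> 1" and sq: "s * q > real DIM('a)"
  shows "controlled d s (\<lambda>u :: int \<Rightarrow> 'a::euclidean_space \<Rightarrow> ennreal. \<integral>\<^sup>+x. epowr (int_sum (\<lambda>j. epowr (u j x) q)) (p / q) \<partial>lborel)"
proof -
  let ?c = "\<lambda>k. ennreal (shell_weight d s q DIM('a) k)"
  obtain B where B: "B > 0" "(\<Sum>k. ?c k) = ennreal B"
    using shell_weight_summable[OF d(1) sq] by auto
  have pq: "p / q > 1" using q by simp
  obtain C where C: "C > 0" "\<And>h :: int \<Rightarrow> 'a \<Rightarrow> ennreal. (\<And>j. h j \<in> borel_measurable borel) \<Longrightarrow>
    (\<integral>\<^sup>+x. epowr (int_sum (\<lambda>j. (\<Sum>k. ?c k * Av (shell_radius j k) (h j) x))) (p / q) \<partial>lborel) \<le>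
    ennreal C * (\<integral>\<^sup>+x. epowr (int_sum (\<lambda>j. h j x)) (p / q) \<partial>lborel)"
    using averages_strong_type[where r="\<lambda>j k. shell_radius j k" and c="?c" and B=B, OF pq Av_shell_le_maximal] B by auto
  show ?thesis
  proof (rule controlledI[OF C(1)])
    fix u v :: "int \<Rightarrow> 'a \<Rightarrow> ennreal"
    assume dom: "dominated d s u v"
    note u[measurable] = dominated_measurable[OF dom]
    have "(\<integral>\<^sup>+x. epowr (int_sum (\<lambda>j. epowr (v j x) q)) (p / q) \<partial>lborel) \<le>
      (\<integral>\<^sup>+x. epowr (int_sum (\<lambda>j. (\<Sum>k. ?c k * Av (shell_radius j k) (\<lambda>y. epowr (u j y) q) x))) (p / q) \<partial>lborel)"
      using pq by (intro nn_integral_mono epowr_mono dominated_Av[OF dom s q(1) d]) auto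
    also have "\<dots> \<le> ennreal C * (\<integral>\<^sup>+x. epowr (int_sum (\<lambda>j. epowr (u j x) q)) (p / q) \<partial>lborel)"
      by (rule C(2)) measurable
    finally show "(\<integral>\<^sup>+x. epowr (int_sum (\<lambda>j. epowr (v j x) q)) (p / q) \<partial>lborel) \<le> \<dots>" .
  qed
qed

lemma square_function_sup:
  assumes s: "s > 0" and p: "p > 0" and d: "0 < d" "d \<le> 1" and sp: "s * p > real DIM('a)"
  shows "controlled d s (\<lambda>u :: int \<Rightarrow> 'a::euclidean_space \<Rightarrow> ennreal. \<integral>\<^sup>+x. epowr (SUP j. u j x) p \<partial>lborel)"
proof -
  let ?n = "real DIM('a)"
  have "?n / s < p" using s sp by (simp add: field_simps)
  \<comment> \<open>The strict inequality s p > n leaves room for \<open>r\<close>: r < p serves the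
    strong type inequality at p / r, and s r > n keeps the shell weights summable.\<close>
  then obtain r where r: "?n / s < r" "r < p" using dense by blast
  then have r0: "r > 0" using s by (meson divide_nonneg_pos le_less_trans of_nat_0_le_iff)
  have sr: "s * r > ?n" using r s by (simp add: field_simps)
  let ?c = "\<lambda>k. ennreal (shell_weight d s r DIM('a) k)"
  obtain B where B: "B > 0" "(\<Sum>k. ?c k) = ennreal B"
    using shell_weight_summable[OF d(1) sr] by auto
  have pr: "p / r > 1" using r r0 by simp
  obtain D where D: "D > 0" "\<And>h :: 'a \<Rightarrow> ennreal. h \<in> borel_measurable borel \<Longrightarrow>
      (\<integral>\<^sup>+x. epowr (maximal h x) (p / r) \<partial>lborel) \<le> ennreal D * (\<integral>\<^sup>+x. epowr (h x) (p / r) \<partial>lborel)"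
    using maximal_strong_type[OF pr, where 'a='a] by blast
  let ?C = "B powr (p / r) * D"
  show ?thesis
  proof (rule controlledI)
    show "?C > 0" using B D by simp
    fix u v :: "int \<Rightarrow> 'a \<Rightarrow> ennreal"
    assume dom: "dominated d s u v"
    note u[measurable] = dominated_measurable[OF dom]
    let ?h = "\<lambda>y. epowr (SUP j. u j y) r"
    have h[measurable]: "?h \<in> borel_measurable borel" by measurable
    have pt: "epowr (SUP j. v j x) p \<le> ennreal (B powr (p / r)) * epowr (maximal ?h x) (p / r)" for x
    proof -
      have "epowr (v j x) r \<le> ennreal B * maximal ?h x" for j
      proof -
        have "epowr (v j x) r \<le> (\<Sum>k. ?c k * Av (shell_radius j k) (\<lambda>y. epowr (u j y) r) x)"
          by (rule dominated_Av[OF dom s r0 d])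
        also have "\<dots> \<le> (\<Sum>k. ?c k * maximal ?h x)"
        proof (intro suminf_le mult_left_mono)
          fix k
          have "Av (shell_radius j k) (\<lambda>y. epowr (u j y) r) x \<le> maximal (\<lambda>y. epowr (u j y) r) x"
            by (rule Av_shell_le_maximal)
          also have "\<dots> \<le> maximal ?h x"
            using r0 by (intro maximal_mono epowr_mono SUP_upper) auto
          finally show "Av (shell_radius j k) (\<lambda>y. epowr (u j y) r) x \<le> maximal ?h x" .
        qed auto
        also have "\<dots> = ennreal B * maximal ?h x" using B by simp
        finally show ?thesis .
      qed
      then have "(SUP j. v j x) \<le> epowr (ennreal B * maximal ?h x) (1 / r)"
        using r0 by (intro SUP_least) (simp add: epowr_le_iff)
      then have "epowr (SUP j. v j x) p \<le> epowr (epowr (ennreal B * maximal ?h x) (1 / r)) p"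
        using p by (intro epowr_mono) auto
      also have "\<dots> = epowr (ennreal B * maximal ?h x) (p / r)" by (simp add: epowr_epowr)
      also have "\<dots> = ennreal (B powr (p / r)) * epowr (maximal ?h x) (p / r)"
        using pr B by (subst epowr_mult) (auto simp: epowr_ennreal)
      finally show ?thesis .
    qed
    have "(\<integral>\<^sup>+x. epowr (SUP j. v j x) p \<partial>lborel) \<le> (\<integral>\<^sup>+x. ennreal (B powr (p / r)) * epowr (maximal ?h x) (p / r) \<partial>lborel)"
      by (intro nn_integral_mono pt)
    also have "\<dots> = ennreal (B powr (p / r)) * (\<integral>\<^sup>+x. epowr (maximal ?h x) (p / r) \<partial>lborel)"
      by (rule nn_integral_cmult) measurable
    also have "\<dots> \<le> ennreal (B powr (p / r)) * (ennreal D * (\<integral>\<^sup>+x. epowr (?h x) (p / r) \<partial>lborel))"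
      by (intro mult_left_mono D h) auto
    also have "(\<integral>\<^sup>+x. epowr (?h x) (p / r) \<partial>lborel) = (\<integral>\<^sup>+x. epowr (SUP j. u j x) p \<partial>lborel)"
      using r0 by (simp add: epowr_epowr)
    also have "ennreal (B powr (p / r)) * (ennreal D * (\<integral>\<^sup>+x. epowr (SUP j. u j x) p \<partial>lborel)) =
        ennreal ?C * (\<integral>\<^sup>+x. epowr (SUP j. u j x) p \<partial>lborel)"
      using D by (simp add: ennreal_mult mult.assoc)
    finally show "(\<integral>\<^sup>+x. epowr (SUP j. v j x) p \<partial>lborel) \<le> ennreal ?C * (\<integral>\<^sup>+x. epowr (SUP j. u j x) p \<partial>lborel)" .
  qed
qed

text \<open>
  Each level \<open>2\<^bsup>i\<^esup>\<close> is handled by removing the set where the maximal function of \<open>{H > 2\<^bsup>i\<^esup>}\<close> is not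
  small: off this set every ball entering the supremum meets \<open>{H \<le> 2\<^bsup>i\<^esup>}\<close> in half its volume.
\<close>

lemma shell_good_lambda:
  fixes u :: "int \<Rightarrow> 'a::euclidean_space \<Rightarrow> ennreal"
  assumes u[measurable]: "\<And>j. u j \<in> borel_measurable borel" and q: "q > 0" and th: "0 < th" "th < 1"
    and d: "0 < d" "d \<le> 1"
  defines "K \<equiv> 2 powr th * (2 * 5 ^ DIM('a) * (2 / d) ^ DIM('a) / (1 - 2 powr (- th)) +
      shell_const d DIM('a) * unit_ball_vol DIM('a) / (1 - 2 powr (th - 1)))"
  shows "\<exists>W\<in>borel_measurable borel.
    (\<forall>x. epowr (int_sum (\<lambda>j. epowr (shell_sup d u j k x) q)) th \<le> W x) \<and>
    (\<integral>\<^sup>+x. W x \<partial>lborel) \<le> ennreal (K * (2 ^ k) ^ DIM('a)) *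
      (\<integral>\<^sup>+x. epowr (int_sum (\<lambda>j. epowr (u j x) q)) th \<partial>lborel)"
proof -
  let ?n = "DIM('a)"
  let ?v = "unit_ball_vol (real ?n)"
  have v: "?v > 0" by simp
  define H where "H x = (int_sum (\<lambda>j. epowr (u j x) q))" for x
  have H[measurable]: "H \<in> borel_measurable borel"
    unfolding H_def by (intro borel_measurable_count_space_int) measurable
  define T where "T x = (int_sum (\<lambda>j. epowr (shell_sup d u j k x) q))" for x
  \<comment> \<open>Half the volume of a small ball in units of
    \<open>shell_radius j k ^ ?n\<close>. An average of the indicator of \<open>hi i\<close> below
    \<open>kap\<close> thus leaves at most half of each small ball to \<open>hi i\<close>.\<close>
  define kap where "kap = ?v / 2 * (d / 2 ^ (k + 1)) ^ ?n"
  have kap: "kap > 0" using v d by (simp add: kap_def)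
  define hi :: "int \<Rightarrow> 'a set" where "hi i = {x. ennreal (2 powr of_int i) < H x}" for i
  define lo :: "int \<Rightarrow> 'a set" where "lo i = {x. H x \<le> ennreal (2 powr of_int i)}" for i
  have hi[measurable]: "hi i \<in> sets borel" and lo[measurable]: "lo i \<in> sets borel" for i
    unfolding hi_def lo_def by measurable
  define Om :: "int \<Rightarrow> 'a set" where "Om i = {x. ennreal kap < maximal (indicator (hi i)) x}" for i
  have Om[measurable]: "Om i \<in> sets borel" for i
    unfolding Om_def by measurable
  define A where "A = shell_const d ?n * (2 ^ k) ^ ?n"
  have A: "A > 0" using shell_const_pos[OF d(1), of ?n] by (simp add: A_def)
  define U where "U i x = (int_sum (\<lambda>j. ennreal A * Av (shell_radius j k) (\<lambda>y. epowr (u j y) q * indicator (lo i) y) x))" for i x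
  have U[measurable]: "U i \<in> borel_measurable borel" for i
    unfolding U_def by (intro borel_measurable_count_space_int) measurable
  have good: "T x \<le> U i x" if x: "x \<notin> Om i" for x i
    unfolding T_def U_def
  proof (rule nn_integral_mono)
    fix j :: int
    let ?R = "freq j"
    have R: "?R > 0" by simp
    show "epowr (shell_sup d u j k x) q \<le> ennreal A * Av (shell_radius j k) (\<lambda>y. epowr (u j y) q * indicator (lo i) y) x"
      unfolding A_def
    proof (rule shell_sup_le_Av[OF u lo d q])
      fix t assume t: "t \<in> cball x (2 ^ k / ?R)"
      let ?B = "ball t (d / ?R)"
      let ?b = "?v * (d / ?R) ^ ?n"
      have b: "?b > 0" using v d R by simp
      have sub: "?B \<subseteq> cball x (shell_radius j k)"
      proof
        fix y assume "y \<in> ?B"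
        then have "dist x y \<le> 2 ^ k / ?R + d / ?R" using t dist_triangle[of x y t] by simp
        also have "\<dots> \<le> 2 ^ k / ?R + 2 ^ k / ?R"
        proof (intro add_left_mono divide_right_mono)
          show "d \<le> 2 ^ k" using d(2) one_le_power[of "2::real" k] by linarith
        qed (use R in simp)
        finally show "y \<in> cball x (shell_radius j k)" by (simp add: field_simps)
      qed
      have "Av (shell_radius j k) (indicator (hi i)) x \<le> ennreal kap"
        using x Av_shell_le_maximal[where j=j and k=k and h="indicator (hi i)" and x=x] by (simp add: Om_def)
      then have "ennreal (shell_radius j k ^ ?n) * Av (shell_radius j k) (indicator (hi i)) x \<le> ennreal (shell_radius j k ^ ?n) * ennreal kap"
        by (intro mult_left_mono) auto
      moreover have "ennreal (shell_radius j k ^ ?n) * Av (shell_radius j k) (indicator (hi i)) x = emeasure lborel (hi i \<inter> cball x (shell_radius j k))"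
      proof -
        have "ennreal (shell_radius j k ^ ?n) * ennreal (1 / shell_radius j k ^ ?n) = 1"
          using R ennreal_divide_mult_cancel[of "shell_radius j k ^ ?n"] by (simp add: mult.commute)
        moreover have "(\<integral>\<^sup>+y. indicator (hi i) y * indicator (cball x (shell_radius j k)) y \<partial>lborel) = emeasure lborel (hi i \<inter> cball x (shell_radius j k))"
          by (subst indicator_inter_arith[symmetric], rule nn_integral_indicator) simp
        ultimately show ?thesis unfolding Av_def by (simp only: mult.assoc[symmetric] mult_1)
      qed
      moreover have "ennreal (shell_radius j k ^ ?n) * ennreal kap = ennreal (1/2 * ?b)"
      proof -
        have "shell_radius j k ^ ?n * kap = 1/2 * ?b"
          by (simp add: kap_def power_divide power_mult_distrib field_simps)
        moreover have "ennreal (shell_radius j k ^ ?n) * ennreal kap = ennreal (shell_radius j k ^ ?n * kap)"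
          by (rule ennreal_mult'[symmetric]) simp
        ultimately show ?thesis by (simp only:)
      qed
      moreover have "emeasure lborel (?B \<inter> hi i) \<le> emeasure lborel (hi i \<inter> cball x (shell_radius j k))"
        using sub by (intro emeasure_mono) auto
      ultimately have small: "emeasure lborel (?B \<inter> hi i) \<le> ennreal (1/2 * ?b)" by simp
      have split: "emeasure lborel ?B = emeasure lborel (?B \<inter> hi i) + emeasure lborel (?B \<inter> lo i)"
      proof -
        have "?B = (?B \<inter> hi i) \<union> (?B \<inter> lo i)" by (auto simp: hi_def lo_def)
        moreover have "(?B \<inter> hi i) \<inter> (?B \<inter> lo i) = {}" by (auto simp: hi_def lo_def)
        ultimately show ?thesis using plus_emeasure[of "?B \<inter> hi i" lborel "?B \<inter> lo i"] by simp
      qed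
      have tot: "emeasure lborel ?B = ennreal ?b" using d R by (simp add: emeasure_ball)
      show "ennreal (?v / 2 * (d / ?R) ^ ?n) \<le> emeasure lborel (?B \<inter> lo i)"
      proof (cases "emeasure lborel (?B \<inter> lo i)")
        case (real z)
        have "ennreal ?b \<le> ennreal (1/2 * ?b) + ennreal z"
          using split small unfolding tot real(2) by (metis add_right_mono)
        also have "\<dots> = ennreal (1/2 * ?b + z)" using b real by (intro ennreal_plus[symmetric]) auto
        finally have "?b \<le> 1/2 * ?b + z" using b real by (subst (asm) ennreal_le_iff) auto
        then show ?thesis unfolding real(2) by (intro ennreal_leI) simp
      qed simp
    qed
  qed
  \<comment> \<open>\<open>T\<close> involves infima and suprema over uncountable sets of merely
    measurable functions, so a measurable majorant carries the integral. Layer \<open>i\<close> is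
    counted in full on \<open>Om i\<close>; elsewhere 2^i < T \<le> U i, and 2^(-i) U i dominates
    the indicator.\<close>
  define W where "W x = (int_sum (\<lambda>i. ennreal (2 powr ((of_int i + 1) * th)) * indicator (Om i) x +
      ennreal (2 powr ((of_int i + 1) * th - of_int i)) * U i x))" for x
  have W[measurable]: "W \<in> borel_measurable borel"
    unfolding W_def by (intro borel_measurable_count_space_int) measurable
  have le: "epowr (T x) th \<le> W x" for x
  proof -
    have "epowr (T x) th \<le> (int_sum (\<lambda>i. ennreal (2 powr ((of_int i + 1) * th)) * indicator {i. ennreal (2 powr of_int i) < T x} i))"
      by (rule epowr_le_layers[OF th(1)])
    also have "\<dots> \<le> W x"
      unfolding W_def
    proof (rule nn_integral_mono)
      fix i :: int
      let ?c = "ennreal (2 powr ((of_int i + 1) * th))"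
      show "?c * indicator {i. ennreal (2 powr of_int i) < T x} i \<le> ?c * indicator (Om i) x + ennreal (2 powr ((of_int i + 1) * th - of_int i)) * U i x"
      proof (cases "x \<in> Om i \<or> \<not> ennreal (2 powr of_int i) < T x")
        case False
        then have "ennreal (2 powr of_int i) \<le> U i x" using good[of x i] by (meson less_imp_le order_trans)
        then have "ennreal (2 powr ((of_int i + 1) * th - of_int i)) * ennreal (2 powr of_int i) \<le> ennreal (2 powr ((of_int i + 1) * th - of_int i)) * U i x"
          by (intro mult_left_mono) auto
        moreover have "ennreal (2 powr ((of_int i + 1) * th - of_int i)) * ennreal (2 powr of_int i) = ?c"
          by (subst ennreal_mult'[symmetric]) (auto simp: powr_add[symmetric])
        ultimately show ?thesis using False by (simp add: indicator_def)
      qed (auto simp: indicator_def)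
    qed
    finally show ?thesis .
  qed
  define B where "B = 1 / (1 - 2 powr (- th))"
  define B' where "B' = 1 / (1 - 2 powr (th - 1))"
  have B: "B > 0" "B' > 0" using th by (auto simp: B_def B'_def powr_less_one)
  let ?I = "\<integral>\<^sup>+x. epowr (H x) th \<partial>lborel"
  \<comment> \<open>This is 5^n v / kap, the weak type constant at height \<open>kap\<close>; here
    the factor \<open>(2 ^ k) ^ ?n\<close> enters.\<close>
  define E where "E = 2 * 5 ^ ?n * (2 / d) ^ ?n * (2 ^ k) ^ ?n"
  let ?F = "\<lambda>i x. ennreal (2 powr ((of_int i + 1) * th)) * indicator (Om i) x + ennreal (2 powr ((of_int i + 1) * th - of_int i)) * U i x"
  let ?G = "\<lambda>i x. ennreal (2 powr th * E) * (ennreal (2 powr (of_int i * th)) * indicator (hi i) x) +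
      ennreal (2 powr th * (A * ?v)) * (H x * (ennreal (2 powr (of_int i * (th - 1))) * indicator (lo i) x))"
  have E: "E > 0" using d by (simp add: E_def)
  have intOm: "emeasure lborel (Om i) \<le> ennreal E * emeasure lborel (hi i)" for i
  proof -
    have "emeasure lborel (Om i) \<le> ennreal (5 ^ ?n * ?v / kap) * (\<integral>\<^sup>+x. indicator (hi i) x \<partial>lborel)"
      unfolding Om_def by (rule weak_type[OF _ kap]) measurable
    also have "5 ^ ?n * ?v / kap = E"
      using d by (simp add: kap_def E_def power_divide power_mult_distrib field_simps)
    finally show ?thesis by simp
  qed
  have intU: "(\<integral>\<^sup>+x. U i x \<partial>lborel) = ennreal (A * ?v) * (\<integral>\<^sup>+x. H x * indicator (lo i) x \<partial>lborel)" for i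
  proof -
    have "(\<integral>\<^sup>+x. U i x \<partial>lborel) = (int_sum (\<lambda>j. (\<integral>\<^sup>+x. ennreal A * Av (shell_radius j k) (\<lambda>y. epowr (u j y) q * indicator (lo i) y) x \<partial>lborel)))"
      unfolding U_def by (rule nn_integral_count_space_nn_integral) auto
    also have "\<dots> = (int_sum (\<lambda>j. ennreal (A * ?v) * (\<integral>\<^sup>+x. epowr (u j x) q * indicator (lo i) x \<partial>lborel)))"
      using A by (intro nn_integral_cong) (simp add: nn_integral_cmult nn_integral_Av ennreal_mult mult.assoc)
    also have "\<dots> = ennreal (A * ?v) * (int_sum (\<lambda>j. (\<integral>\<^sup>+x. epowr (u j x) q * indicator (lo i) x \<partial>lborel)))"
      by (rule nn_integral_cmult) simp
    also have "(int_sum (\<lambda>j. (\<integral>\<^sup>+x. epowr (u j x) q * indicator (lo i) x \<partial>lborel))) = (\<integral>\<^sup>+x. (int_sum (\<lambda>j. epowr (u j x) q * indicator (lo i) x)) \<partial>lborel)"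
      by (rule nn_integral_count_space_nn_integral[symmetric]) auto
    also have "\<dots> = (\<integral>\<^sup>+x. H x * indicator (lo i) x \<partial>lborel)"
      unfolding H_def by (intro nn_integral_cong nn_integral_multc) simp
    finally show ?thesis .
  qed
  have "(\<integral>\<^sup>+x. W x \<partial>lborel) = (int_sum (\<lambda>i. (\<integral>\<^sup>+x. ?F i x \<partial>lborel)))"
    unfolding W_def by (rule nn_integral_count_space_nn_integral) auto
  also have "\<dots> \<le> (int_sum (\<lambda>i. (\<integral>\<^sup>+x. ?G i x \<partial>lborel)))"
  proof (rule nn_integral_mono)
    fix i :: int
    have p1: "2 powr ((of_int i + 1) * th) = 2 powr th * 2 powr (of_int i * th)"
      and p2: "2 powr ((of_int i + 1) * th - of_int i) = 2 powr th * 2 powr (of_int i * (th - 1))"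
      by (simp_all add: powr_add[symmetric] algebra_simps)
    have "(\<integral>\<^sup>+x. ?F i x \<partial>lborel) =
      ennreal (2 powr ((of_int i + 1) * th)) * emeasure lborel (Om i) +
        ennreal (2 powr ((of_int i + 1) * th - of_int i)) * (\<integral>\<^sup>+x. U i x \<partial>lborel)"
      by (subst nn_integral_add) (auto simp: nn_integral_cmult nn_integral_cmult_indicator)
    also have "\<dots> \<le> ennreal (2 powr ((of_int i + 1) * th)) * (ennreal E * emeasure lborel (hi i)) +
        ennreal (2 powr ((of_int i + 1) * th - of_int i)) * (ennreal (A * ?v) * (\<integral>\<^sup>+x. H x * indicator (lo i) x \<partial>lborel))"
      unfolding intU by (intro add_right_mono mult_left_mono intOm) auto
    also have "\<dots> = ennreal (2 powr th * E) * (ennreal (2 powr (of_int i * th)) * emeasure lborel (hi i)) +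
        ennreal (2 powr th * (A * ?v)) * (ennreal (2 powr (of_int i * (th - 1))) * (\<integral>\<^sup>+x. H x * indicator (lo i) x \<partial>lborel))"
      unfolding p1 p2 using A E v by (simp add: ennreal_mult mult_ac)
    also have "\<dots> = (\<integral>\<^sup>+x. ennreal (2 powr th * E) * (ennreal (2 powr (of_int i * th)) * indicator (hi i) x) +
      ennreal (2 powr th * (A * ?v)) * (ennreal (2 powr (of_int i * (th - 1))) * (H x * indicator (lo i) x)) \<partial>lborel)"
      by (subst nn_integral_add) (auto simp: nn_integral_cmult nn_integral_cmult_indicator)
    finally show "(\<integral>\<^sup>+x. ?F i x \<partial>lborel) \<le>
      (\<integral>\<^sup>+x. ?G i x \<partial>lborel)"
      by (simp only: mult.left_commute)
  qed
  also have "\<dots> = (\<integral>\<^sup>+x. (int_sum (\<lambda>i. ?G i x)) \<partial>lborel)"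
    by (rule nn_integral_count_space_nn_integral[symmetric]) auto
  also have "\<dots> \<le> (\<integral>\<^sup>+x. ennreal (K * (2 ^ k) ^ ?n) * epowr (H x) th \<partial>lborel)"
  proof (rule nn_integral_mono)
    fix x
    have i1: "indicator (hi i) x = (indicator {i. ennreal (2 powr of_int i) < H x} i :: ennreal)" for i
      by (simp add: hi_def indicator_def)
    have i2: "indicator (lo i) x = (indicator {i. H x \<le> ennreal (2 powr of_int i)} i :: ennreal)" for i
      by (simp add: lo_def indicator_def)
    have "(int_sum (\<lambda>i. ?G i x)) =
      ennreal (2 powr th * E) * (int_sum (\<lambda>i. ennreal (2 powr (of_int i * th)) * indicator (hi i) x)) +
      ennreal (2 powr th * (A * ?v)) * (H x * (int_sum (\<lambda>i. ennreal (2 powr (of_int i * (th - 1))) * indicator (lo i) x)))"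
      by (subst nn_integral_add) (auto simp: nn_integral_cmult)
    \<comment> \<open>For fixed \<open>x\<close> the levels below \<open>H x\<close> sum to a
      multiple of H^th, and those above it to H times a multiple of H^(th-1). The second sum
      converges because th < 1.\<close>
    also have "\<dots> \<le> ennreal (2 powr th * E) * (ennreal B * epowr (H x) th) + ennreal (2 powr th * (A * ?v)) * (ennreal B' * epowr (H x) th)"
      unfolding i1 i2 B_def B'_def
      by (intro add_mono mult_left_mono layers_le_epowr[OF th(1)] upper_layers_le_epowr[OF th]) auto
    also have "\<dots> = (ennreal (2 powr th * E) * ennreal B + ennreal (2 powr th * (A * ?v)) * ennreal B') * epowr (H x) th"
      by (simp only: distrib_right mult.assoc)
    also have "ennreal (2 powr th * E) * ennreal B + ennreal (2 powr th * (A * ?v)) * ennreal B' = ennreal (2 powr th * E * B + 2 powr th * (A * ?v) * B')"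
      using A E v B by (subst ennreal_plus) (auto simp: ennreal_mult)
    also have "2 powr th * E * B + 2 powr th * (A * ?v) * B' = K * (2 ^ k) ^ ?n"
      by (simp add: K_def A_def E_def B_def B'_def algebra_simps)
    finally show "(int_sum (\<lambda>i. ?G i x)) \<le>
      ennreal (K * (2 ^ k) ^ ?n) * epowr (H x) th" .
  qed
  also have "\<dots> = ennreal (K * (2 ^ k) ^ ?n) * ?I"
    by (rule nn_integral_cmult) measurable
  finally show ?thesis using W le unfolding T_def H_def by blast
qed

text \<open>The shells are summed with exponent \<open>q\<close>, but subadditivity of the power p /
  q < 1 turns the weights 2^(-ksq) into 2^(-ksp). Against the loss 2^(kn) from the level set
  argument this sums exactly when s p > n.\<close>

lemma square_function_greater:
  assumes s: "s > 0" and q: "0 < p" "p < q" and d: "0 < d" "d \<le> 1" and sp: "s * p > real DIM('a)"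
  shows "controlled d s (\<lambda>u :: int \<Rightarrow> 'a::euclidean_space \<Rightarrow> ennreal. \<integral>\<^sup>+x. epowr (int_sum (\<lambda>j. epowr (u j x) q)) (p / q) \<partial>lborel)"
proof -
  let ?n = "DIM('a)"
  define th where "th = p / q"
  have th: "0 < th" "th < 1" and q0: "q > 0" using q by (auto simp: th_def)
  define K where "K = 2 powr th * (2 * 5 ^ DIM('a) * (2 / d) ^ DIM('a) / (1 - 2 powr (- th)) +
      shell_const d DIM('a) * unit_ball_vol DIM('a) / (1 - 2 powr (th - 1)))"
  have K: "K > 0"
    unfolding K_def using d th shell_const_pos[OF d(1), of ?n]
    by (intro mult_pos_pos add_pos_pos divide_pos_pos) (auto simp: powr_less_one)
  define L where "L = (2 * 2 powr s) powr p"
  have L: "L > 0" by (simp add: L_def)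
  let ?z = "2 powr (- (s * p - ?n)) :: real"
  have z: "0 < ?z" "?z < 1" using sp by (auto simp: powr_less_one)
  define C where "C = L * (K * (1 / (1 - ?z)))"
  have C: "C > 0" unfolding C_def using L K z by (intro mult_pos_pos) auto
  have sumz: "(\<Sum>k. ennreal (K * ?z ^ k)) = ennreal (K * (1 / (1 - ?z)))"
    using z K by (intro suminf_ennreal_eq sums_mult geometric_sums) auto
  have "controlled d s (\<lambda>u :: int \<Rightarrow> 'a \<Rightarrow> ennreal. \<integral>\<^sup>+x. epowr (int_sum (\<lambda>j. epowr (u j x) q)) th \<partial>lborel)"
  proof (rule controlledI[OF C])
    fix u v :: "int \<Rightarrow> 'a \<Rightarrow> ennreal"
    assume dom: "dominated d s u v"
    note u[measurable] = dominated_measurable[OF dom]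
    let ?I = "\<integral>\<^sup>+x. epowr (int_sum (\<lambda>j. epowr (u j x) q)) th \<partial>lborel"
    let ?T = "\<lambda>k x. \<integral>\<^sup>+j. epowr (shell_sup d u j k x) q \<partial>count_space UNIV"
    have "\<forall>k. \<exists>W. W \<in> borel_measurable borel \<and> (\<forall>x. epowr (?T k x) th \<le> W x) \<and>
        (\<integral>\<^sup>+x. W x \<partial>lborel) \<le> ennreal (K * (2 ^ k) ^ ?n) * ?I"
      using shell_good_lambda[where u=u, OF u q0 th d] unfolding K_def by blast
    then obtain W where W[measurable]: "\<And>k. W k \<in> borel_measurable borel"
      and WT: "\<And>k x. epowr (?T k x) th \<le> W k x"
      and WI: "\<And>k. (\<integral>\<^sup>+x. W k x \<partial>lborel) \<le> ennreal (K * (2 ^ k) ^ ?n) * ?I" by metis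
    have pt: "epowr (int_sum (\<lambda>j. epowr (v j x) q)) th \<le> ennreal L * (\<Sum>k. ennreal (2 powr (- real k * s * p)) * W k x)" for x
    proof -
      let ?M = "(2 * 2 powr s) powr q :: real"
      have "(int_sum (\<lambda>j. epowr (v j x) q)) \<le>
        (int_sum (\<lambda>j. ennreal ?M * (\<Sum>k. ennreal (2 powr (- real k * s * q)) * epowr (shell_sup d u j k x) q)))"
        by (intro nn_integral_mono dominated_shell_sum[OF dom s q0])
      also have "\<dots> = ennreal ?M * (int_sum (\<lambda>j. (\<Sum>k. ennreal (2 powr (- real k * s * q)) * epowr (shell_sup d u j k x) q)))"
        by (rule nn_integral_cmult) simp
      also have "(int_sum (\<lambda>j. (\<Sum>k. ennreal (2 powr (- real k * s * q)) * epowr (shell_sup d u j k x) q))) =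
        (\<Sum>k. \<integral>\<^sup>+j. ennreal (2 powr (- real k * s * q)) * epowr (shell_sup d u j k x) q \<partial>count_space UNIV)"
        by (rule nn_integral_suminf) simp
      also have "\<dots> = (\<Sum>k. ennreal (2 powr (- real k * s * q)) * ?T k x)"
        by (intro suminf_cong nn_integral_cmult) simp
      finally have "epowr (int_sum (\<lambda>j. epowr (v j x) q)) th \<le> epowr (ennreal ?M * (\<Sum>k. ennreal (2 powr (- real k * s * q)) * ?T k x)) th"
        using th by (intro epowr_mono) auto
      also have "\<dots> = ennreal L * epowr (\<Sum>k. ennreal (2 powr (- real k * s * q)) * ?T k x) th"
        using th q0 by (simp add: epowr_mult epowr_ennreal powr_powr L_def th_def)
      also have "\<dots> \<le> ennreal L * (\<Sum>k. epowr (ennreal (2 powr (- real k * s * q)) * ?T k x) th)"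
        using th by (intro mult_left_mono epowr_suminf_le) auto
      also have "\<dots> \<le> ennreal L * (\<Sum>k. ennreal (2 powr (- real k * s * p)) * W k x)"
      proof (intro mult_left_mono suminf_le)
        fix k
        have "epowr (ennreal (2 powr (- real k * s * q)) * ?T k x) th = ennreal (2 powr (- real k * s * p)) * epowr (?T k x) th"
          using th q0 by (simp add: epowr_mult epowr_ennreal powr_powr th_def mult.assoc)
        also have "\<dots> \<le> ennreal (2 powr (- real k * s * p)) * W k x"
          by (intro mult_left_mono WT) auto
        finally show "epowr (ennreal (2 powr (- real k * s * q)) * ?T k x) th \<le> ennreal (2 powr (- real k * s * p)) * W k x" .
      qed auto
      finally show ?thesis .
    qed
    have "(\<integral>\<^sup>+x. epowr (int_sum (\<lambda>j. epowr (v j x) q)) th \<partial>lborel) \<le>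
        (\<integral>\<^sup>+x. ennreal L * (\<Sum>k. ennreal (2 powr (- real k * s * p)) * W k x) \<partial>lborel)"
      by (intro nn_integral_mono pt)
    also have "\<dots> = ennreal L * (\<integral>\<^sup>+x. (\<Sum>k. ennreal (2 powr (- real k * s * p)) * W k x) \<partial>lborel)"
      by (rule nn_integral_cmult) measurable
    also have "(\<integral>\<^sup>+x. (\<Sum>k. ennreal (2 powr (- real k * s * p)) * W k x) \<partial>lborel) = (\<Sum>k. \<integral>\<^sup>+x. ennreal (2 powr (- real k * s * p)) * W k x \<partial>lborel)"
      by (rule nn_integral_suminf) measurable
    also have "\<dots> \<le> (\<Sum>k. ennreal (K * ?z ^ k) * ?I)"
    proof (intro suminf_le)
      fix k
      have "(\<integral>\<^sup>+x. ennreal (2 powr (- real k * s * p)) * W k x \<partial>lborel) = ennreal (2 powr (- real k * s * p)) * (\<integral>\<^sup>+x. W k x \<partial>lborel)"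
        by (rule nn_integral_cmult) measurable
      also have "\<dots> \<le> ennreal (2 powr (- real k * s * p)) * (ennreal (K * (2 ^ k) ^ ?n) * ?I)"
        by (intro mult_left_mono WI) auto
      also have "\<dots> = ennreal (2 powr (- real k * s * p) * (K * (2 ^ k) ^ ?n)) * ?I"
        by (subst ennreal_mult') (auto simp: mult.assoc)
      also have "2 powr (- real k * s * p) * (K * (2 ^ k) ^ ?n) = K * ?z ^ k"
      proof -
        have "(2 ^ k) ^ ?n = (2::real) powr (real k * real ?n)"
          by (simp add: powr_realpow[symmetric] powr_powr)
        then show ?thesis by (simp add: powr_power powr_add[symmetric] algebra_simps)
      qed
      finally show "(\<integral>\<^sup>+x. ennreal (2 powr (- real k * s * p)) * W k x \<partial>lborel) \<le> ennreal (K * ?z ^ k) * ?I" .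
    qed auto
    also have "\<dots> = ennreal (K * (1 / (1 - ?z))) * ?I" by (simp only: ennreal_suminf_multc sumz)
    finally have "(\<integral>\<^sup>+x. epowr (int_sum (\<lambda>j. epowr (v j x) q)) th \<partial>lborel) \<le> ennreal L * (ennreal (K * (1 / (1 - ?z))) * ?I)"
      by (simp add: mult_left_mono)
    also have "\<dots> = ennreal C * ?I"
      unfolding C_def using L by (subst ennreal_mult') (auto simp: mult.assoc)
    finally show "(\<integral>\<^sup>+x. epowr (int_sum (\<lambda>j. epowr (v j x) q)) th \<partial>lborel) \<le> ennreal C * ?I" .
  qed
  then show ?thesis unfolding th_def .
qed

section \<open>Equivalence of the quasi-norms\<close>

text \<open>\<open>y\<close> may be negative, in which case \<open>ennreal y\<close> is 0 and only
  an inequality survives; this occurs where the oscillation bound exceeds the function.\<close>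

lemma ennreal_le_add:
  assumes "x = y + z" "0 \<le> z"
  shows "ennreal x \<le> ennreal y + ennreal z"
proof (cases "0 \<le> y")
  case False
  then have "ennreal x \<le> ennreal z" using assms by (intro ennreal_leI) simp
  then show ?thesis by (simp add: add_increasing)
qed (use assms in simp)

text \<open>Puts the weights \<open>2 powr (of_int j * \<alpha>)\<close> into the functions
  themselves, so the square function bounds can be stated without \<alpha>.\<close>

lemma dominated_cmult:
  fixes w :: "int \<Rightarrow> real" and u v :: "int \<Rightarrow> 'a::euclidean_space \<Rightarrow> ennreal"
  assumes dom: "dominated d s u v"
  shows "dominated d s (\<lambda>j x. ennreal (w j) * u j x) (\<lambda>j x. ennreal (w j) * v j x)"
  unfolding dominated_def
proof (intro conjI allI)
  note [measurable] = dominated_measurable[OF dom]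
  show "(\<lambda>x. ennreal (w j) * u j x) \<in> borel_measurable borel" for j by measurable
  fix j and x :: 'a
  let ?R = "freq j"
  let ?c = "\<lambda>t. ennreal (1 / (1 + ?R * norm (x - t)) powr s)"
  have "ennreal (w j) * v j x \<le> ennreal (w j) * (2 * (SUP t. (INF y\<in>ball t (d / ?R). u j y) * ?c t))"
    using dom by (intro mult_left_mono) (simp_all add: dominated_def)
  also have "\<dots> = 2 * (ennreal (w j) * (SUP t. (INF y\<in>ball t (d / ?R). u j y) * ?c t))"
    by (rule mult.left_commute)
  also have "ennreal (w j) * (SUP t. (INF y\<in>ball t (d / ?R). u j y) * ?c t) =
      (SUP t. ennreal (w j) * ((INF y\<in>ball t (d / ?R). u j y) * ?c t))"
    by (rule SUP_mult_left_ennreal)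
  also have "\<dots> \<le> (SUP t. (INF y\<in>ball t (d / ?R). ennreal (w j) * u j y) * ?c t)"
  proof (rule SUP_mono')
    fix t
    have "ennreal (w j) * (INF y\<in>ball t (d / ?R). u j y) \<le> (INF y\<in>ball t (d / ?R). ennreal (w j) * u j y)"
      by (intro INF_greatest mult_left_mono INF_lower) auto
    then show "ennreal (w j) * ((INF y\<in>ball t (d / ?R). u j y) * ?c t) \<le> (INF y\<in>ball t (d / ?R). ennreal (w j) * u j y) * ?c t"
      by (subst mult.assoc[symmetric]) (intro mult_right_mono, auto)
  qed
  finally show "ennreal (w j) * v j x \<le> 2 * (SUP t. (INF y\<in>ball t (d / ?R). ennreal (w j) * u j y) * ?c t)"
    by (simp add: mult_left_mono)
qed

section \<open>Domination of the Peetre maximal function\<close>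

context spectral_kernel
begin

context
  fixes \<phi> :: "int \<Rightarrow> real \<Rightarrow> complex" and s :: real
  assumes \<phi>: "dyadic_family \<phi>" and s: "s > 0"
begin

lemma spectral_apply_le_peetre: "ennreal (norm (spectral_apply E (\<phi> j) f x)) \<le> peetre_maximal E \<phi> j s f x"
  unfolding peetre_maximal_def by (rule SUP_upper2[of x]) auto

text \<open>A supremum of continuous functions is lower semicontinuous, even over uncountably many
  \<open>t\<close>.\<close>

lemma peetre_measurable: "peetre_maximal E \<phi> j s f \<in> borel_measurable borel"
proof (rule borel_measurableI_greater)
  fix y :: ennreal
  let ?h = "\<lambda>t x. ennreal (norm (spectral_apply E (\<phi> j) f t) / (1 + freq j * norm (x - t)) powr s)"
  have "open {x. y < ?h t x}" for t
  proof (intro open_Collect_less continuous_on_const continuous_on_ennreal)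
    have "1 + freq j * norm (x - t) > 0" for x by (simp add: add_pos_nonneg)
    then have "1 + freq j * norm (x - t) \<noteq> 0" for x by (simp add: less_imp_neq[symmetric])
    then show "continuous_on UNIV (\<lambda>x. norm (spectral_apply E (\<phi> j) f t) / (1 + freq j * norm (x - t)) powr s)"
      by (intro continuous_intros) auto
  qed
  then have "open (\<Union>t. {x. y < ?h t x})" by (intro open_UN) auto
  moreover have "{x \<in> space borel. y < peetre_maximal E \<phi> j s f x} = (\<Union>t. {x. y < ?h t x})"
    by (auto simp: peetre_maximal_def less_SUP_iff)
  ultimately show "{x \<in> space borel. y < peetre_maximal E \<phi> j s f x} \<in> sets borel" by simp
qed

text \<open>Let \<open>D\<close> be the maximal function at \<open>w\<close>. On a small ball about
  \<open>t\<close> the modulus drops by at most half of \<open>D\<close> times the weight at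
  \<open>t\<close>; after division by that weight the loss is D / 2 for every \<open>t\<close>, so
  it survives the supremum unchanged and is absorbed.\<close>

lemma peetre_dominated:
  "\<exists>d. 0 < d \<and> d \<le> 1 \<and> (\<forall>f\<in>schwartz_space.
    dominated d s (\<lambda>j x. ennreal (norm (spectral_apply E (\<phi> j) f x))) (\<lambda>j. peetre_maximal E \<phi> j s f))"
proof -
  obtain C where C: "C > 0" and slow: "\<And>f j x x' w D. f \<in> schwartz_space \<Longrightarrow>
    (\<And>t. norm (spectral_apply E (\<phi> j) f t) \<le> D * (1 + freq j * norm (w - t)) powr s) \<Longrightarrow>
    freq j * norm (x - x') \<le> 1 \<Longrightarrow>
    norm (spectral_apply E (\<phi> j) f x - spectral_apply E (\<phi> j) f x') \<le>
      C * (freq j * norm (x - x')) * D * (1 + freq j * norm (w - x)) powr s"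
    using slow_variation[OF \<phi> less_imp_le[OF s]] by blast
  \<comment> \<open>Makes C d \<le> 1/2, and d \<le> 1 keeps the ball within the range of the slow
    variation estimate. Both hold for all \<open>f\<close> and \<open>j\<close> at once.\<close>
  define d where "d = 1 / (2 * C + 1)"
  have d: "0 < d" "d \<le> 1" "C * d \<le> 1 / 2" using C by (auto simp: d_def field_simps)
  have "dominated d s (\<lambda>j x. ennreal (norm (spectral_apply E (\<phi> j) f x))) (\<lambda>j. peetre_maximal E \<phi> j s f)"
    if f: "f \<in> schwartz_space" for f
    unfolding dominated_def
  proof (intro conjI allI)
    fix j
    let ?F = "spectral_apply E (\<phi> j) f"
    let ?R = "freq j"
    have cont: "continuous_on UNIV ?F" by (rule spectral_apply_regular(1)[OF \<phi> f])
    show "(\<lambda>x. ennreal (norm (?F x))) \<in> borel_measurable borel"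
      by (intro borel_measurable_continuous_onI continuous_on_ennreal continuous_on_norm cont)
    fix w :: "real^'n"
    let ?G = "\<lambda>t. (1 + ?R * norm (w - t)) powr s"
    let ?m = "\<lambda>t. INF y\<in>ball t (d / ?R). ennreal (norm (?F y))"
    let ?S = "SUP t. ?m t * ennreal (1 / ?G t)"
    have b1: "1 + ?R * norm (w - t) \<ge> 1" for t by simp
    have G: "?G t \<ge> 1" for t using b1[of t] s by (intro ge_one_powr_ge_zero) auto
    obtain B where B: "\<And>x. norm (?F x) \<le> B" using spectral_apply_regular(2)[OF \<phi> f] by blast
    have "peetre_maximal E \<phi> j s f w \<le> ennreal B"
      unfolding peetre_maximal_def
    proof (intro SUP_least ennreal_leI)
      fix t
      have "norm (?F t) / ?G t \<le> norm (?F t) / 1" using G[of t] by (intro divide_left_mono) auto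
      then show "norm (?F t) / ?G t \<le> B" using B[of t] by simp
    qed
    then obtain D where D: "peetre_maximal E \<phi> j s f w = ennreal D" "D \<ge> 0"
      by (cases "peetre_maximal E \<phi> j s f w") (auto simp: top_unique)
    have FD: "norm (?F t) \<le> D * ?G t" for t
    proof -
      have "ennreal (norm (?F t) / ?G t) \<le> ennreal D"
        unfolding D(1)[symmetric] peetre_maximal_def by (rule SUP_upper) simp
      then have "norm (?F t) / ?G t \<le> D" using D by simp
      moreover have "0 < ?G t" using G[of t] by linarith
      ultimately show ?thesis by (simp only: pos_divide_le_eq)
    qed
    have "ennreal (norm (?F t) / ?G t) \<le> ?m t * ennreal (1 / ?G t) + ennreal (D / 2)" for t
    proof -
      \<comment> \<open>Where the difference is negative, \<open>ennreal\<close> truncates it to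
        0.\<close>
      have "ennreal (norm (?F t) - D / 2 * ?G t) \<le> ?m t"
      proof (intro INF_greatest ennreal_leI)
        fix y assume "y \<in> ball t (d / ?R)"
        then have y: "?R * norm (t - y) \<le> d" by (simp add: dist_norm field_simps less_imp_le)
        then have "norm (?F t - ?F y) \<le> C * (?R * norm (t - y)) * D * ?G t"
          using d by (intro slow f FD) auto
        also have "\<dots> \<le> C * d * D * ?G t"
          using y C D by (intro mult_right_mono mult_left_mono) auto
        also have "\<dots> \<le> 1 / 2 * D * ?G t"
          using d D by (intro mult_right_mono) auto
        finally have "norm (?F t - ?F y) \<le> D / 2 * ?G t" by simp
        then show "norm (?F t) - D / 2 * ?G t \<le> norm (?F y)"
          using norm_triangle_ineq2[of "?F t" "?F y"] by linarith
      qed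
      then have *: "ennreal (norm (?F t) - D / 2 * ?G t) * ennreal (1 / ?G t) \<le> ?m t * ennreal (1 / ?G t)"
        by (rule mult_right_mono) simp
      have "norm (?F t) / ?G t = (norm (?F t) - D / 2 * ?G t) * (1 / ?G t) + D / 2"
      proof -
        have "?G t \<noteq> 0" using G[of t] by linarith
        moreover have "a / g = (a - D / 2 * g) * (1 / g) + D / 2" if "g \<noteq> 0" for a g :: real
          using that by (simp add: field_simps)
        ultimately show ?thesis by blast
      qed
      then have "ennreal (norm (?F t) / ?G t) \<le> ennreal ((norm (?F t) - D / 2 * ?G t) * (1 / ?G t)) + ennreal (D / 2)"
        using D by (intro ennreal_le_add) auto
      also have "ennreal ((norm (?F t) - D / 2 * ?G t) * (1 / ?G t)) = ennreal (norm (?F t) - D / 2 * ?G t) * ennreal (1 / ?G t)"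
        by (rule ennreal_mult'') simp
      also have "\<dots> + ennreal (D / 2) \<le> ?m t * ennreal (1 / ?G t) + ennreal (D / 2)"
        using * by (rule add_right_mono)
      finally show ?thesis .
    qed
    also have "?m t * ennreal (1 / ?G t) + ennreal (D / 2) \<le> ?S + ennreal (D / 2)" for t
      by (intro add_right_mono SUP_upper) simp
    finally have "peetre_maximal E \<phi> j s f w \<le> ?S + ennreal (D / 2)"
      unfolding peetre_maximal_def by (intro SUP_least)
    then have le: "ennreal D \<le> ?S + ennreal (D / 2)" unfolding D(1) .
    show "peetre_maximal E \<phi> j s f w \<le> 2 * ?S"
    proof (cases ?S)
      case (real z)
      then have "ennreal D \<le> ennreal (z + D / 2)" using le D unfolding real(2) by simp
      then have "D \<le> 2 * z" using real D by (subst (asm) ennreal_le_iff) auto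
      then have "ennreal D \<le> ennreal (2 * z)" by (rule ennreal_leI)
      also have "\<dots> = 2 * ?S" unfolding real(2) using real(1) by (simp add: ennreal_mult)
      finally show ?thesis unfolding D(1) .
    next
      case top
      show ?thesis unfolding top by (simp add: ennreal_mult_top)
    qed
  qed
  then show ?thesis using d by blast
qed

end

end

section \<open>From the power estimates to the quasi-norms\<close>

lemma equivalent_onI:
  assumes C: "C > 0" and 1: "\<And>f. f \<in> S \<Longrightarrow> A f \<le> B f" and 2: "\<And>f. f \<in> S \<Longrightarrow> B f \<le> ennreal C * A f"
  shows "equivalent_on S A B"
  unfolding equivalent_on_def
proof (intro exI[of _ "max 1 C"] conjI ballI)
  fix f assume f: "f \<in> S"
  have "ennreal (1 / max 1 C) * A f \<le> 1 * A f"
    using C by (intro mult_right_mono) (auto simp: field_simps)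
  then show "ennreal (1 / max 1 C) * A f \<le> B f" using 1[OF f] by simp
  have "ennreal C * A f \<le> ennreal (max 1 C) * A f" by (intro mult_right_mono ennreal_leI) auto
  then show "B f \<le> ennreal (max 1 C) * A f" using 2[OF f] order_trans by blast
qed simp

lemma epowr_le_cmult:
  assumes "a > 0" "C > 0" "X \<le> ennreal C * Y"
  shows "epowr X a \<le> ennreal (C powr a) * epowr Y a"
proof -
  have "epowr X a \<le> epowr (ennreal C * Y) a" using assms by (intro epowr_mono) auto
  also have "\<dots> = ennreal (C powr a) * epowr Y a" using assms by (simp add: epowr_mult epowr_ennreal)
  finally show ?thesis .
qed

lemma lq_norm_infinity: "lq_norm \<alpha> \<infinity> a = (SUP j. ennreal (2 powr (of_int j * \<alpha>)) * a j)"
  by (simp add: lq_norm_def)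

lemma lq_norm_finite:
  assumes "q > 0"
  shows "lq_norm \<alpha> (ennreal q) a = epowr (int_sum (\<lambda>j. epowr (ennreal (2 powr (of_int j * \<alpha>)) * a j) q)) (1 / q)"
  using assms by (simp add: lq_norm_def epowr_mult epowr_ennreal powr_powr)

lemma lq_norm_mono:
  assumes "q > 0" "\<And>j. a j \<le> b j"
  shows "lq_norm \<alpha> q a \<le> lq_norm \<alpha> q b"
proof (cases q)
  case (real q')
  then show ?thesis using assms
    by (auto simp: lq_norm_finite intro!: epowr_mono nn_integral_mono mult_left_mono)
next
  case top
  then show ?thesis using assms lq_norm_infinity
    by (auto intro!: SUP_mono' mult_left_mono)
qed

lemma lq_norm_cmult:
  assumes "q > 0" "C \<ge> 0"
  shows "lq_norm \<alpha> q (\<lambda>j. ennreal C * a j) = ennreal C * lq_norm \<alpha> q a"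
proof (cases q)
  case (real q')
  then have q': "q' > 0" using assms by auto
  have "lq_norm \<alpha> q (\<lambda>j. ennreal C * a j) =
      epowr (int_sum (\<lambda>j. epowr (ennreal C) q' * epowr (ennreal (2 powr (of_int j * \<alpha>)) * a j) q')) (1 / q')"
    unfolding real(2) lq_norm_finite[OF q'] using q' by (simp add: epowr_mult mult_ac)
  also have "(int_sum (\<lambda>j. epowr (ennreal C) q' * epowr (ennreal (2 powr (of_int j * \<alpha>)) * a j) q')) =
      epowr (ennreal C) q' * (int_sum (\<lambda>j. epowr (ennreal (2 powr (of_int j * \<alpha>)) * a j) q'))"
    by (rule nn_integral_cmult) simp
  also have "epowr \<dots> (1 / q') = ennreal C * lq_norm \<alpha> q a"
    unfolding real(2) lq_norm_finite[OF q'] using q' by (simp add: epowr_mult epowr_epowr)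
  finally show ?thesis .
next
  case top
  have "(SUP j. ennreal (2 powr (of_int j * \<alpha>)) * (ennreal C * a j)) = (SUP j. ennreal C * (ennreal (2 powr (of_int j * \<alpha>)) * a j))"
    by (simp only: mult.left_commute)
  then show ?thesis using top lq_norm_infinity by (simp add: SUP_mult_left_ennreal)
qed

lemma Lp_norm_finite: "p > 0 \<Longrightarrow> Lp_norm (ennreal p) F = epowr (\<integral>\<^sup>+x. epowr (F x) p \<partial>lborel) (1 / p)"
  by (simp add: Lp_norm_def)

lemma Lp_norm_mono:
  assumes "p > 0" "F \<in> borel_measurable borel" "\<And>x. F x \<le> G x"
  shows "Lp_norm p F \<le> Lp_norm p G"
proof (cases p)
  case (real p')
  then show ?thesis using assms by (auto simp: Lp_norm_finite intro!: epowr_mono nn_integral_mono)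
next
  case top
  then show ?thesis using assms by (simp add: Lp_norm_def esssup_mono)
qed

text \<open>The set where \<open>g\<close> exceeds its essential supremum is open and null, hence
  empty.\<close>

lemma le_esssup_continuous:
  fixes g :: "'a::euclidean_space \<Rightarrow> real"
  assumes g: "continuous_on UNIV g"
  shows "ennreal (g x) \<le> esssup lborel (\<lambda>x. ennreal (g x))"
proof (rule ccontr)
  let ?h = "\<lambda>x. ennreal (g x)"
  let ?S = "{x. esssup lborel ?h < ?h x}"
  assume "\<not> ?thesis"
  then have x: "x \<in> ?S" by simp
  have S: "open ?S" by (intro open_Collect_less continuous_on_const continuous_on_ennreal g)
  have "?S \<in> null_sets lborel"
    using esssup_zero_measure[of lborel ?h] S by (auto intro: null_setsI)
  then have "negligible ?S" using negligible_iff_null_sets null_sets_completionI by blast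
  then show False using open_not_negligible[OF S] x by blast
qed

lemma divide_less_ennrealD:
  assumes "of_nat n / ennreal p < ennreal s" "p > 0"
  shows "s > 0" "s * p > real n"
proof -
  have "ennreal (real n / p) < ennreal s"
    using assms by (simp add: divide_ennreal ennreal_of_nat_eq_real_of_nat)
  then have "real n / p < s" using assms by (subst (asm) ennreal_less_iff) auto
  then show "s * p > real n" using assms by (simp add: field_simps)
  have "0 \<le> real n / p" using assms by simp
  then show "s > 0" using \<open>real n / p < s\<close> by linarith
qed

context spectral_kernel
begin

text \<open>The estimate holds for each \<open>j\<close> with a constant independent of
  \<open>j\<close>, so monotonicity and homogeneity of the sequence norm finish the proof. For
  infinite \<open>p\<close> the Peetre weight is at least 1, and continuity identifies pointwise
  with essential bounds.\<close>

lemma besov_equivalence: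
  assumes \<phi>: "dyadic_family \<phi>" and p: "0 < p" and q: "0 < q" and s: "of_nat CARD('n) / p < ennreal s"
  shows "equivalent_on schwartz_space (besov_norm E \<phi> \<alpha> p q) (\<lambda>f. lq_norm \<alpha> q (\<lambda>j. Lp_norm p (peetre_maximal E \<phi> j s f)))"
proof -
  \<comment> \<open>\<open>ennreal s\<close> is 0 for \<open>s\<close> at most 0, so the strict
    inequality forces positivity even when the quotient vanishes for infinite
    \<open>p\<close>.\<close>
  have s0: "s > 0" using s by (metis ennreal_less_zero_iff not_gr_zero not_less_zero zero_less_iff_neq_zero)
  let ?u = "\<lambda>f j x. ennreal (norm (spectral_apply E (\<phi> j) f x))"
  have m: "?u f j \<in> borel_measurable borel" if "f \<in> schwartz_space" for f j
    by (intro borel_measurable_continuous_onI continuous_on_ennreal continuous_on_norm spectral_apply_regular \<phi> that)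
  have "\<exists>C>0. \<forall>f\<in>schwartz_space. \<forall>j. Lp_norm p (peetre_maximal E \<phi> j s f) \<le> ennreal C * Lp_norm p (?u f j)"
  proof (cases p)
    case (real p')
    then have p': "p' > 0" using p by auto
    have sp: "s * p' > real DIM(real^'n)" using divide_less_ennrealD[of "CARD('n)" p' s] s p' real by simp
    obtain d where d: "0 < d" "d \<le> 1" and dom: "\<And>f. f \<in> schwartz_space \<Longrightarrow> dominated d s (?u f) (\<lambda>j. peetre_maximal E \<phi> j s f)"
      using peetre_dominated[OF \<phi> s0] by blast
    obtain C where C: "C > 0" "\<And>(u :: int \<Rightarrow> real^'n \<Rightarrow> ennreal) v j. dominated d s u v \<Longrightarrow>
      (\<integral>\<^sup>+x. epowr (v j x) p' \<partial>lborel) \<le> ennreal C * (\<integral>\<^sup>+x. epowr (u j x) p' \<partial>lborel)"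
      using dominated_Lp[OF s0 p' d sp] by blast
    have "Lp_norm p (peetre_maximal E \<phi> j s f) \<le> ennreal (C powr (1 / p')) * Lp_norm p (?u f j)" if "f \<in> schwartz_space" for f j
      unfolding real(2) Lp_norm_finite[OF p'] using C(2)[OF dom[OF that], of j] C(1) p' by (intro epowr_le_cmult) auto
    then show ?thesis using C(1) by (intro exI[of _ "C powr (1 / p')"]) auto
  next
    case top
    have "Lp_norm p (peetre_maximal E \<phi> j s f) \<le> ennreal 1 * Lp_norm p (?u f j)" if f: "f \<in> schwartz_space" for f j
    proof -
      have "peetre_maximal E \<phi> j s f x \<le> esssup lborel (?u f j)" for x
        unfolding peetre_maximal_def
      proof (rule SUP_least)
        fix t
        have "(1 + freq j * norm (x - t)) powr s \<ge> 1"
          using s0 by (intro ge_one_powr_ge_zero) auto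
        then have "norm (spectral_apply E (\<phi> j) f t) / (1 + freq j * norm (x - t)) powr s \<le> norm (spectral_apply E (\<phi> j) f t) / 1"
          by (intro divide_left_mono) auto
        then have "ennreal (norm (spectral_apply E (\<phi> j) f t) / (1 + freq j * norm (x - t)) powr s) \<le> ?u f j t"
          by (intro ennreal_leI) simp
        also have "\<dots> \<le> esssup lborel (?u f j)"
          by (intro le_esssup_continuous continuous_on_norm spectral_apply_regular \<phi> f)
        finally show "ennreal (norm (spectral_apply E (\<phi> j) f t) / (1 + freq j * norm (x - t)) powr s) \<le> esssup lborel (?u f j)" .
      qed
      moreover have "peetre_maximal E \<phi> j s f \<in> borel_measurable lborel" using peetre_measurable[OF \<phi> s0] by simp
      ultimately show ?thesis using top by (simp add: Lp_norm_def esssup_I)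
    qed
    then show ?thesis by (intro exI[of _ 1]) auto
  qed
  then obtain C where C: "C > 0" "\<And>f j. f \<in> schwartz_space \<Longrightarrow> Lp_norm p (peetre_maximal E \<phi> j s f) \<le> ennreal C * Lp_norm p (?u f j)"
    by blast
  show ?thesis
  proof (rule equivalent_onI[OF C(1)])
    fix f :: "real^'n \<Rightarrow> complex" assume f: "f \<in> schwartz_space"
    show "besov_norm E \<phi> \<alpha> p q f \<le> lq_norm \<alpha> q (\<lambda>j. Lp_norm p (peetre_maximal E \<phi> j s f))"
      unfolding besov_norm_def
      by (intro lq_norm_mono[OF q] Lp_norm_mono[OF p m[OF f]] spectral_apply_le_peetre[OF \<phi> s0])
    have "lq_norm \<alpha> q (\<lambda>j. Lp_norm p (peetre_maximal E \<phi> j s f)) \<le> lq_norm \<alpha> q (\<lambda>j. ennreal C * Lp_norm p (?u f j))"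
      by (intro lq_norm_mono[OF q] C f)
    also have "\<dots> = ennreal C * besov_norm E \<phi> \<alpha> p q f"
      unfolding besov_norm_def using C by (intro lq_norm_cmult[OF q]) simp
    finally show "lq_norm \<alpha> q (\<lambda>j. Lp_norm p (peetre_maximal E \<phi> j s f)) \<le> ennreal C * besov_norm E \<phi> \<alpha> p q f" .
  qed
qed

text \<open>For finite \<open>q\<close> the \<open>p\<close>-th power of the quasi-norm is an
  integral with outer exponent \<open>p' / q'\<close>, and the position of this exponent relative to
  1 selects the square function bound. Infinite \<open>q\<close> has its own bound for
  suprema.\<close>

lemma triebel_lizorkin_equivalence:
  assumes \<phi>: "dyadic_family \<phi>" and p: "0 < p" "p < \<infinity>" and q: "0 < q" and s: "of_nat CARD('n) / min p q < ennreal s"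
  shows "equivalent_on schwartz_space (triebel_lizorkin_norm E \<phi> \<alpha> p q)
    (\<lambda>f. Lp_norm p (\<lambda>x. lq_norm \<alpha> q (\<lambda>j. peetre_maximal E \<phi> j s f x)))"
proof -
  obtain p' where p': "p = ennreal p'" "p' > 0" using p by (cases p) auto
  let ?u = "\<lambda>f j x. ennreal (norm (spectral_apply E (\<phi> j) f x))"
  let ?w = "\<lambda>j. ennreal (2 powr (of_int j * \<alpha>))"
  have m: "?u f j \<in> borel_measurable borel" if "f \<in> schwartz_space" for f j
    by (intro borel_measurable_continuous_onI continuous_on_ennreal continuous_on_norm spectral_apply_regular \<phi> that)
  have s0: "s > 0" using s by (metis ennreal_less_zero_iff not_gr_zero not_less_zero zero_less_iff_neq_zero)
  obtain d where d: "0 < d" "d \<le> 1" and dom0: "\<And>f. f \<in> schwartz_space \<Longrightarrow> dominated d s (?u f) (\<lambda>j. peetre_maximal E \<phi> j s f)"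
    using peetre_dominated[OF \<phi> s0] by blast
  have dom: "dominated d s (\<lambda>j x. ?w j * ?u f j x) (\<lambda>j x. ?w j * peetre_maximal E \<phi> j s f x)" if "f \<in> schwartz_space" for f
    by (rule dominated_cmult[OF dom0[OF that]])
  have wm: "(\<lambda>x. ?w j * peetre_maximal E \<phi> j s f x) \<in> borel_measurable borel" for f j
    using peetre_measurable[OF \<phi> s0] by measurable
  have "\<exists>C>0. \<forall>f\<in>schwartz_space. Lp_norm p (\<lambda>x. lq_norm \<alpha> q (\<lambda>j. peetre_maximal E \<phi> j s f x)) \<le>
      ennreal C * triebel_lizorkin_norm E \<phi> \<alpha> p q f"
  proof (cases q)
    case (real q')
    then have q': "q' > 0" using q by auto
    have mn: "min p q = ennreal (min p' q')" using p' real by (auto simp: min_def)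
    have sm: "s * min p' q' > real DIM(real^'n)"
      using divide_less_ennrealD[of "CARD('n)" "min p' q'" s] s p' q' unfolding mn by simp
    have norm_eq: "Lp_norm p (\<lambda>x. lq_norm \<alpha> q (\<lambda>j. a j x)) =
        epowr (\<integral>\<^sup>+x. epowr (int_sum (\<lambda>j. epowr (?w j * a j x) q')) (p' / q') \<partial>lborel) (1 / p')" for a :: "int \<Rightarrow> real^'n \<Rightarrow> ennreal"
      unfolding p'(1) real(2) Lp_norm_finite[OF p'(2)] lq_norm_finite[OF q'] by (simp add: epowr_epowr)
    have "controlled d s (\<lambda>u :: int \<Rightarrow> real^'n \<Rightarrow> ennreal. \<integral>\<^sup>+x. epowr (int_sum (\<lambda>j. epowr (u j x) q')) (p' / q') \<partial>lborel)"
    proof (cases p' q' rule: linorder_cases)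
      case less
      then show ?thesis using sm by (intro square_function_greater[OF s0 p'(2) _ d]) auto
    next
      case equal
      then have "p' / q' = 1" using q' by simp
      then show ?thesis using sm equal square_function_eq[OF s0 q' d, where 'a="real^'n"] by simp
    next
      case greater
      then show ?thesis using sm by (intro square_function_less[OF s0 q' _ d]) auto
    qed
    from controlledE[OF this] obtain C where C: "C > 0"
      "\<And>u v :: int \<Rightarrow> real^'n \<Rightarrow> ennreal. dominated d s u v \<Longrightarrow> (\<And>j. v j \<in> borel_measurable borel) \<Longrightarrow>
        (\<integral>\<^sup>+x. epowr (int_sum (\<lambda>j. epowr (v j x) q')) (p' / q') \<partial>lborel) \<le>
        ennreal C * (\<integral>\<^sup>+x. epowr (int_sum (\<lambda>j. epowr (u j x) q')) (p' / q') \<partial>lborel)" by blast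
    have "Lp_norm p (\<lambda>x. lq_norm \<alpha> q (\<lambda>j. peetre_maximal E \<phi> j s f x)) \<le> ennreal (C powr (1 / p')) * triebel_lizorkin_norm E \<phi> \<alpha> p q f"
      if "f \<in> schwartz_space" for f
      unfolding triebel_lizorkin_norm_def norm_eq using C(1) p' by (intro epowr_le_cmult C(2)[OF dom[OF that] wm]) auto
    then show ?thesis using C(1) by (intro exI[of _ "C powr (1 / p')"]) auto
  next
    case top
    then have mn: "min p q = ennreal p'" using p' by (simp add: min_def)
    have sp: "s * p' > real DIM(real^'n)"
      using divide_less_ennrealD[of "CARD('n)" p' s] s p' unfolding mn by simp
    have norm_eq: "Lp_norm p (\<lambda>x. lq_norm \<alpha> q (\<lambda>j. a j x)) =
        epowr (\<integral>\<^sup>+x. epowr (SUP j. ?w j * a j x) p' \<partial>lborel) (1 / p')" for a :: "int \<Rightarrow> real^'n \<Rightarrow> ennreal"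
      unfolding p'(1) Lp_norm_finite[OF p'(2)] using top lq_norm_infinity by simp
    from controlledE[OF square_function_sup[OF s0 p'(2) d sp]] obtain C where C: "C > 0"
      "\<And>u v :: int \<Rightarrow> real^'n \<Rightarrow> ennreal. dominated d s u v \<Longrightarrow> (\<And>j. v j \<in> borel_measurable borel) \<Longrightarrow>
        (\<integral>\<^sup>+x. epowr (SUP j. v j x) p' \<partial>lborel) \<le> ennreal C * (\<integral>\<^sup>+x. epowr (SUP j. u j x) p' \<partial>lborel)" by blast
    have "Lp_norm p (\<lambda>x. lq_norm \<alpha> q (\<lambda>j. peetre_maximal E \<phi> j s f x)) \<le> ennreal (C powr (1 / p')) * triebel_lizorkin_norm E \<phi> \<alpha> p q f"
      if "f \<in> schwartz_space" for f
      unfolding triebel_lizorkin_norm_def norm_eq using C(1) p' by (intro epowr_le_cmult C(2)[OF dom[OF that] wm]) auto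
    then show ?thesis using C(1) by (intro exI[of _ "C powr (1 / p')"]) auto
  qed
  then obtain C where C: "C > 0" "\<And>f. f \<in> schwartz_space \<Longrightarrow> Lp_norm p (\<lambda>x. lq_norm \<alpha> q (\<lambda>j. peetre_maximal E \<phi> j s f x)) \<le>
      ennreal C * triebel_lizorkin_norm E \<phi> \<alpha> p q f" by blast
  show ?thesis
  proof (rule equivalent_onI[OF C(1) _ C(2)])
    fix f :: "real^'n \<Rightarrow> complex"
    show "triebel_lizorkin_norm E \<phi> \<alpha> p q f \<le> Lp_norm p (\<lambda>x. lq_norm \<alpha> q (\<lambda>j. peetre_maximal E \<phi> j s f x))"
      unfolding triebel_lizorkin_norm_def p'(1) Lp_norm_finite[OF p'(2)] using p'
      by (intro epowr_mono nn_integral_mono lq_norm_mono[OF q] spectral_apply_le_peetre[OF \<phi> s0]) auto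
  qed
qed

end

theorem theorem1p3:
  fixes V :: "real^'n \<Rightarrow> real"
    and H :: "(real^'n) l2_operator"
    and E :: "real set \<Rightarrow> (real^'n \<Rightarrow> complex) \<Rightarrow> (real^'n \<Rightarrow> complex)"
    and \<phi> :: "int \<Rightarrow> real \<Rightarrow> complex"
  assumes "schrodinger_operator V H"
    and "spectral_resolution H E"
    and "kernel_decay E"
    and "dyadic_system \<phi>"
  shows "(\<forall>(p::ennreal) (q::ennreal) (\<alpha>::real) (s::real).
            0 < p \<and> 0 < q \<and> of_nat CARD('n) / p < ennreal s \<longrightarrow>
            equivalent_on schwartz_space
              (besov_norm E \<phi> \<alpha> p q)
              (\<lambda>f. lq_norm \<alpha> q (\<lambda>j. Lp_norm p (peetre_maximal E \<phi> j s f)))) \<and>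
         (\<forall>(p::ennreal) (q::ennreal) (\<alpha>::real) (s::real).
            0 < p \<and> p < \<infinity> \<and> 0 < q \<and> of_nat CARD('n) / min p q < ennreal s \<longrightarrow>
            equivalent_on schwartz_space
              (triebel_lizorkin_norm E \<phi> \<alpha> p q)
              (\<lambda>f. Lp_norm p (\<lambda>x. lq_norm \<alpha> q (\<lambda>j. peetre_maximal E \<phi> j s f x))))"
proof -
  interpret spectral_kernel E
    using assms(2,3) by unfold_locales (simp_all add: spectral_resolution_def)
  have \<phi>: "dyadic_family \<phi>" using assms(4) by (simp add: dyadic_system_def)
  show ?thesis
    using besov_equivalence[OF \<phi>] triebel_lizorkin_equivalence[OF \<phi>] by blast
qed

end
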